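(* Let $Q$ be a monic cubic polynomial and $P$ a polynomial of degree at most $2$. Let $N\subset\mathbb N$ be infinite and, for each $n\in N$, let $V_n(z)$ be a polynomial of degree exactly $1$ such that the equation $Q(z)S''+P(z)S'+V_n(z)S=0$ has a polynomial solution $S_n$ of degree exactly $n$. Let $\widetilde V_n$ be the monic polynomial proportional to $V_n$ and assume $\widetilde V_n\to\widetilde V$ as $n\to\infty$, $n\in N$, where $\widetilde V$ is a monic linear polynomial. Then the root-counting measures $\nu_n$ of $S_n$ converge weakly (as $n\to\infty$, $n\in N$) to the unique probability measure $\nu_{\widetilde V}$ whose Cauchy transform $\mathcal C_{\widetilde V}$ satisfies $\mathcal C_{\widetilde V}^2(z)=\frac{\widetilde V(z)}{Q(z)}$ for almost every $z\in\mathbb C$.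
   Context: The root-counting measure of a polynomial $S$ of degree $n$ with roots $z_1,\dots,z_n$ (with multiplicity) is $\frac1n\sum_{i}\delta_{z_i}$. The Cauchy transform of a compactly supported measure $\nu$ on $\mathbb C$ is $\mathcal C_\nu(z)=\int_{\mathbb C}\frac{d\nu(\xi)}{z-\xi}$. *)

theory Defs
  imports "HOL-Analysis.Analysis" "HOL-Computational_Algebra.Polynomial" "HOL-Probability.Probability_Measure"
begin

definition root_counting_measure :: "complex poly \<Rightarrow> complex measure" where
  "root_counting_measure p =
     measure_of UNIV (sets borel)
       (\<lambda>A. ennreal ((\<Sum>z\<in>{z. poly p z = 0} \<inter> A. real (order z p)) / real (degree p)))"

definition cauchy_transform :: "complex measure \<Rightarrow> complex \<Rightarrow> complex" where
  "cauchy_transform \<nu> z = (\<integral>\<xi>. 1 / (z - \<xi>) \<partial>\<nu>)"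

definition weak_conv_along ::
    "(nat \<Rightarrow> complex measure) \<Rightarrow> complex measure \<Rightarrow> nat filter \<Rightarrow> bool" where
  "weak_conv_along M \<mu> F \<longleftrightarrow>
     (\<forall>f :: complex \<Rightarrow> real. continuous_on UNIV f \<and> bounded (range f) \<longrightarrow>
        ((\<lambda>n. \<integral>x. f x \<partial>(M n)) \<longlongrightarrow> (\<integral>x. f x \<partial>\<mu>)) F)"

end

theory Submission
  imports Defs "HOL-Probability.Probability" "HOL-Real_Asymp.Real_Asymp"
    "HOL-Computational_Algebra.Fundamental_Theorem_Algebra"
begin

text \<open>
  Convergence. A root of maximal modulus outside a fixed disc is simple, and evaluating the equation there
  bounds the degree of the solution, so all roots stay in one disc and weak limits exist along subsequences. The function
  \<open>C = S'/(n S)\<close> satisfies the Riccati equation \<open>Q (C\<^sup>2 + C'/n) + P C/n + V/n\<^sup>2 = 0\<close>.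
  Here \<open>C\<close> converges in \<open>L\<^sup>1\<close> on discs because its kernel is locally integrable, while \<open>C'/n\<close>
  tends to \<open>0\<close> in \<open>L\<^sup>p\<close> with \<open>p = 3/4\<close>, since a \<open>p\<close>-th power with \<open>p < 1\<close> is subadditive over the
  roots; passing to an almost everywhere convergent subsequence gives \<open>Q C\<^sup>2 = V\<close> for the limit.

  Uniqueness. Let \<open>u\<^sub>1\<close>, \<open>u\<^sub>2\<close> be the logarithmic potentials of two solutions; they agree near infinity
  and \<open>|\<nabla>u\<^sub>1| = |\<nabla>u\<^sub>2|\<close> almost everywhere. Put \<open>T(t) = max(0, t + M)\<^sup>2\<close> and \<open>W = T(u\<^sub>2) - T(u\<^sub>1)\<close>.
  Testing the Laplacian of \<open>u\<^sub>1 + u\<^sub>2\<close> against \<open>W\<^sup>2\<close> gives a nonnegative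
  Dirichlet integral and a nonpositive integral of \<open>W\<^sup>2\<close> with respect to the measures, so both vanish. Testing the Laplacian of
  \<open>u\<^sub>2 - u\<^sub>1\<close> against \<open>W\<close> then yields \<open>\<integral> (T'(u\<^sub>1) + T'(u\<^sub>2)) |\<nabla>u\<^sub>1 - \<nabla>u\<^sub>2|\<^sup>2 = 0\<close>.
  The truncation \<open>T\<close> removes the poles of \<open>V/Q\<close> of order at least two, which are atoms of both measures; the
  remaining singularities of the gradients are of order \<open>1/2\<close>.
\<close>

section \<open>Local integrability of Riesz kernels\<close>

text \<open>The identity C^2 = V/Q leaves the sign of C open at almost every point, and nothing says
  in advance where it jumps; this is the obstacle to uniqueness. As conj C is the gradient of the
  potential, equal squares give gradients of equal length. With \<rho> the common squared length and
  c the inner product of the gradients, testing the sum against W^2 produces the factor \<rho> + c,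
  testing the difference against W produces \<rho> - c, and both are nonnegative by Cauchy-Schwarz.
  The signs also need T and T' nondecreasing, so that W and T'(u_2) - T'(u_1) agree in sign. T(u)
  becomes a C^1 test function once ln|z| is replaced by ln(|z|^2 + e^2)/2; a squared positive part
  is used because it is C^1. The measures may be singular with respect to area, so integrals of W
  against them are only formed for e > 0 and enter as limits. The exponents are tied together: the
  regularisation error is estimated by e^(1/4) |z|^(-5/4), and 5/4 + 1/2 < 2 leaves room for a
  second gradient with a singularity of order 1/2.\<close>

lemma ball_in_borel [measurable]: "ball a r \<in> sets borel" "cball a r \<in> sets borel"
  by auto

text \<open>The integrand takes the value \<open>top\<close> at the origin because
  \<open>0 powr - q\<close> is 0 in HOL. The planar estimate multiplies two such functions and needs
  a majorant on the coordinate axes as well.\<close>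

lemma nn_integral_powr_Icc:
  fixes q r :: real
  assumes "0 \<le> q" "q < 1" "0 < r"
  shows "(\<integral>\<^sup>+x. (if \<bar>x\<bar> \<le> r then (if x = 0 then top else ennreal (\<bar>x\<bar> powr - q)) else 0) \<partial>lborel)
           = ennreal (2 * r powr (1 - q) / (1 - q))"
proof -
  have hi: "((\<lambda>x. x powr (-q)) has_integral (r powr (-q+1) / (-q+1))) {0..r}"
    by (rule has_integral_powr_from_0) (use assms in auto)
  have 1: "(\<integral>\<^sup>+x. ennreal (x powr (-q)) * indicator {0..r} x \<partial>lborel) = ennreal (r powr (1-q) / (1-q))"
  proof -
    have "((\<lambda>x. x powr (-q) * indicator {0..r} x) has_integral (r powr (-q+1) / (-q+1))) UNIV"
      using hi by (subst (asm) has_integral_restrict_UNIV[symmetric]) (simp add: indicator_def of_bool_def if_distrib cong: if_cong)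
    then have "(\<integral>\<^sup>+x. ennreal (x powr (-q) * indicator {0..r} x) \<partial>lborel) = ennreal (r powr (-q+1) / (-q+1))"
      by (intro nn_integral_has_integral_lborel) auto
    then show ?thesis by (simp add: ennreal_mult'' ennreal_indicator algebra_simps)
  qed
  have 2: "(\<integral>\<^sup>+x. ennreal ((-x) powr (-q)) * indicator {0..r} (-x) \<partial>lborel) = ennreal (r powr (1-q) / (1-q))"
    using nn_integral_real_affine[of "\<lambda>x. ennreal (x powr (-q)) * indicator {0..r} x" "-1" 0] 1 by simp
  have "(\<integral>\<^sup>+x. (if \<bar>x\<bar> \<le> r then (if x = 0 then top else ennreal (\<bar>x\<bar> powr - q)) else 0) \<partial>lborel)
      = (\<integral>\<^sup>+x. ennreal (x powr (-q)) * indicator {0..r} x + ennreal ((-x) powr (-q)) * indicator {0..r} (-x) \<partial>lborel)"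
    by (intro nn_integral_cong_AE eventually_mono[OF AE_lborel_singleton[of "0::real"]])
       (auto simp: indicator_def abs_if)
  also have "\<dots> = ennreal (r powr (1-q) / (1-q)) + ennreal (r powr (1-q) / (1-q))"
    by (subst nn_integral_add) (auto simp only: 1 2, measurable)
  also have "\<dots> = ennreal (2 * r powr (1 - q) / (1 - q))"
    using assms by (simp flip: ennreal_plus add: ennreal_plus[symmetric])
  finally show ?thesis .
qed

text \<open>Polar coordinates are avoided: |Re z| |Im z| \<le> |z|^2 gives |z|^(-p) \<le> |Re
  z|^(-p/2) |Im z|^(-p/2), and the right side factors over the enclosing square. Each factor is
  integrable since p/2 < 1.\<close>

lemma nn_integral_norm_powr_cball:
  fixes a :: complex and p r :: real
  assumes "0 \<le> p" "p < 2" "0 < r"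
  shows "(\<integral>\<^sup>+z. ennreal (norm (z - a) powr - p) * indicator (cball a r) z \<partial>lborel)
           \<le> ennreal ((2 * r powr (1 - p/2) / (1 - p/2))\<^sup>2)"
proof -
  define f :: "real \<Rightarrow> ennreal" where
    "f = (\<lambda>x. if \<bar>x\<bar> \<le> r then (if x = 0 then top else ennreal (\<bar>x\<bar> powr - (p/2))) else 0)"
  have [measurable]: "f \<in> borel_measurable borel" unfolding f_def by measurable
  have fpos: "f x > 0" if "\<bar>x\<bar> \<le> r" for x using that by (auto simp: f_def)
  have le: "ennreal (norm z powr - p) * indicator (cball 0 r) z \<le> f (Re z) * f (Im z)" for z
  proof (cases "norm z \<le> r")
    case True
    then have R: "\<bar>Re z\<bar> \<le> r" "\<bar>Im z\<bar> \<le> r" using abs_Re_le_cmod[of z] abs_Im_le_cmod[of z] by linarith+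
    show ?thesis
    proof (cases "Re z = 0 \<or> Im z = 0")
      case True
      then have "f (Re z) * f (Im z) = top" using fpos[OF R(1)] fpos[OF R(2)] R
        by (auto simp: f_def ennreal_top_mult ennreal_mult_top)
      then show ?thesis by simp
    next
      case False
      then have pos: "0 < \<bar>Re z\<bar>" "0 < \<bar>Im z\<bar>" "0 < norm z" by auto
      have "\<bar>Re z\<bar> * \<bar>Im z\<bar> \<le> norm z * norm z"
        by (intro mult_mono abs_Re_le_cmod abs_Im_le_cmod) auto
      then have "(norm z * norm z) powr (-(p/2)) \<le> (\<bar>Re z\<bar> * \<bar>Im z\<bar>) powr (-(p/2))"
        using pos assms by (intro powr_mono2') auto
      moreover have "(norm z * norm z) powr (-(p/2)) = norm z powr (-p)"
        using pos by (simp add: powr_mult flip: powr_add)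
      ultimately have "norm z powr (-p) \<le> \<bar>Re z\<bar> powr (-(p/2)) * \<bar>Im z\<bar> powr (-(p/2))"
        by (simp add: powr_mult)
      then show ?thesis using R False True by (simp add: f_def ennreal_mult[symmetric] del: ennreal_le_iff) 
          (auto simp: indicator_def intro!: ennreal_leI)
    qed
  qed (auto simp: indicator_def)
  have "(\<integral>\<^sup>+z. ennreal (norm (z - a) powr - p) * indicator (cball a r) z \<partial>lborel)
      = (\<integral>\<^sup>+(z::complex). ennreal (norm z powr - p) * indicator (cball 0 r) z \<partial>lborel)"
  proof -
    have "(\<integral>\<^sup>+z. ennreal (norm (z - a) powr - p) * indicator (cball a r) z \<partial>distr lborel borel ((+) a))
      = (\<integral>\<^sup>+(z::complex). ennreal (norm z powr - p) * indicator (cball 0 r) z \<partial>lborel)"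
      by (subst nn_integral_distr) (auto simp: indicator_def dist_norm intro!: nn_integral_cong)
    then show ?thesis by (simp add: lborel_distr_plus)
  qed
  also have "\<dots> \<le> (\<integral>\<^sup>+(z::complex). (\<Prod>b\<in>Basis. f (z \<bullet> b)) \<partial>lborel)"
    using le by (intro nn_integral_mono) (auto simp: Basis_complex_def)
  also have "\<dots> = (\<Prod>b\<in>(Basis::complex set). (\<integral>\<^sup>+x. f x \<partial>lborel))"
    by (rule nn_integral_lborel_prod) auto
  also have "\<dots> = ennreal ((2 * r powr (1 - p/2) / (1 - p/2))\<^sup>2)"
    using nn_integral_powr_Icc[of "p/2" r] assms
    by (simp add: Basis_complex_def f_def power2_eq_square flip: ennreal_mult)
  finally show ?thesis .
qed

definition riesz_const :: "real \<Rightarrow> real \<Rightarrow> real" where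
  "riesz_const p r = (2 * r powr (1 - p/2) / (1 - p/2))\<^sup>2"

lemma riesz_const_nonneg [simp]: "0 \<le> riesz_const p r" by (simp add: riesz_const_def)

text \<open>The disc around \<open>a\<close> sits in a disc around the pole \<open>\<xi>\<close>, so
  one constant serves all poles of norm at most \<open>s\<close>. This uniformity is what allows
  averaging over a measure.\<close>

lemma nn_integral_norm_powr_cball':
  fixes a \<xi> :: complex and p r :: real
  assumes "0 \<le> p" "p < 2" "0 < r" "norm \<xi> \<le> s" "norm a \<le> s"
  shows "(\<integral>\<^sup>+z. ennreal (norm (z - \<xi>) powr - p) * indicator (cball a r) z \<partial>lborel)
           \<le> ennreal (riesz_const p (r + 2 * s))"
proof -
  have "cball a r \<subseteq> cball \<xi> (r + 2 * s)"
  proof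
    fix z assume "z \<in> cball a r"
    then show "z \<in> cball \<xi> (r + 2 * s)"
      using assms(4,5) norm_triangle_ineq4[of \<xi> a] dist_triangle[of \<xi> z a] by (simp add: dist_norm)
  qed
  then have "(\<integral>\<^sup>+z. ennreal (norm (z - \<xi>) powr - p) * indicator (cball a r) z \<partial>lborel)
     \<le> (\<integral>\<^sup>+z. ennreal (norm (z - \<xi>) powr - p) * indicator (cball \<xi> (r + 2 * s)) z \<partial>lborel)"
    by (intro nn_integral_mono) (auto simp: indicator_def)
  also have "\<dots> \<le> ennreal (riesz_const p (r + 2 * s))"
    unfolding riesz_const_def using assms norm_ge_zero[of \<xi>]
    by (intro nn_integral_norm_powr_cball) (auto simp del: norm_ge_zero)
  finally show ?thesis .
qed

text \<open>At each point the closer of the two poles dominates: x^(-p) y^(-q) is at most the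
  smaller of x, y to the power -(p+q). The product is thus bounded by the sum of two one-pole
  kernels.\<close>

lemma nn_integral_two_norm_powr_cball:
  fixes a b \<xi> :: complex and p q r :: real
  assumes "0 \<le> p" "0 \<le> q" "p + q < 2" "0 < r" "norm \<xi> \<le> s" "norm a \<le> s" "norm b \<le> s"
  shows "(\<integral>\<^sup>+z. ennreal (norm (z - \<xi>) powr - p * norm (z - b) powr - q) * indicator (cball a r) z \<partial>lborel)
           \<le> ennreal (2 * riesz_const (p+q) (r + 2 * s))"
proof -
  have le: "x powr - p * y powr - q \<le> x powr - (p+q) + y powr - (p+q)" if "0 \<le> x" "0 \<le> y" for x y :: real
  proof (cases "x = 0 \<or> y = 0")
    case False
    then have "x > 0" "y > 0" using that by auto
    show ?thesis
    proof (cases "x \<le> y")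
      case True
      have "x powr - p * y powr - q \<le> x powr - p * x powr - q"
        using True \<open>x > 0\<close> assms by (intro mult_left_mono powr_mono2') auto
      then show ?thesis by (simp flip: powr_add add: algebra_simps add_increasing2)
    next
      case False
      have "x powr - p * y powr - q \<le> y powr - p * y powr - q"
        using False \<open>y > 0\<close> assms by (intro mult_right_mono powr_mono2') auto
      then show ?thesis by (simp flip: powr_add add: algebra_simps add_increasing)
    qed
  qed auto
  let ?I = "\<lambda>c z. ennreal (norm (z - c) powr - (p+q)) * indicator (cball a r) z"
  have m: "?I c \<in> borel_measurable lborel" for c by measurable
  have "(\<integral>\<^sup>+z. ennreal (norm (z - \<xi>) powr - p * norm (z - b) powr - q) * indicator (cball a r) z \<partial>lborel)
    \<le> (\<integral>\<^sup>+z. ?I \<xi> z + ?I b z \<partial>lborel)"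
    using le by (intro nn_integral_mono) (auto simp: indicator_def simp flip: ennreal_plus intro!: ennreal_leI)
  also have "\<dots> = (\<integral>\<^sup>+z. ?I \<xi> z \<partial>lborel) + (\<integral>\<^sup>+z. ?I b z \<partial>lborel)"
    by (intro nn_integral_add m)
  also have "\<dots> \<le> ennreal (riesz_const (p+q) (r + 2 * s)) + ennreal (riesz_const (p+q) (r + 2 * s))"
    using assms by (intro add_mono nn_integral_norm_powr_cball') auto
  also have "\<dots> = ennreal (2 * riesz_const (p+q) (r + 2 * s))" by (simp flip: ennreal_plus)
  finally show ?thesis .
qed

text \<open>The integrand is the Laplacian of ln(|z|^2 + 1)/2. Since (1 + x^2)(1 + y^2) \<le> (x^2 +
  y^2 + 1)^2, it is dominated by a product of two one-dimensional arctangent densities.\<close>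

lemma integrable_inverse_one_plus_norm_square_square:
  "integrable lborel (\<lambda>z::complex. 2 / ((norm z)\<^sup>2 + 1)\<^sup>2)"
proof (rule integrableI_bounded)
  define f :: "real \<Rightarrow> ennreal" where "f = (\<lambda>x. ennreal (inverse (1 + x\<^sup>2)))"
  have "integrable lborel (\<lambda>x::real. inverse (1 + x\<^sup>2))"
    using integrable_inverse_1_plus_square by (simp add: set_integrable_def)
  then have fin: "(\<integral>\<^sup>+x. f x \<partial>lborel) < top"
    unfolding f_def by (subst nn_integral_eq_integral) (auto)
  have [measurable]: "f \<in> borel_measurable borel" unfolding f_def by measurable
  have "ennreal (norm (2 / ((norm z)\<^sup>2 + 1)\<^sup>2)) \<le> 2 * (\<Prod>b\<in>Basis. f (z \<bullet> b))" for z :: complex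
  proof -
    have "(1 + (Re z)\<^sup>2) * (1 + (Im z)\<^sup>2) \<le> ((Re z)\<^sup>2 + (Im z)\<^sup>2 + 1)\<^sup>2"
      proof -
        have "((Re z)\<^sup>2 + (Im z)\<^sup>2 + 1)\<^sup>2 - (1 + (Re z)\<^sup>2) * (1 + (Im z)\<^sup>2)
           = (Re z)^4 + (Im z)^4 + (Re z)\<^sup>2 * (Im z)\<^sup>2 + (Re z)\<^sup>2 + (Im z)\<^sup>2"
          by (simp add: power2_eq_square power4_eq_xxxx algebra_simps)
        also have "\<dots> \<ge> 0" by simp
        finally show ?thesis by simp
      qed
    then have "1 / ((norm z)\<^sup>2 + 1)\<^sup>2 \<le> 1 / (1 + (Re z)\<^sup>2) * (1 / (1 + (Im z)\<^sup>2))"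
      unfolding times_divide_times_eq mult_1 by (intro divide_left_mono) (auto simp: cmod_power2 intro!: mult_pos_pos zero_less_power, simp_all add: add_nonneg_pos add_pos_nonneg)
    then have "ennreal (norm (2 / ((norm z)\<^sup>2 + 1)\<^sup>2)) \<le> ennreal (2 * (inverse (1 + (Re z)\<^sup>2) * inverse (1 + (Im z)\<^sup>2)))"
      by (intro ennreal_leI) (simp add: inverse_eq_divide)
    also have "\<dots> = 2 * (\<Prod>b\<in>Basis. f (z \<bullet> b))"
      by (simp add: Basis_complex_def f_def ennreal_mult)
    finally show ?thesis .
  qed
  then have "(\<integral>\<^sup>+(z::complex). ennreal (norm (2 / ((norm z)\<^sup>2 + 1)\<^sup>2)) \<partial>lborel)
      \<le> (\<integral>\<^sup>+(z::complex). 2 * (\<Prod>b\<in>Basis. f (z \<bullet> b)) \<partial>lborel)" 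
    by (intro nn_integral_mono) auto
  also have "\<dots> = 2 * (\<Prod>b\<in>(Basis::complex set). (\<integral>\<^sup>+x. f x \<partial>lborel))"
    using nn_integral_lborel_prod[of "\<lambda>_::complex. f"] by (subst nn_integral_cmult) auto
  also have "\<dots> < \<infinity>" using fin by (simp add: Basis_complex_def ennreal_mult_less_top)
  finally show "(\<integral>\<^sup>+(z::complex). ennreal (norm (2 / ((norm z)\<^sup>2 + 1)\<^sup>2)) \<partial>lborel) < \<infinity>" .
qed auto

section \<open>Green's formula for the Cauchy kernel\<close>

lemma integrable_norm_powr_cball:
  fixes a \<xi> :: complex
  assumes "0 \<le> p" "p < 2" "0 < r"
  shows "integrable lborel (\<lambda>z. norm (z - \<xi>) powr - p * indicator (cball a r) z :: real)"
proof (rule integrableI_bounded)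
  have "(\<integral>\<^sup>+z. ennreal (norm (z - \<xi>) powr - p) * indicator (cball a r) z \<partial>lborel)
      \<le> ennreal (riesz_const p (r + 2 * max (norm \<xi>) (norm a)))"
    using assms by (intro nn_integral_norm_powr_cball') auto
  also have "\<dots> < \<infinity>" by simp
  also have "(\<integral>\<^sup>+z. ennreal (norm (z - \<xi>) powr - p) * indicator (cball a r) z \<partial>lborel)
     = (\<integral>\<^sup>+z. ennreal (norm (norm (z - \<xi>) powr - p * indicator (cball a r) z :: real)) \<partial>lborel)"
    by (intro nn_integral_cong) (simp add: indicator_def)
  finally show "(\<integral>\<^sup>+z. ennreal (norm (norm (z - \<xi>) powr - p * indicator (cball a r) z :: real)) \<partial>lborel) < \<infinity>" .
qed measurable

lemma integrable_continuous_compact_support: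
  fixes f :: "'a::euclidean_space \<Rightarrow> 'b::{banach, second_countable_topology}"
  assumes "continuous_on UNIV f" "\<And>z. norm z > r \<Longrightarrow> f z = 0"
  shows "integrable lborel f"
proof -
  have "integrable lborel (\<lambda>x. indicator (cball 0 r) x *\<^sub>R f x)"
    by (intro borel_integrable_compact) (auto intro: continuous_on_subset assms)
  also have "(\<lambda>x. indicator (cball 0 r) x *\<^sub>R f x) = f"
    using assms(2) by (force simp: indicator_def)
  finally show ?thesis .
qed

lemma bounded_continuous_compact_support:
  fixes f :: "'a::euclidean_space \<Rightarrow> 'b::real_normed_vector"
  assumes "continuous_on UNIV f" "\<And>z. norm z > r \<Longrightarrow> f z = 0"
  obtains B where "0 \<le> B" "\<And>z. norm (f z) \<le> B"
proof -
  have "compact (f ` cball 0 r)"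
    by (intro compact_continuous_image continuous_on_subset[OF assms(1)]) auto
  then obtain B where B: "\<And>z. z \<in> cball 0 r \<Longrightarrow> norm (f z) \<le> B"
    using compact_imp_bounded bounded_iff by (metis image_eqI)
  have "norm (f z) \<le> max B 0" for z
    using B[of z] assms(2)[of z] by (cases "norm z \<le> r") auto
  then show ?thesis using that[of "max B 0"] by auto
qed

lemma integral_lborel_translate:
  fixes f :: "'a::euclidean_space \<Rightarrow> 'b::{banach, second_countable_topology}"
  assumes [measurable]: "f \<in> borel_measurable borel"
  shows "(\<integral>x. f (x + c) \<partial>lborel) = (\<integral>x. f x \<partial>lborel)"
proof -
  have "(\<integral>x. f x \<partial>lborel) = (\<integral>x. f x \<partial>distr lborel borel ((+) c))"
    by (simp add: lborel_distr_plus)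
  also have "\<dots> = (\<integral>x. f (x + c) \<partial>lborel)"
    by (subst integral_distr) (auto simp: add.commute)
  finally show ?thesis by simp
qed

lemma integral_lborel_affine:
  fixes f :: "'a::euclidean_space \<Rightarrow> 'b::{banach, second_countable_topology}"
  assumes [measurable]: "f \<in> borel_measurable borel" and c: "c \<noteq> 0"
  shows "(\<integral>x. f x \<partial>lborel) = \<bar>c\<bar> ^ DIM('a) *\<^sub>R (\<integral>x. f (t + c *\<^sub>R x) \<partial>lborel)"
  by (subst lborel_affine[OF c, of t]) (simp add: integral_density integral_distr)

lemma has_derivative_eq_0_outside:
  fixes f :: "'a::real_normed_vector \<Rightarrow> real"
  assumes "(f has_derivative f') (at z)" "\<And>z. norm z > r \<Longrightarrow> f z = 0" "norm z > r"
  shows "f' = (\<lambda>_. 0)"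
proof -
  have "((\<lambda>_. 0) has_derivative f') (at z)"
    by (rule has_derivative_transform_within_open[OF assms(1), of "{z. norm z > r}"])
       (use assms in \<open>auto intro!: open_Collect_less continuous_intros\<close>)
  then show ?thesis using has_derivative_unique has_derivative_const by blast
qed

text \<open>Translation invariance makes every difference quotient of \<open>f\<close> integrate to
  zero; the derivative inherits this by dominated convergence. It is the form of the divergence
  theorem used for all integrations by parts below.\<close>

lemma integral_derivative_eq_0:
  fixes f :: "'a::euclidean_space \<Rightarrow> real"
  assumes der: "\<And>z. (f has_derivative f' z) (at z)"
    and cont: "continuous_on UNIV (\<lambda>z. f' z h)"
    and supp: "\<And>z. norm z > r \<Longrightarrow> f z = 0"
  shows "(\<integral>z. f' z h \<partial>lborel) = 0"
proof -
  define t :: "nat \<Rightarrow> real" where "t n = inverse (real (Suc n))" for n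
  have t: "t n > 0" "t n \<le> 1" for n by (auto simp: t_def field_simps)
  have t0: "t \<longlonglongrightarrow> 0" unfolding t_def by (rule LIMSEQ_inverse_real_of_nat)
  have contf: "continuous_on UNIV f"
    using der by (auto intro!: continuous_at_imp_continuous_on has_derivative_continuous)
  have fm [measurable]: "f \<in> borel_measurable borel"
    by (intro borel_measurable_continuous_onI contf)
  have f'm: "(\<lambda>z. f' z h) \<in> borel_measurable borel"
    by (intro borel_measurable_continuous_onI cont)
  have f'0: "f' z h = 0" if "norm z > r" for z
    using has_derivative_eq_0_outside[OF der supp that] by auto
  obtain B where B: "0 \<le> B" "\<And>z. norm (f' z h) \<le> B"
    using bounded_continuous_compact_support[OF cont f'0] by blast
  define q where "q n z = (f (z + t n *\<^sub>R h) - f z) / t n" for n z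
  have qm: "q n \<in> borel_measurable borel" for n unfolding q_def by measurable
  have fint: "integrable lborel f"
    using integrable_continuous_compact_support[OF contf supp] by auto
  have "continuous_on UNIV (\<lambda>z. f (z + c))" for c :: 'a
    by (rule continuous_on_compose2[OF contf]) (auto intro!: continuous_intros)
  then have fint': "integrable lborel (\<lambda>z. f (z + c))" for c :: 'a
  proof (rule integrable_continuous_compact_support)
    fix z :: 'a assume "r + norm c < norm z"
    then show "f (z + c) = 0" using norm_triangle_ineq4[of "z + c" c] by (intro supp) auto
  qed
  have q0: "(\<integral>z. q n z \<partial>lborel) = 0" for n
    unfolding q_def using fint fint' by (simp add: integral_lborel_translate)
  \<comment> \<open>By the mean value theorem the quotient is a value of the derivative within
    distance |h|, because \<open>t n\<close> is at most 1. Hence all quotients are bounded by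
    \<open>B\<close> and vanish outside the disc of radius \<open>r + norm h\<close>.\<close>
  have qb: "\<exists>y. q n z = f' y h \<and> norm (y - z) \<le> norm h" for n z
  proof -
    have "((\<lambda>s. f (z + s *\<^sub>R h)) has_derivative (\<lambda>u. f' (z + s *\<^sub>R h) (u *\<^sub>R h))) (at s within {0..t n})" for s
      by (rule has_derivative_compose[of "\<lambda>s. z + s *\<^sub>R h" _ _ _ f, OF _ der]) (auto intro!: derivative_eq_intros)
    then obtain s where s: "s \<in> {0<..<t n}" "f (z + t n *\<^sub>R h) - f (z + 0 *\<^sub>R h) = f' (z + s *\<^sub>R h) ((t n - 0) *\<^sub>R h)"
      using mvt_simple[of 0 "t n" "\<lambda>s. f (z + s *\<^sub>R h)" "\<lambda>s u. f' (z + s *\<^sub>R h) (u *\<^sub>R h)"] t[of n] by auto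
    have "f' (z + s *\<^sub>R h) (t n *\<^sub>R h) = t n * f' (z + s *\<^sub>R h) h"
      using has_derivative_bounded_linear[OF der] by (simp add: linear_simps)
    then have "q n z = f' (z + s *\<^sub>R h) h" using s t[of n] by (simp add: q_def)
    moreover have "norm (z + s *\<^sub>R h - z) \<le> norm h"
      using s t[of n] by (auto intro!: mult_left_le_one_le)
    ultimately show ?thesis by blast
  qed
  have "(\<lambda>n. \<integral>z. q n z \<partial>lborel) \<longlonglongrightarrow> (\<integral>z. f' z h \<partial>lborel)"
  proof (rule integral_dominated_convergence[where w = "\<lambda>z. B * indicator (cball 0 (r + norm h)) z"])
    show "AE z in lborel. (\<lambda>n. q n z) \<longlonglongrightarrow> f' z h"
    proof (intro AE_I2)
      fix z
      have "((\<lambda>s. f (z + s *\<^sub>R h)) has_derivative (\<lambda>u. f' z (u *\<^sub>R h))) (at 0)"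
      proof (rule has_derivative_compose[of "\<lambda>s. z + s *\<^sub>R h" _ _ _ f])
        show "(f has_derivative f' z) (at (z + 0 *\<^sub>R h))" using der[of z] by simp
      qed (auto intro!: derivative_eq_intros)
      moreover have "f' z (u *\<^sub>R h) = f' z h * u" for u
        using has_derivative_bounded_linear[OF der] by (simp add: linear_simps)
      ultimately have "((\<lambda>s. f (z + s *\<^sub>R h)) has_real_derivative f' z h) (at 0)"
        by (simp add: has_field_derivative_def)
      then have "((\<lambda>s. (f (z + s *\<^sub>R h) - f z) / s) \<longlongrightarrow> f' z h) (at 0)"
        by (simp add: DERIV_def)
      then show "(\<lambda>n. q n z) \<longlonglongrightarrow> f' z h"
        unfolding q_def using t t0 by (rule_tac filterlim_compose[of _ _ "at 0" t sequentially])
          (auto simp: filterlim_at eventually_sequentially less_imp_neq[symmetric])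
    qed
    show "AE z in lborel. norm (q n z) \<le> B * indicator (cball 0 (r + norm h)) z" for n
    proof (intro AE_I2)
      fix z
      obtain y where y: "q n z = f' y h" "norm (y - z) \<le> norm h" using qb by blast
      show "norm (q n z) \<le> B * indicator (cball 0 (r + norm h)) z"
      proof (cases "norm z \<le> r + norm h")
        case False
        then have "norm y > r" using y(2) norm_triangle_ineq2[of z "z - y"] by (simp add: norm_minus_commute)
        then show ?thesis using False y f'0 by auto
      qed (use y B in auto)
    qed
    show "integrable lborel (\<lambda>z. B * indicator (cball 0 (r + norm h)) z :: real)"
      by (intro integrable_mult_right integrable_real_indicator) (auto intro!: emeasure_bounded_finite[unfolded infinity_ennreal_def])
  qed (auto intro: qm f'm)
  then show ?thesis using q0 by (simp add: LIMSEQ_const_iff)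
qed

text \<open>This is the gradient of ln(|z|^2 + e^2)/2. For e = 0 it is z/|z|^2 = 1/conj z, the
  conjugate of the Cauchy kernel, with value 0 at the origin.\<close>

definition reg_kernel :: "real \<Rightarrow> complex \<Rightarrow> complex" where
  "reg_kernel e z = z /\<^sub>R ((norm z)\<^sup>2 + e\<^sup>2)"

lemma reg_kernel_0: "reg_kernel 0 z = cnj (1 / z)"
  unfolding reg_kernel_def complex_div_cnj[of 1 z]
  by (simp add: scaleR_conv_of_real divide_inverse mult.commute)

lemma norm_reg_kernel: "norm (reg_kernel e z) = norm z / ((norm z)\<^sup>2 + e\<^sup>2)"
  by (simp add: reg_kernel_def divide_inverse_commute abs_mult)

lemma norm_reg_kernel_le: "norm (reg_kernel e z) \<le> norm z powr -1"
proof (cases "z = 0")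
  case False
  then have "norm z / ((norm z)\<^sup>2 + e\<^sup>2) \<le> norm z / (norm z)\<^sup>2"
    by (intro divide_left_mono) (auto intro!: mult_pos_pos add_pos_nonneg)
  then show ?thesis using False by (simp add: norm_reg_kernel power2_eq_square powr_minus_divide)
qed (simp add: norm_reg_kernel)

lemma reg_kernel_tendsto: "(\<lambda>n. reg_kernel (inverse (real (Suc n))) z) \<longlonglongrightarrow> reg_kernel 0 z"
proof (cases "z = 0")
  case False
  then show ?thesis unfolding reg_kernel_def
    by (intro tendsto_intros LIMSEQ_inverse_real_of_nat) auto
qed (simp add: reg_kernel_def)

lemma borel_measurable_reg_kernel [measurable]: "reg_kernel e \<in> borel_measurable borel"
  unfolding reg_kernel_def by measurable

lemma reg_kernel_inner_has_derivative:
  assumes "e \<noteq> 0"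
  shows "((\<lambda>z. reg_kernel e (z - \<xi>) \<bullet> b) has_derivative
      (\<lambda>h. (h \<bullet> b) / ((norm (z - \<xi>))\<^sup>2 + e\<^sup>2)
           - 2 * ((z - \<xi>) \<bullet> h) * ((z - \<xi>) \<bullet> b) / ((norm (z - \<xi>))\<^sup>2 + e\<^sup>2)\<^sup>2)) (at z)"
proof -
  let ?D = "\<lambda>z. (norm (z - \<xi>))\<^sup>2 + e\<^sup>2"
  have D: "?D z \<noteq> 0" using assms by (simp add: add_nonneg_eq_0_iff)
  have "((\<lambda>z. ((z - \<xi>) \<bullet> b) / ?D z) has_derivative
     (\<lambda>h. - ((z - \<xi>) \<bullet> b) * (inverse (?D z) * (2 * ((z - \<xi>) \<bullet> h)) * inverse (?D z)) + (h \<bullet> b) / ?D z)) (at z)"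
    unfolding power2_norm_eq_inner
    by (rule has_derivative_divide)
       (use D in \<open>auto intro!: derivative_eq_intros simp: inner_commute power2_norm_eq_inner\<close>)
  moreover have "- ((z - \<xi>) \<bullet> b) * (inverse D * (2 * ((z - \<xi>) \<bullet> h)) * inverse D) + (h \<bullet> b) / D
      = (h \<bullet> b) / D - 2 * ((z - \<xi>) \<bullet> h) * ((z - \<xi>) \<bullet> b) / D\<^sup>2" for h D
    by (simp add: divide_inverse power2_eq_square)
  moreover have "(\<lambda>z. ((z - \<xi>) \<bullet> b) / ?D z) = (\<lambda>z. reg_kernel e (z - \<xi>) \<bullet> b)"
    by (simp add: reg_kernel_def divide_inverse mult.commute)
  ultimately show ?thesis by simp
qed

text \<open>For e \<noteq> 0 the kernel is smooth, and its divergence is 2 e^2 / (|z|^2 + e^2)^2;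
  integrating the divergence of \<open>\<phi>\<close> times the kernel over the plane gives
  zero.\<close>

lemma green_reg_kernel:
  fixes \<phi> :: "complex \<Rightarrow> real"
  assumes e: "e \<noteq> 0"
    and der: "\<And>z. (\<phi> has_derivative (\<lambda>h. G z \<bullet> h)) (at z)"
    and cont: "continuous_on UNIV G"
    and supp: "\<And>z. norm z > r \<Longrightarrow> \<phi> z = 0"
  shows "(\<integral>z. G z \<bullet> reg_kernel e (z - \<xi>) \<partial>lborel)
           = - (\<integral>z. \<phi> z * (2 * e\<^sup>2 / ((norm (z - \<xi>))\<^sup>2 + e\<^sup>2)\<^sup>2) \<partial>lborel)"
proof -
  let ?D = "\<lambda>z. (norm (z - \<xi>))\<^sup>2 + e\<^sup>2"
  have D: "?D z \<noteq> 0" "?D z > 0" for z using e by (auto simp: add_nonneg_eq_0_iff add_nonneg_pos)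
  have cphi: "continuous_on UNIV \<phi>"
    using der by (auto intro!: continuous_at_imp_continuous_on has_derivative_continuous)
  have ck: "continuous_on UNIV (\<lambda>z. reg_kernel e (z - \<xi>))"
    unfolding reg_kernel_def using D by (intro continuous_intros) auto
  have G0: "G z = 0" if "norm z > r" for z
    using has_derivative_eq_0_outside[OF der supp that] by (metis inner_eq_zero_iff)
  \<comment> \<open>The derivative in direction \<open>h\<close> of \<open>\<phi>\<close> times the
    component of the kernel along \<open>b\<close>. Taking h = b and summing over the basis gives
    the divergence.\<close>
  define d where "d b z h = \<phi> z * ((h \<bullet> b) / ?D z - 2 * ((z - \<xi>) \<bullet> h) * ((z - \<xi>) \<bullet> b) / (?D z)\<^sup>2)
       + (G z \<bullet> h) * (reg_kernel e (z - \<xi>) \<bullet> b)" for b z h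
  have "(\<integral>z. d b z b \<partial>lborel) = 0" for b
  proof (rule integral_derivative_eq_0[where f' = "d b"])
    show "((\<lambda>z. \<phi> z * (reg_kernel e (z - \<xi>) \<bullet> b)) has_derivative d b z) (at z)" for z
      unfolding d_def by (rule has_derivative_mult[OF der reg_kernel_inner_has_derivative[OF e]])
    show "continuous_on UNIV (\<lambda>z. d b z b)"
      unfolding d_def using D by (intro continuous_intros cphi cont ck) auto
  qed (use supp in auto)
  moreover have int: "integrable lborel (\<lambda>z. d b z b)" for b
    unfolding d_def using D G0 supp
    by (intro integrable_continuous_compact_support[of _ r] continuous_intros cphi cont ck) auto
  ultimately have "(\<integral>z. (\<Sum>b\<in>Basis. d b z b) \<partial>lborel) = 0"
    by (subst Bochner_Integration.integral_sum) auto
  moreover have "(\<Sum>b\<in>Basis. d b z b) = \<phi> z * (2 * e\<^sup>2 / (?D z)\<^sup>2) + G z \<bullet> reg_kernel e (z - \<xi>)" for z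
  proof -
    have "(\<Sum>b\<in>Basis. d b z b) = \<phi> z * (2 / ?D z - 2 * (norm (z - \<xi>))\<^sup>2 / (?D z)\<^sup>2) + G z \<bullet> reg_kernel e (z - \<xi>)"
    proof -
      have "(\<Sum>b\<in>Basis. p * ((b \<bullet> b) / D - 2 * (w \<bullet> b) * (w \<bullet> b) / D\<^sup>2) + (g \<bullet> b) * (k \<bullet> b))
          = p * (2 / D - 2 * (norm w)\<^sup>2 / D\<^sup>2) + g \<bullet> k" for w k g :: complex and D p :: real
        by (simp add: Basis_complex_def cmod_power2 inner_complex_def)
           (simp add: power2_eq_square algebra_simps add_divide_distrib)
      then show ?thesis unfolding d_def .
    qed
    also have "2 / ?D z - 2 * (norm (z - \<xi>))\<^sup>2 / (?D z)\<^sup>2 = 2 * e\<^sup>2 / (?D z)\<^sup>2"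
      using D[of z] by (simp add: divide_simps) (simp add: power2_eq_square algebra_simps)
    finally show ?thesis .
  qed
  moreover have "integrable lborel (\<lambda>z. \<phi> z * (2 * e\<^sup>2 / (?D z)\<^sup>2))"
    using D supp by (intro integrable_continuous_compact_support[of _ r] continuous_intros cphi) auto
  moreover have "integrable lborel (\<lambda>z. G z \<bullet> reg_kernel e (z - \<xi>))"
    using G0 by (intro integrable_continuous_compact_support[of _ r] continuous_intros cont ck) auto
  ultimately show ?thesis by simp
qed

text \<open>The number is 2 pi, the total mass of the Laplacian of ln|z|. It enters the later
  arguments through its positivity.\<close>

definition green_const :: real where
  "green_const = (\<integral>z. 2 / ((norm (z::complex))\<^sup>2 + 1)\<^sup>2 \<partial>lborel)"

lemma green_const_pos: "green_const > 0"
proof -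
  have "green_const \<noteq> 0"
  proof
    assume "green_const = 0"
    then have "AE z::complex in lborel. 2 / ((norm z)\<^sup>2 + 1)\<^sup>2 = (0::real)"
      unfolding green_const_def
      by (subst (asm) integral_nonneg_eq_0_iff_AE) (auto intro: integrable_inverse_one_plus_norm_square_square)
    moreover have "2 / ((norm z)\<^sup>2 + 1)\<^sup>2 \<noteq> (0::real)" for z :: complex
      by (simp add: add_nonneg_eq_0_iff)
    ultimately have "AE z::complex in lborel. False" by simp
    then show False by (simp add: ae_filter_eq_bot_iff emeasure_lborel_UNIV[simplified])
  qed
  moreover have "green_const \<ge> 0" unfolding green_const_def by (intro integral_nonneg_AE AE_I2) auto
  ultimately show ?thesis by simp
qed

text \<open>The logarithm is a multiple of the fundamental solution of the Laplacian. The
  regularised Laplacians form an approximate identity at \<open>\<xi>\<close>, while the regularised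
  kernels stay below the integrable 1/|z - \<xi>|, so both sides pass to the limit.\<close>

lemma green_kernel:
  fixes \<phi> :: "complex \<Rightarrow> real"
  assumes der: "\<And>z. (\<phi> has_derivative (\<lambda>h. G z \<bullet> h)) (at z)"
    and cont: "continuous_on UNIV G"
    and supp: "\<And>z. norm z > r \<Longrightarrow> \<phi> z = 0"
  shows "(\<integral>z. G z \<bullet> reg_kernel 0 (z - \<xi>) \<partial>lborel) = - green_const * \<phi> \<xi>"
proof -
  define t :: "nat \<Rightarrow> real" where "t n = inverse (real (Suc n))" for n
  have t: "t n > 0" "t n \<noteq> 0" for n by (auto simp: t_def field_simps)
  have t0: "t \<longlonglongrightarrow> 0" unfolding t_def by (rule LIMSEQ_inverse_real_of_nat)
  have cphi: "continuous_on UNIV \<phi>"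
    using der by (auto intro!: continuous_at_imp_continuous_on has_derivative_continuous)
  have [measurable]: "\<phi> \<in> borel_measurable borel" "G \<in> borel_measurable borel"
    by (intro borel_measurable_continuous_onI cphi cont)+
  have G0: "G z = 0" if "norm z > r" for z
    using has_derivative_eq_0_outside[OF der supp that] by (metis inner_eq_zero_iff)
  obtain B where B: "0 \<le> B" "\<And>z. norm (\<phi> z) \<le> B"
    using bounded_continuous_compact_support[OF cphi supp] by blast
  obtain B' where B': "0 \<le> B'" "\<And>z. norm (G z) \<le> B'"
    using bounded_continuous_compact_support[OF cont G0] by blast
  \<comment> \<open>After the substitution z = \<xi> + t x the profile 2/(|x|^2 + 1)^2 no longer
    depends on t, and the limit concerns the continuous factor \<open>\<phi>\<close> alone.\<close>
  define I where "I n = (\<integral>z. \<phi> (\<xi> + t n *\<^sub>R z) * (2 / ((norm z)\<^sup>2 + 1)\<^sup>2) \<partial>lborel)" for n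
  have I: "(\<integral>z. G z \<bullet> reg_kernel (t n) (z - \<xi>) \<partial>lborel) = - I n" for n
  proof -
    have "(\<integral>z. \<phi> z * (2 * (t n)\<^sup>2 / ((norm (z - \<xi>))\<^sup>2 + (t n)\<^sup>2)\<^sup>2) \<partial>lborel)
        = (t n)\<^sup>2 * (\<integral>z. \<phi> (\<xi> + t n *\<^sub>R z) * (2 * (t n)\<^sup>2 / ((norm (t n *\<^sub>R z))\<^sup>2 + (t n)\<^sup>2)\<^sup>2) \<partial>lborel)"
      by (subst integral_lborel_affine[of _ "t n" \<xi>]) (auto simp: t)
    also have "\<dots> = (\<integral>z. (t n)\<^sup>2 * (\<phi> (\<xi> + t n *\<^sub>R z) * (2 * (t n)\<^sup>2 / ((norm (t n *\<^sub>R z))\<^sup>2 + (t n)\<^sup>2)\<^sup>2)) \<partial>lborel)"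
      by (rule integral_mult_right_zero[symmetric])
    also have "\<dots> = I n"
    proof -
      have "(t n)\<^sup>2 * (2 * (t n)\<^sup>2 / ((norm (t n *\<^sub>R z))\<^sup>2 + (t n)\<^sup>2)\<^sup>2) = 2 / ((norm z)\<^sup>2 + 1)\<^sup>2" for z :: complex
      proof -
        have "(norm (t n *\<^sub>R z))\<^sup>2 + (t n)\<^sup>2 = (t n)\<^sup>2 * ((norm z)\<^sup>2 + 1)"
          by (simp add: power_mult_distrib algebra_simps)
        moreover have "(t n)\<^sup>2 * (2 * (t n)\<^sup>2 / ((t n)\<^sup>2 * X)\<^sup>2) = 2 / X\<^sup>2" for X
          using t[of n] by (cases "X = 0") (simp_all add: field_simps power2_eq_square)
        ultimately show ?thesis by simp
      qed
      then show ?thesis unfolding I_def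
        by (intro Bochner_Integration.integral_cong refl) (subst mult.left_commute, simp only:)
    qed
    finally show ?thesis using green_reg_kernel[OF _ der cont supp, of "t n" r \<xi>] t[of n] by simp
  qed
  have "I \<longlonglongrightarrow> (\<integral>z. \<phi> \<xi> * (2 / ((norm z)\<^sup>2 + 1)\<^sup>2) \<partial>(lborel::complex measure))"
    unfolding I_def
  proof (rule integral_dominated_convergence[where w = "\<lambda>z. B * (2 / ((norm z)\<^sup>2 + 1)\<^sup>2)"])
    show "integrable (lborel::complex measure) (\<lambda>z. B * (2 / ((norm z)\<^sup>2 + 1)\<^sup>2))"
      by (intro integrable_mult_right integrable_inverse_one_plus_norm_square_square)
    show "AE z in lborel. (\<lambda>n. \<phi> (\<xi> + t n *\<^sub>R z) * (2 / ((norm z)\<^sup>2 + 1)\<^sup>2)) \<longlonglongrightarrow> \<phi> \<xi> * (2 / ((norm z)\<^sup>2 + 1)\<^sup>2)"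
    proof (intro AE_I2 tendsto_intros)
      fix z :: complex
      have "(\<lambda>n. \<xi> + t n *\<^sub>R z) \<longlonglongrightarrow> \<xi> + 0 *\<^sub>R z" by (intro tendsto_intros t0)
      moreover have "isCont \<phi> \<xi>" using cphi by (simp add: continuous_on_eq_continuous_at)
      ultimately show "(\<lambda>n. \<phi> (\<xi> + t n *\<^sub>R z)) \<longlonglongrightarrow> \<phi> \<xi>"
        by (intro isCont_tendsto_compose[of \<xi> \<phi>]) auto
    qed
    show "AE z in lborel. norm (\<phi> (\<xi> + t n *\<^sub>R z) * (2 / ((norm z)\<^sup>2 + 1)\<^sup>2)) \<le> B * (2 / ((norm z)\<^sup>2 + 1)\<^sup>2)" for n
      using B by (auto simp: abs_mult intro!: divide_right_mono)
  qed auto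
  then have 1: "I \<longlonglongrightarrow> green_const * \<phi> \<xi>"
    by (subst (asm) integral_mult_right_zero) (simp add: green_const_def mult.commute)
  have 2: "(\<lambda>n. \<integral>z. G z \<bullet> reg_kernel (t n) (z - \<xi>) \<partial>lborel) \<longlonglongrightarrow> (\<integral>z. G z \<bullet> reg_kernel 0 (z - \<xi>) \<partial>lborel)"
  proof (rule integral_dominated_convergence[where w = "\<lambda>z. B' * (norm (z - \<xi>) powr -1 * indicator (cball 0 (max r 1)) z)"])
    have "integrable lborel (\<lambda>z. norm (z - \<xi>) powr -1 * indicator (cball 0 (max r 1)) z)"
      by (rule integrable_norm_powr_cball) auto
    then show "integrable lborel (\<lambda>z. B' * (norm (z - \<xi>) powr -1 * indicator (cball 0 (max r 1)) z))"
      by (rule integrable_mult_right)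
    show "AE z in lborel. (\<lambda>n. G z \<bullet> reg_kernel (t n) (z - \<xi>)) \<longlonglongrightarrow> G z \<bullet> reg_kernel 0 (z - \<xi>)"
      unfolding t_def by (intro AE_I2 tendsto_intros reg_kernel_tendsto)
    show "AE z in lborel. norm (G z \<bullet> reg_kernel (t n) (z - \<xi>)) \<le> B' * (norm (z - \<xi>) powr -1 * indicator (cball 0 (max r 1)) z)" for n
    proof (intro AE_I2)
      fix z
      show "norm (G z \<bullet> reg_kernel (t n) (z - \<xi>)) \<le> B' * (norm (z - \<xi>) powr -1 * indicator (cball 0 (max r 1)) z)"
      proof (cases "norm z \<le> r")
        case True
        have "norm (G z \<bullet> reg_kernel (t n) (z - \<xi>)) \<le> norm (G z) * norm (reg_kernel (t n) (z - \<xi>))"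
          using Cauchy_Schwarz_ineq2 by auto
        also have "\<dots> \<le> B' * norm (z - \<xi>) powr -1"
          by (intro mult_mono B' norm_reg_kernel_le) auto
        finally show ?thesis using True by simp
      qed (use G0 B' in auto)
    qed
  qed measurable
  show ?thesis
    using LIMSEQ_unique[OF 2[unfolded I] tendsto_minus[OF 1]] by simp
qed

section \<open>Regularized logarithmic potentials\<close>

definition reg_pot :: "real \<Rightarrow> complex measure \<Rightarrow> complex \<Rightarrow> real" where
  "reg_pot e \<mu> z = (\<integral>\<xi>. ln ((norm (z - \<xi>))\<^sup>2 + e\<^sup>2) / 2 \<partial>\<mu>)"

definition reg_grad :: "real \<Rightarrow> complex measure \<Rightarrow> complex \<Rightarrow> complex" where
  "reg_grad e \<mu> z = (\<integral>\<xi>. reg_kernel e (z - \<xi>) \<partial>\<mu>)"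

text \<open>The real gradient of ln|z| is 1/conj z, whence the conjugate. Squares and absolute
  values of Cauchy transforms can therefore be read off from gradients of potentials.\<close>

lemma reg_grad_0: "reg_grad 0 \<mu> z = cnj (cauchy_transform \<mu> z)"
proof -
  have "(\<integral>\<xi>. cnj (1 / (z - \<xi>)) \<partial>\<mu>) = cnj (\<integral>\<xi>. 1 / (z - \<xi>) \<partial>\<mu>)"
    by (rule Bochner_Integration.integral_cnj)
  then show ?thesis by (simp only: reg_grad_def cauchy_transform_def reg_kernel_0)
qed

text \<open>With A = a conj a + e^2 and B = b conj b + e^2 the numerator of the difference factors
  through a - b as e^2 (a - b) + a b conj(b - a). The constant then comes from A B \<ge> e^2 (e^2 +
  |a| |b|), whose defect is a sum of squares.\<close>

lemma reg_kernel_lipschitz: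
  assumes "e > 0"
  shows "norm (reg_kernel e a - reg_kernel e b) \<le> norm (a - b) / e\<^sup>2"
proof -
  define A where "A = (norm a)\<^sup>2 + e\<^sup>2"
  define B where "B = (norm b)\<^sup>2 + e\<^sup>2"
  have AB: "A > 0" "B > 0" using assms by (auto simp: A_def B_def add_nonneg_pos)
  have "reg_kernel e a - reg_kernel e b = (of_real B * a - of_real A * b) /\<^sub>R (A * B)"
    using AB unfolding reg_kernel_def A_def[symmetric] B_def[symmetric] scaleR_conv_of_real
    by (simp add: field_simps)
  also have "of_real B * a - of_real A * b = of_real (e\<^sup>2) * (a - b) + a * b * cnj (b - a)"
  proof -
    have "complex_of_real A = a * cnj a + of_real (e\<^sup>2)" "complex_of_real B = b * cnj b + of_real (e\<^sup>2)"
      unfolding A_def B_def of_real_add complex_norm_square by auto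
    then show ?thesis by (simp add: algebra_simps)
  qed
  also have "norm ((of_real (e\<^sup>2) * (a - b) + a * b * cnj (b - a)) /\<^sub>R (A * B))
      \<le> (e\<^sup>2 * norm (a - b) + norm a * norm b * norm (a - b)) / (A * B)"
  proof -
    have "norm (of_real (e\<^sup>2) * (a - b) + a * b * cnj (b - a)) \<le> e\<^sup>2 * norm (a - b) + norm a * norm b * norm (a - b)"
      by (rule order.trans[OF norm_triangle_ineq])
         (simp add: norm_mult norm_minus_commute complex_mod_cnj norm_power del: complex_cnj_diff)
    then show ?thesis using AB by (simp add: divide_inverse mult.commute mult_left_mono abs_mult)
  qed
  also have "\<dots> = norm (a - b) * ((e\<^sup>2 + norm a * norm b) / (A * B))"
    by (simp add: algebra_simps add_divide_distrib)
  also have "\<dots> \<le> norm (a - b) * (1 / e\<^sup>2)"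
  proof (intro mult_left_mono)
    have "A * B - e\<^sup>2 * (e\<^sup>2 + norm a * norm b)
       = (norm a)\<^sup>2 * (norm b)\<^sup>2 + e\<^sup>2 * (((norm a)\<^sup>2 + (norm b)\<^sup>2 + (norm a - norm b)\<^sup>2) / 2)"
      by (simp add: A_def B_def power2_eq_square field_simps)
    also have "\<dots> \<ge> 0" by simp
    finally have "e\<^sup>2 * (e\<^sup>2 + norm a * norm b) \<le> A * B" by simp
    then show "(e\<^sup>2 + norm a * norm b) / (A * B) \<le> 1 / e\<^sup>2"
      using AB assms by (simp add: divide_simps mult.commute)
  qed auto
  finally show ?thesis by simp
qed

lemma reg_log_has_derivative:
  assumes "e \<noteq> 0"
  shows "((\<lambda>z. ln ((norm z)\<^sup>2 + e\<^sup>2) / 2) has_derivative (\<lambda>h. reg_kernel e z \<bullet> h)) (at z)"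
proof -
  have pos: "0 < (norm z)\<^sup>2 + e\<^sup>2" using assms by (simp add: add_nonneg_pos)
  have "((\<lambda>z. z \<bullet> z + e\<^sup>2) has_derivative (\<lambda>h. (z \<bullet> h + h \<bullet> z) + 0)) (at z)"
    by (intro has_derivative_add has_derivative_inner has_derivative_ident has_derivative_const)
  then have "((\<lambda>z. (norm z)\<^sup>2 + e\<^sup>2) has_derivative (\<lambda>h. 2 * (z \<bullet> h))) (at z)"
    by (simp add: power2_norm_eq_inner inner_commute)
  then have "((\<lambda>z. (1/2) * ln ((norm z)\<^sup>2 + e\<^sup>2)) has_derivative
      (\<lambda>h. (1/2) * (2 * (z \<bullet> h) * inverse ((norm z)\<^sup>2 + e\<^sup>2)))) (at z)"
    by (intro has_derivative_mult_right has_derivative_ln pos)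
  moreover have "(\<lambda>h. (1/2) * (2 * (z \<bullet> h) * inverse ((norm z)\<^sup>2 + e\<^sup>2))) = (\<lambda>h. reg_kernel e z \<bullet> h)"
    by (auto simp: reg_kernel_def)
  ultimately show ?thesis by simp
qed

text \<open>The mean value inequality on the segment, applied after subtracting the linear term,
  turns the Lipschitz bound of the gradient into a quadratic remainder. Its uniformity in
  \<open>z\<close> permits differentiation under the integral sign.\<close>

lemma reg_log_taylor:
  assumes "e > 0"
  shows "\<bar>ln ((norm (z + h))\<^sup>2 + e\<^sup>2) / 2 - ln ((norm z)\<^sup>2 + e\<^sup>2) / 2 - reg_kernel e z \<bullet> h\<bar> \<le> (norm h)\<^sup>2 / e\<^sup>2"
proof -
  let ?l = "\<lambda>z. ln ((norm z)\<^sup>2 + e\<^sup>2) / 2"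
  define g where "g y = ?l y - reg_kernel e z \<bullet> y" for y
  have "norm (g (z + h) - g z) \<le> (norm h / e\<^sup>2) * norm (z + h - z)"
  proof (rule differentiable_bound[of "closed_segment z (z + h)"])
    fix y assume y: "y \<in> closed_segment z (z + h)"
    show "(g has_derivative (\<lambda>h. reg_kernel e y \<bullet> h - reg_kernel e z \<bullet> h)) (at y within closed_segment z (z + h))"
      unfolding g_def
      by (intro has_derivative_diff has_derivative_at_withinI[OF reg_log_has_derivative] has_derivative_inner_right has_derivative_ident)
         (use assms in auto)
    show "onorm (\<lambda>h. reg_kernel e y \<bullet> h - reg_kernel e z \<bullet> h) \<le> norm h / e\<^sup>2"
    proof (rule onorm_bound)
      fix x
      have "norm (reg_kernel e y \<bullet> x - reg_kernel e z \<bullet> x) \<le> norm (reg_kernel e y - reg_kernel e z) * norm x"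
        using Cauchy_Schwarz_ineq2 by (metis inner_diff_left real_norm_def)
      also have "norm (reg_kernel e y - reg_kernel e z) \<le> norm (y - z) / e\<^sup>2"
        by (rule reg_kernel_lipschitz[OF assms])
      also have "norm (y - z) \<le> norm h"
        using segment_bound(1)[OF y] by simp
      finally show "norm (reg_kernel e y \<bullet> x - reg_kernel e z \<bullet> x) \<le> norm h / e\<^sup>2 * norm x"
        by (simp add: mult_right_mono divide_right_mono)
    qed simp
  qed auto
  then show ?thesis
    by (simp add: g_def inner_add_right power2_eq_square)
qed

section \<open>Regularised potentials of a probability measure carried by a disc\<close>

locale compact_prob =
  fixes \<mu> :: "complex measure" and R0 :: real
  assumes sets_mu: "sets \<mu> = sets borel" and prob_mu: "prob_space \<mu>"
    and supp_mu: "AE \<xi> in \<mu>. norm \<xi> \<le> R0" and R0_nonneg: "0 \<le> R0"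
begin

sublocale prob_space \<mu> by (rule prob_mu)

lemma space_mu [simp]: "space \<mu> = UNIV"
  using sets_eq_imp_space_eq[OF sets_mu] by simp

lemma prob_UNIV [simp]: "prob UNIV = 1"
  using prob_space by simp

lemma integrable_bounded_on_support:
  fixes f :: "complex \<Rightarrow> 'b::{banach, second_countable_topology}"
  assumes "f \<in> borel_measurable borel" "\<And>\<xi>. norm \<xi> \<le> R0 \<Longrightarrow> norm (f \<xi>) \<le> B"
  shows "integrable \<mu> f"
  by (rule integrable_const_bound[of _ B])
     (use assms supp_mu in \<open>auto elim: eventually_mono simp: measurable_cong_sets[OF sets_mu refl]\<close>)

lemma integral_norm_bound_on_support:
  fixes f :: "complex \<Rightarrow> 'b::{banach, second_countable_topology}"
  assumes "f \<in> borel_measurable borel" "\<And>\<xi>. norm \<xi> \<le> R0 \<Longrightarrow> norm (f \<xi>) \<le> B"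
  shows "norm (\<integral>\<xi>. f \<xi> \<partial>\<mu>) \<le> B"
proof -
  have "norm (\<integral>\<xi>. f \<xi> \<partial>\<mu>) \<le> (\<integral>\<xi>. norm (f \<xi>) \<partial>\<mu>)" by (rule integral_norm_bound)
  also have "\<dots> \<le> (\<integral>\<xi>. B \<partial>\<mu>)"
    using integrable_bounded_on_support[OF assms]
    by (intro integral_mono_AE) (use assms supp_mu in \<open>auto elim: eventually_mono\<close>)
  also have "\<dots> = B" by simp
  finally show ?thesis .
qed

lemma reg_log_bounds:
  assumes "e > 0" "norm \<xi> \<le> R0"
  shows "\<bar>ln ((norm (z - \<xi>))\<^sup>2 + e\<^sup>2) / 2\<bar> \<le> \<bar>ln (e\<^sup>2)\<bar> + \<bar>ln ((norm z + R0)\<^sup>2 + e\<^sup>2)\<bar>"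
proof -
  have n: "norm (z - \<xi>) \<le> norm z + R0" using assms norm_triangle_ineq4[of z \<xi>] by linarith
  have "ln (e\<^sup>2) \<le> ln ((norm (z - \<xi>))\<^sup>2 + e\<^sup>2)" using assms by (subst ln_le_cancel_iff) (auto simp: add_nonneg_pos)
  moreover have "ln ((norm (z - \<xi>))\<^sup>2 + e\<^sup>2) \<le> ln ((norm z + R0)\<^sup>2 + e\<^sup>2)"
    using assms n by (subst ln_le_cancel_iff) (auto simp: add_nonneg_pos intro!: power_mono)
  ultimately show ?thesis by linarith
qed

lemma integrable_reg_log:
  assumes "e > 0" shows "integrable \<mu> (\<lambda>\<xi>. ln ((norm (z - \<xi>))\<^sup>2 + e\<^sup>2) / 2)"
proof (rule integrable_bounded_on_support)
  fix \<xi> :: complex assume "norm \<xi> \<le> R0"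
  then show "norm (ln ((norm (z - \<xi>))\<^sup>2 + e\<^sup>2) / 2) \<le> \<bar>ln (e\<^sup>2)\<bar> + \<bar>ln ((norm z + R0)\<^sup>2 + e\<^sup>2)\<bar>"
    using reg_log_bounds[OF assms] by simp
qed measurable

lemma integrable_reg_kernel:
  assumes "e > 0" shows "integrable \<mu> (\<lambda>\<xi>. reg_kernel e (z - \<xi>))"
proof (rule integrable_bounded_on_support)
  fix \<xi> :: complex
  assume "norm \<xi> \<le> R0"
  then have "norm (z - \<xi>) \<le> norm z + R0" using norm_triangle_ineq4[of z \<xi>] by linarith
  moreover have "norm (reg_kernel e (z - \<xi>)) \<le> norm (z - \<xi>) / e\<^sup>2"
    using reg_kernel_lipschitz[OF assms, of "z - \<xi>" 0] by (simp add: reg_kernel_def)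
  ultimately show "norm (reg_kernel e (z - \<xi>)) \<le> (norm z + R0) / e\<^sup>2"
    by (meson divide_right_mono order.trans zero_le_power2)
qed auto

lemma reg_grad_lipschitz:
  assumes "e > 0"
  shows "norm (reg_grad e \<mu> a - reg_grad e \<mu> b) \<le> norm (a - b) / e\<^sup>2"
proof -
  have "reg_grad e \<mu> a - reg_grad e \<mu> b = (\<integral>\<xi>. reg_kernel e (a - \<xi>) - reg_kernel e (b - \<xi>) \<partial>\<mu>)"
    unfolding reg_grad_def using integrable_reg_kernel[OF assms] by simp
  also have "norm \<dots> \<le> norm (a - b) / e\<^sup>2"
  proof (rule integral_norm_bound_on_support)
    fix \<xi> :: complex
    show "norm (reg_kernel e (a - \<xi>) - reg_kernel e (b - \<xi>)) \<le> norm (a - b) / e\<^sup>2"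
      using reg_kernel_lipschitz[OF assms, of "a - \<xi>" "b - \<xi>"] by simp
  qed measurable
  finally show ?thesis .
qed

lemma continuous_reg_grad:
  assumes "e > 0"
  shows "continuous_on UNIV (reg_grad e \<mu>)"
proof (rule lipschitz_on_continuous_on[of "1 / e\<^sup>2"], rule lipschitz_onI)
  fix a b show "dist (reg_grad e \<mu> a) (reg_grad e \<mu> b) \<le> 1 / e\<^sup>2 * dist a b"
    using reg_grad_lipschitz[OF assms] by (simp add: dist_norm)
qed simp

text \<open>The quadratic Taylor remainder of the regularised logarithm has a constant independent
  of \<open>\<xi>\<close>, so it survives integration against a probability measure.\<close>

lemma reg_pot_has_derivative:
  assumes e: "e > 0"
  shows "(reg_pot e \<mu> has_derivative (\<lambda>h. reg_grad e \<mu> z \<bullet> h)) (at z)"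
proof (rule has_derivativeI_sandwich[of 1])
  show "bounded_linear (\<lambda>h. reg_grad e \<mu> z \<bullet> h)" by (rule bounded_linear_inner_right)
  fix y assume "y \<noteq> z"
  let ?l = "\<lambda>z. ln ((norm z)\<^sup>2 + e\<^sup>2) / 2"
  have "reg_pot e \<mu> y - reg_pot e \<mu> z - reg_grad e \<mu> z \<bullet> (y - z)
     = (\<integral>\<xi>. ?l (y - \<xi>) - ?l (z - \<xi>) - reg_kernel e (z - \<xi>) \<bullet> (y - z) \<partial>\<mu>)"
    unfolding reg_pot_def reg_grad_def
    by (simp only: Bochner_Integration.integral_diff Bochner_Integration.integrable_diff integrable_reg_log[OF e]
        integrable_inner_left integrable_reg_kernel[OF e] integral_inner_left)
  also have "norm \<dots> \<le> (norm (y - z))\<^sup>2 / e\<^sup>2"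
  proof (rule integral_norm_bound_on_support)
    fix \<xi> :: complex
    show "norm (?l (y - \<xi>) - ?l (z - \<xi>) - reg_kernel e (z - \<xi>) \<bullet> (y - z)) \<le> (norm (y - z))\<^sup>2 / e\<^sup>2"
      using reg_log_taylor[OF e, of "z - \<xi>" "y - z"] by (simp add: algebra_simps)
  qed measurable
  finally show "norm (reg_pot e \<mu> y - reg_pot e \<mu> z - reg_grad e \<mu> z \<bullet> (y - z)) / norm (y - z) \<le> norm (y - z) / e\<^sup>2"
    using \<open>y \<noteq> z\<close> e by (simp add: pos_divide_le_eq power2_eq_square)
next
  have "((\<lambda>y. norm (y - z) / e\<^sup>2) \<longlongrightarrow> norm (z - z) / e\<^sup>2) (at z)"
    by (intro tendsto_intros) (use e in auto)
  then show "((\<lambda>y. norm (y - z) / e\<^sup>2) \<longlongrightarrow> 0) (at z within UNIV)" by simp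
qed auto

lemma sets_pair_mu: "sets (borel \<Otimes>\<^sub>M \<mu>) = sets (borel \<Otimes>\<^sub>M borel)"
  by (intro sets_pair_measure_cong refl sets_mu)

lemma measurable_integral_mu:
  fixes f :: "complex \<Rightarrow> complex \<Rightarrow> 'b::{banach, second_countable_topology}"
  assumes "case_prod f \<in> borel_measurable (borel \<Otimes>\<^sub>M borel)"
  shows "(\<lambda>z. \<integral>\<xi>. f z \<xi> \<partial>\<mu>) \<in> borel_measurable borel"
proof (rule borel_measurable_lebesgue_integral)
  have "borel_measurable (borel \<Otimes>\<^sub>M \<mu>) = (borel_measurable (borel \<Otimes>\<^sub>M borel) :: (complex \<times> complex \<Rightarrow> 'b) set)"
    by (rule measurable_cong_sets[OF sets_pair_mu refl])
  then show "case_prod f \<in> borel_measurable (borel \<Otimes>\<^sub>M \<mu>)" using assms by metis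
qed

lemma measurable_reg_grad [measurable]: "reg_grad e \<mu> \<in> borel_measurable borel"
proof -
  have "(\<lambda>z. \<integral>\<xi>. reg_kernel e (z - \<xi>) \<partial>\<mu>) \<in> borel_measurable borel"
    by (rule measurable_integral_mu) (unfold split_def, measurable)
  then show ?thesis by (simp add: reg_grad_def[abs_def])
qed

lemma measurable_reg_pot [measurable]: "reg_pot e \<mu> \<in> borel_measurable borel"
proof -
  have "(\<lambda>z. \<integral>\<xi>. ln ((norm (z - \<xi>))\<^sup>2 + e\<^sup>2) / 2 \<partial>\<mu>) \<in> borel_measurable borel"
    by (rule measurable_integral_mu) (unfold split_def, measurable)
  then show ?thesis by (simp add: reg_pot_def[abs_def])
qed

end

abbreviation eps :: "nat \<Rightarrow> real" where "eps n \<equiv> inverse (real (Suc n))"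

lemma eps_pos: "eps n > 0" and eps_le_1: "eps n \<le> 1"
  by (auto simp: field_simps)

text \<open>The relative error e^2/(|z|^2 + e^2) is at most both 1 and (e/|z|)^2, hence at most
  (e/|z|)^(1/4). The small exponent 1/4 keeps the singularity at 5/4, so that a further factor of
  order 1/2 is still integrable in the plane.\<close>

lemma reg_kernel_diff_le:
  assumes "e > 0"
  shows "norm (reg_kernel e z - reg_kernel 0 z) \<le> e powr (1/4) * norm z powr - (5/4)"
proof (cases "z = 0")
  case False
  define x where "x = norm z"
  have x: "x > 0" using False by (simp add: x_def)
  have "reg_kernel e z - reg_kernel 0 z = (inverse (x\<^sup>2 + e\<^sup>2) - inverse (x\<^sup>2)) *\<^sub>R z"
    by (simp add: reg_kernel_def x_def scaleR_left_diff_distrib)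
  also have "norm \<dots> = \<bar>inverse (x\<^sup>2 + e\<^sup>2) - inverse (x\<^sup>2)\<bar> * x" by (simp add: x_def)
  also have "\<dots> = (e\<^sup>2 / (x\<^sup>2 + e\<^sup>2)) * x powr -1"
  proof -
    have "\<bar>inverse X - inverse (x\<^sup>2)\<bar> * x = ((X - x\<^sup>2) / X) * x powr -1" if "X \<ge> x\<^sup>2" for X
    proof -
      have X: "X > 0" using that x zero_less_power[OF x, of 2] by linarith
      have "inverse X - inverse (x\<^sup>2) = - ((X - x\<^sup>2) / (X * x\<^sup>2))"
        using X x by (simp add: divide_simps)
      then have "\<bar>inverse X - inverse (x\<^sup>2)\<bar> = (X - x\<^sup>2) / (X * x\<^sup>2)"
        using X that by simp
      then show ?thesis using X x by (simp add: powr_minus_divide power2_eq_square)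
    qed
    from this[of "x\<^sup>2 + e\<^sup>2"] show ?thesis by simp
  qed
  also have "\<dots> \<le> (e / x) powr (1/4) * x powr -1"
  proof (intro mult_right_mono)
    show "e\<^sup>2 / (x\<^sup>2 + e\<^sup>2) \<le> (e / x) powr (1/4)"
    proof (cases "e \<le> x")
      case True
      have "e\<^sup>2 / (x\<^sup>2 + e\<^sup>2) \<le> e\<^sup>2 / x\<^sup>2"
        using x assms by (intro divide_left_mono) (auto intro!: mult_pos_pos add_pos_pos)
      also have "\<dots> = (e / x) powr 2" using x assms by (simp add: power_divide)
      also have "\<dots> \<le> (e / x) powr (1/4)" using x assms True by (intro powr_mono') auto
      finally show ?thesis .
    next
      case False
      have "e\<^sup>2 / (x\<^sup>2 + e\<^sup>2) \<le> 1" using x assms by (simp add: divide_le_eq add_pos_pos)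
      also have "1 \<le> (e / x) powr (1/4)" using False x by (intro ge_one_powr_ge_zero) auto
      finally show ?thesis .
    qed
  qed auto
  also have "\<dots> = e powr (1/4) * x powr - (5/4)"
  proof -
    have "(e / x) powr (1/4) = e powr (1/4) * x powr - (1/4)"
      using x assms by (simp add: powr_divide powr_minus_divide)
    moreover have "x powr - (1/4) * x powr -1 = x powr - (5/4)"
      by (subst powr_add[symmetric]) simp
    ultimately show ?thesis by (simp only: mult.assoc)
  qed
  finally show ?thesis by (simp add: x_def)
qed (simp add: reg_kernel_def)

text \<open>For a non-integrable \<open>f\<close> the left side is 0 by the convention for Bochner
  integrals. Thus \<open>reg_grad 0\<close> can be estimated at every point, including those where
  the kernel is not integrable.\<close>

lemma ennreal_norm_integral_le:
  fixes f :: "'a \<Rightarrow> 'b::{banach, second_countable_topology}"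
  shows "ennreal (norm (\<integral>x. f x \<partial>M)) \<le> (\<integral>\<^sup>+x. ennreal (norm (f x)) \<partial>M)"
  by (cases "integrable M f") (auto intro: integral_norm_bound_ennreal simp: not_integrable_integral_eq)

lemma ennreal_mult_assoc: "0 \<le> x \<Longrightarrow> 0 \<le> y \<Longrightarrow> ennreal (x * y) * c = ennreal x * (ennreal y * c)"
  by (simp add: ennreal_mult mult.assoc)

section \<open>Exchanging area integrals with integrals over the measure\<close>

context compact_prob
begin

lemma pair_sigma_finite_lborel_mu: "pair_sigma_finite (lborel :: complex measure) \<mu>"
  by (intro pair_sigma_finite.intro) unfold_locales

lemma measurable_pair_mu:
  "borel_measurable (lborel \<Otimes>\<^sub>M \<mu>) = (borel_measurable (borel \<Otimes>\<^sub>M borel) :: (complex \<times> complex \<Rightarrow> 'b::topological_space) set)"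
  by (intro measurable_cong_sets refl sets_pair_measure_cong) (simp_all add: sets_mu)

lemma borel_measurable_pairI:
  "f \<in> borel_measurable (borel \<Otimes>\<^sub>M borel) \<Longrightarrow> f \<in> borel_measurable (lborel \<Otimes>\<^sub>M \<mu>)"
  for f :: "complex \<times> complex \<Rightarrow> 'b::topological_space"
  by (simp only: measurable_pair_mu)

text \<open>Tonelli: a bound on the area integral that is uniform over the support is preserved by
  averaging, since the measure has total mass one.\<close>

lemma nn_integral_swap_le:
  fixes f :: "complex \<Rightarrow> complex \<Rightarrow> ennreal"
  assumes f: "case_prod f \<in> borel_measurable (borel \<Otimes>\<^sub>M borel)"
    and le: "\<And>\<xi>. norm \<xi> \<le> R0 \<Longrightarrow> (\<integral>\<^sup>+z. f z \<xi> \<partial>lborel) \<le> K"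
  shows "(\<integral>\<^sup>+z. (\<integral>\<^sup>+\<xi>. f z \<xi> \<partial>\<mu>) \<partial>lborel) \<le> K"
proof -
  interpret P: pair_sigma_finite "lborel :: complex measure" \<mu> by (rule pair_sigma_finite_lborel_mu)
  have m: "case_prod f \<in> borel_measurable (lborel \<Otimes>\<^sub>M \<mu>)" by (rule borel_measurable_pairI[OF f])
  have "(\<integral>\<^sup>+z. (\<integral>\<^sup>+\<xi>. f z \<xi> \<partial>\<mu>) \<partial>lborel) = (\<integral>\<^sup>+\<xi>. (\<integral>\<^sup>+z. f z \<xi> \<partial>lborel) \<partial>\<mu>)"
    using P.Fubini[OF m] by simp
  also have "\<dots> \<le> (\<integral>\<^sup>+\<xi>. K \<partial>\<mu>)"
    using supp_mu le by (intro nn_integral_mono_AE) (auto elim: eventually_mono)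
  also have "\<dots> = K" using emeasure_space_1 by simp
  finally show ?thesis .
qed

lemma integrable_pair_mu:
  fixes f :: "complex \<Rightarrow> complex \<Rightarrow> 'b::{banach, second_countable_topology}"
  assumes f: "case_prod f \<in> borel_measurable (borel \<Otimes>\<^sub>M borel)"
    and le: "\<And>\<xi>. norm \<xi> \<le> R0 \<Longrightarrow> (\<integral>\<^sup>+z. ennreal (norm (f z \<xi>)) \<partial>lborel) \<le> ennreal K"
  shows "integrable (lborel \<Otimes>\<^sub>M \<mu>) (case_prod f)"
proof (rule integrableI_bounded)
  show m: "case_prod f \<in> borel_measurable (lborel \<Otimes>\<^sub>M \<mu>)" by (rule borel_measurable_pairI[OF f])
  have m': "(\<lambda>x. ennreal (norm (case_prod f x))) \<in> borel_measurable (lborel \<Otimes>\<^sub>M \<mu>)"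
    using m by measurable
  have "(\<integral>\<^sup>+x. ennreal (norm (case_prod f x)) \<partial>(lborel \<Otimes>\<^sub>M \<mu>))
      = (\<integral>\<^sup>+z. (\<integral>\<^sup>+\<xi>. ennreal (norm (f z \<xi>)) \<partial>\<mu>) \<partial>lborel)"
    using nn_integral_fst[OF m'] by simp
  also have "\<dots> \<le> ennreal K"
  proof (rule nn_integral_swap_le[OF _ le])
    show "(\<lambda>(z, \<xi>). ennreal (norm (f z \<xi>))) \<in> borel_measurable (borel \<Otimes>\<^sub>M borel)"
      using f by (simp add: split_def)
  qed
  finally show "(\<integral>\<^sup>+x. ennreal (norm (case_prod f x)) \<partial>(lborel \<Otimes>\<^sub>M \<mu>)) < \<infinity>"
    using ennreal_less_top le_less_trans by (metis infinity_ennreal_def)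
qed

lemma borel_measurable_muI: "f \<in> borel_measurable borel \<Longrightarrow> f \<in> borel_measurable \<mu>"
  by (simp add: measurable_cong_sets[OF sets_mu refl])

text \<open>On each disc the double integral is finite by Tonelli, so the inner integral is finite
  almost everywhere there; countably many discs exhaust the plane.\<close>

lemma AE_integrable_powr:
  assumes p: "0 \<le> p" "p < 2"
  shows "AE z in lborel. integrable \<mu> (\<lambda>\<xi>. norm (z - \<xi>) powr - p)"
proof -
  have "AE z in lborel. norm z \<le> real (Suc n) \<longrightarrow> integrable \<mu> (\<lambda>\<xi>. norm (z - \<xi>) powr - p)" for n
  proof -
    let ?f = "\<lambda>(z::complex) (\<xi>::complex). ennreal (norm (z - \<xi>) powr - p) * indicator (cball 0 (real (Suc n))) z"
    have m: "case_prod ?f \<in> borel_measurable (borel \<Otimes>\<^sub>M borel)"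
      unfolding split_def by measurable
    have m2: "case_prod ?f \<in> borel_measurable (lborel \<Otimes>\<^sub>M \<mu>)" by (rule borel_measurable_pairI[OF m])
    have "(\<integral>\<^sup>+z. (\<integral>\<^sup>+\<xi>. ?f z \<xi> \<partial>\<mu>) \<partial>lborel) \<le> ennreal (riesz_const p (real (Suc n) + 2 * R0))"
      by (rule nn_integral_swap_le[OF m]) (rule nn_integral_norm_powr_cball', use p R0_nonneg in auto)
    also have "\<dots> < \<infinity>" by simp
    finally have "(\<integral>\<^sup>+z. (\<integral>\<^sup>+\<xi>. ?f z \<xi> \<partial>\<mu>) \<partial>lborel) \<noteq> \<infinity>" by simp
    moreover have "(\<lambda>z. \<integral>\<^sup>+\<xi>. ?f z \<xi> \<partial>\<mu>) \<in> borel_measurable lborel"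
      using borel_measurable_nn_integral[OF m2] .
    ultimately have "AE z in lborel. (\<integral>\<^sup>+\<xi>. ?f z \<xi> \<partial>\<mu>) \<noteq> \<infinity>"
      by (intro nn_integral_noteq_infinite)
    then show ?thesis
    proof (eventually_elim, intro impI integrableI_bounded)
      fix z :: complex assume "norm z \<le> real (Suc n)" "(\<integral>\<^sup>+\<xi>. ?f z \<xi> \<partial>\<mu>) \<noteq> \<infinity>"
      then show "(\<integral>\<^sup>+\<xi>. ennreal (norm (norm (z - \<xi>) powr - p)) \<partial>\<mu>) < \<infinity>"
        by (simp flip: less_top)
      show "(\<lambda>\<xi>. norm (z - \<xi>) powr - p) \<in> borel_measurable \<mu>"
        by (rule borel_measurable_muI) measurable
    qed
  qed
  then have "AE z in lborel. \<forall>n. norm z \<le> real (Suc n) \<longrightarrow> integrable \<mu> (\<lambda>\<xi>. norm (z - \<xi>) powr - p)"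
    unfolding AE_all_countable by blast
  then show ?thesis
  proof eventually_elim
    fix z :: complex assume *: "\<forall>n. norm z \<le> real (Suc n) \<longrightarrow> integrable \<mu> (\<lambda>\<xi>. norm (z - \<xi>) powr - p)"
    obtain n where "norm z < real n" using reals_Archimedean2 by blast
    then show "integrable \<mu> (\<lambda>\<xi>. norm (z - \<xi>) powr - p)" using *[rule_format, of n] by simp
  qed
qed

lemma AE_integrable_kernel: "AE z in lborel. integrable \<mu> (\<lambda>\<xi>. reg_kernel 0 (z - \<xi>))"
proof -
  have "AE z in lborel. integrable \<mu> (\<lambda>\<xi>. norm (z - \<xi>) powr - 1)" by (rule AE_integrable_powr) auto
  then show ?thesis
  proof eventually_elim
    fix z assume i: "integrable \<mu> (\<lambda>\<xi>. norm (z - \<xi>) powr - 1)"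
    show "integrable \<mu> (\<lambda>\<xi>. reg_kernel 0 (z - \<xi>))"
      using norm_reg_kernel_le[of 0]
      by (intro Bochner_Integration.integrable_bound[OF i]) (auto intro!: borel_measurable_muI)
  qed
qed

text \<open>A finite measure has countably many atoms, and countable sets are Lebesgue null.\<close>

lemma AE_no_atom: "AE z in lborel. AE \<xi> in \<mu>. \<xi> \<noteq> z"
proof -
  have "{z. measure \<mu> {z} \<noteq> 0} \<in> null_sets lborel"
    by (intro countable_imp_null_set_lborel countable_support)
  then have "AE z in lborel. z \<notin> {z. measure \<mu> {z} \<noteq> 0}" by (rule AE_not_in)
  then show ?thesis
  proof (eventually_elim)
    fix z assume "z \<notin> {z. measure \<mu> {z} \<noteq> 0}"
    then have "{z} \<in> null_sets \<mu>" by (auto simp: null_sets_def emeasure_eq_measure sets_mu)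
    then show "AE \<xi> in \<mu>. \<xi> \<noteq> z" by (auto dest: AE_not_in)
  qed
qed

text \<open>Integrating Green's formula for one pole over all poles shows that the distributional
  Laplacian of the potential is \<open>green_const\<close> times \<open>\<mu>\<close>. The double
  integral converges absolutely because the kernel is locally integrable uniformly in the
  pole.\<close>

lemma green_mu:
  fixes \<phi> :: "complex \<Rightarrow> real"
  assumes der: "\<And>z. (\<phi> has_derivative (\<lambda>h. G z \<bullet> h)) (at z)"
    and cont: "continuous_on UNIV G"
    and supp: "\<And>z. norm z > r \<Longrightarrow> \<phi> z = 0"
  shows "(\<integral>z. G z \<bullet> reg_grad 0 \<mu> z \<partial>lborel) = - green_const * (\<integral>\<xi>. \<phi> \<xi> \<partial>\<mu>)"
proof -
  interpret P: pair_sigma_finite "lborel :: complex measure" \<mu> by (rule pair_sigma_finite_lborel_mu)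
  have [measurable]: "G \<in> borel_measurable borel"
    by (intro borel_measurable_continuous_onI cont)
  have G0: "G z = 0" if "norm z > r" for z
    using has_derivative_eq_0_outside[OF der supp that] by (metis inner_eq_zero_iff)
  obtain B where B: "0 \<le> B" "\<And>z. norm (G z) \<le> B"
    using bounded_continuous_compact_support[OF cont G0] by blast
  let ?f = "\<lambda>(z::complex) (\<xi>::complex). G z \<bullet> reg_kernel 0 (z - \<xi>)"
  define r' where "r' = max r 1"
  have int: "integrable (lborel \<Otimes>\<^sub>M \<mu>) (case_prod ?f)"
  proof (rule integrable_pair_mu)
    show "case_prod ?f \<in> borel_measurable (borel \<Otimes>\<^sub>M borel)"
      unfolding split_def by measurable
    fix \<xi> :: complex assume \<xi>: "norm \<xi> \<le> R0"
    have "(\<integral>\<^sup>+z. ennreal (norm (?f z \<xi>)) \<partial>lborel)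
       \<le> (\<integral>\<^sup>+z. ennreal B * (ennreal (norm (z - \<xi>) powr -1) * indicator (cball 0 r') z) \<partial>lborel)"
    proof (intro nn_integral_mono)
      fix z
      show "ennreal (norm (?f z \<xi>)) \<le> ennreal B * (ennreal (norm (z - \<xi>) powr -1) * indicator (cball 0 r') z)"
      proof (cases "norm z \<le> r")
        case True
        have "norm (?f z \<xi>) \<le> norm (G z) * norm (reg_kernel 0 (z - \<xi>))"
          using Cauchy_Schwarz_ineq2 by auto
        also have "\<dots> \<le> B * norm (z - \<xi>) powr -1"
          by (intro mult_mono B norm_reg_kernel_le) auto
        finally have "ennreal (norm (?f z \<xi>)) \<le> ennreal (B * norm (z - \<xi>) powr -1)" by (rule ennreal_leI)
        then show ?thesis using True B by (simp add: r'_def flip: ennreal_mult)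
      qed (use G0 in auto)
    qed
    also have "\<dots> = ennreal B * (\<integral>\<^sup>+z. ennreal (norm (z - \<xi>) powr -1) * indicator (cball 0 r') z \<partial>lborel)"
      by (rule nn_integral_cmult) measurable
    also have "\<dots> \<le> ennreal B * ennreal (riesz_const 1 (r' + 2 * R0))"
      using \<xi> R0_nonneg by (intro mult_left_mono nn_integral_norm_powr_cball') (auto simp: r'_def)
    finally show "(\<integral>\<^sup>+z. ennreal (norm (?f z \<xi>)) \<partial>lborel) \<le> ennreal (B * riesz_const 1 (r' + 2 * R0))"
      using B by (simp add: ennreal_mult)
  qed
  have "(\<integral>z. G z \<bullet> reg_grad 0 \<mu> z \<partial>lborel) = (\<integral>z. (\<integral>\<xi>. ?f z \<xi> \<partial>\<mu>) \<partial>lborel)"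
  proof (rule integral_cong_AE)
    show "(\<lambda>z. \<integral>\<xi>. ?f z \<xi> \<partial>\<mu>) \<in> borel_measurable lborel"
      using measurable_integral_mu[of ?f] by (simp add: split_def)
    show "AE z in lborel. G z \<bullet> reg_grad 0 \<mu> z = (\<integral>\<xi>. ?f z \<xi> \<partial>\<mu>)"
      using AE_integrable_kernel by eventually_elim (simp add: reg_grad_def)
  qed measurable
  also have "\<dots> = (\<integral>\<xi>. (\<integral>z. ?f z \<xi> \<partial>lborel) \<partial>\<mu>)"
    using P.Fubini_integral[OF int] by simp
  also have "\<dots> = (\<integral>\<xi>. - green_const * \<phi> \<xi> \<partial>\<mu>)"
    by (simp add: green_kernel[OF der cont supp])
  finally show ?thesis by simp
qed

lemma nn_integral_reg_grad_weighted:
  assumes q: "0 \<le> q" "1 + q < 2" and r: "0 < r" "norm a \<le> s" "norm b \<le> s" "R0 \<le> s"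
  shows "(\<integral>\<^sup>+z. ennreal (norm (reg_grad 0 \<mu> z) * norm (z - b) powr - q) * indicator (cball a r) z \<partial>lborel)
     \<le> ennreal (2 * riesz_const (1 + q) (r + 2 * s))"
proof -
  let ?f = "\<lambda>(z::complex) (\<xi>::complex). ennreal (norm (z - \<xi>) powr - 1 * norm (z - b) powr - q) * indicator (cball a r) z"
  have m: "case_prod ?f \<in> borel_measurable (borel \<Otimes>\<^sub>M borel)" unfolding split_def by measurable
  have m\<mu>: "(\<lambda>\<xi>. ennreal (norm (z - \<xi>) powr - 1)) \<in> borel_measurable \<mu>" for z :: complex
    by (rule borel_measurable_muI) measurable
  have "(\<integral>\<^sup>+z. ennreal (norm (reg_grad 0 \<mu> z) * norm (z - b) powr - q) * indicator (cball a r) z \<partial>lborel)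
     \<le> (\<integral>\<^sup>+z. (\<integral>\<^sup>+\<xi>. ?f z \<xi> \<partial>\<mu>) \<partial>lborel)"
  proof (intro nn_integral_mono)
    fix z
    have "ennreal (norm (reg_grad 0 \<mu> z)) \<le> (\<integral>\<^sup>+\<xi>. ennreal (norm (reg_kernel 0 (z - \<xi>))) \<partial>\<mu>)"
      unfolding reg_grad_def by (rule ennreal_norm_integral_le)
    also have "\<dots> \<le> (\<integral>\<^sup>+\<xi>. ennreal (norm (z - \<xi>) powr -1) \<partial>\<mu>)"
      by (intro nn_integral_mono ennreal_leI norm_reg_kernel_le)
    finally have "ennreal (norm (reg_grad 0 \<mu> z)) * (ennreal (norm (z - b) powr - q) * indicator (cball a r) z)
       \<le> (\<integral>\<^sup>+\<xi>. ennreal (norm (z - \<xi>) powr -1) \<partial>\<mu>) * (ennreal (norm (z - b) powr - q) * indicator (cball a r) z)"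
      by (intro mult_right_mono) auto
    also have "\<dots> = (\<integral>\<^sup>+\<xi>. ?f z \<xi> \<partial>\<mu>)"
      by (subst nn_integral_multc[symmetric, OF m\<mu>]) (simp only: ennreal_mult_assoc powr_ge_zero)
    finally show "ennreal (norm (reg_grad 0 \<mu> z) * norm (z - b) powr - q) * indicator (cball a r) z \<le> (\<integral>\<^sup>+\<xi>. ?f z \<xi> \<partial>\<mu>)"
      by (simp only: ennreal_mult_assoc powr_ge_zero norm_ge_zero)
  qed
  also have "\<dots> \<le> ennreal (2 * riesz_const (1 + q) (r + 2 * s))"
    by (rule nn_integral_swap_le[OF m], rule nn_integral_two_norm_powr_cball) (use q r in auto)
  finally show ?thesis .
qed

text \<open>The weight stands for the gradient of a second potential near a simple pole of the
  right-hand side. The exponent 7/4 is 5/4 + 1/2, and the factor e^(1/4) makes the error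
  vanish.\<close>

lemma nn_integral_reg_grad_diff_weighted:
  assumes e: "e > 0" and r: "0 < r" "norm a \<le> s" "norm b \<le> s" "R0 \<le> s"
  shows "(\<integral>\<^sup>+z. ennreal (norm (reg_grad e \<mu> z - reg_grad 0 \<mu> z) * norm (z - b) powr - (1/2)) * indicator (cball a r) z \<partial>lborel)
     \<le> ennreal (e powr (1/4) * (2 * riesz_const (7/4) (r + 2 * s)))"
proof -
  let ?f = "\<lambda>(z::complex) (\<xi>::complex). ennreal (norm (z - \<xi>) powr - (5/4) * norm (z - b) powr - (1/2)) * indicator (cball a r) z"
  have m: "case_prod ?f \<in> borel_measurable (borel \<Otimes>\<^sub>M borel)" unfolding split_def by measurable
  have m\<mu>: "(\<lambda>\<xi>. ennreal (norm (z - \<xi>) powr - (5/4))) \<in> borel_measurable \<mu>" for z :: complex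
    by (rule borel_measurable_muI) measurable
  have m2: "(\<lambda>z. \<integral>\<^sup>+\<xi>. ?f z \<xi> \<partial>\<mu>) \<in> borel_measurable lborel"
    by (rule borel_measurable_nn_integral, rule borel_measurable_pairI[OF m])
  have "(\<integral>\<^sup>+z. ennreal (norm (reg_grad e \<mu> z - reg_grad 0 \<mu> z) * norm (z - b) powr - (1/2)) * indicator (cball a r) z \<partial>lborel)
     \<le> (\<integral>\<^sup>+z. ennreal (e powr (1/4)) * (\<integral>\<^sup>+\<xi>. ?f z \<xi> \<partial>\<mu>) \<partial>lborel)"
  proof (rule nn_integral_mono_AE)
    show "AE z in lborel. ennreal (norm (reg_grad e \<mu> z - reg_grad 0 \<mu> z) * norm (z - b) powr - (1/2)) * indicator (cball a r) z
       \<le> ennreal (e powr (1/4)) * (\<integral>\<^sup>+\<xi>. ?f z \<xi> \<partial>\<mu>)"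
      using AE_integrable_kernel
    proof eventually_elim
      fix z assume i: "integrable \<mu> (\<lambda>\<xi>. reg_kernel 0 (z - \<xi>))"
      have "reg_grad e \<mu> z - reg_grad 0 \<mu> z = (\<integral>\<xi>. reg_kernel e (z - \<xi>) - reg_kernel 0 (z - \<xi>) \<partial>\<mu>)"
        unfolding reg_grad_def using i integrable_reg_kernel[OF e] by simp
      then have "ennreal (norm (reg_grad e \<mu> z - reg_grad 0 \<mu> z)) \<le> (\<integral>\<^sup>+\<xi>. ennreal (norm (reg_kernel e (z - \<xi>) - reg_kernel 0 (z - \<xi>))) \<partial>\<mu>)"
        using ennreal_norm_integral_le[of \<mu> "\<lambda>\<xi>. reg_kernel e (z - \<xi>) - reg_kernel 0 (z - \<xi>)"] by simp
      also have "\<dots> \<le> (\<integral>\<^sup>+\<xi>. ennreal (e powr (1/4) * norm (z - \<xi>) powr - (5/4)) \<partial>\<mu>)"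
        by (intro nn_integral_mono ennreal_leI reg_kernel_diff_le e)
      also have "\<dots> = ennreal (e powr (1/4)) * (\<integral>\<^sup>+\<xi>. ennreal (norm (z - \<xi>) powr - (5/4)) \<partial>\<mu>)"
        by (subst nn_integral_cmult[symmetric, OF m\<mu>]) (simp add: ennreal_mult)
      finally have "ennreal (norm (reg_grad e \<mu> z - reg_grad 0 \<mu> z)) * (ennreal (norm (z - b) powr - (1/2)) * indicator (cball a r) z)
         \<le> ennreal (e powr (1/4)) * (\<integral>\<^sup>+\<xi>. ennreal (norm (z - \<xi>) powr - (5/4)) \<partial>\<mu>) * (ennreal (norm (z - b) powr - (1/2)) * indicator (cball a r) z)"
        by (intro mult_right_mono) auto
      also have "\<dots> = ennreal (e powr (1/4)) * (\<integral>\<^sup>+\<xi>. ?f z \<xi> \<partial>\<mu>)"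
        unfolding mult.assoc by (subst nn_integral_multc[symmetric, OF m\<mu>]) (simp only: ennreal_mult_assoc powr_ge_zero)
      finally show "ennreal (norm (reg_grad e \<mu> z - reg_grad 0 \<mu> z) * norm (z - b) powr - (1/2)) * indicator (cball a r) z
          \<le> ennreal (e powr (1/4)) * (\<integral>\<^sup>+\<xi>. ?f z \<xi> \<partial>\<mu>)"
        by (simp only: ennreal_mult_assoc powr_ge_zero norm_ge_zero)
    qed
  qed
  also have "\<dots> = ennreal (e powr (1/4)) * (\<integral>\<^sup>+z. (\<integral>\<^sup>+\<xi>. ?f z \<xi> \<partial>\<mu>) \<partial>lborel)"
    by (rule nn_integral_cmult[OF m2])
  also have "\<dots> \<le> ennreal (e powr (1/4)) * ennreal (2 * riesz_const (5/4 + 1/2) (r + 2 * s))"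
    by (intro mult_left_mono, rule nn_integral_swap_le[OF m], rule nn_integral_two_norm_powr_cball) (use r in auto)
  also have "\<dots> = ennreal (e powr (1/4) * (2 * riesz_const (7/4) (r + 2 * s)))"
    by (subst ennreal_mult) auto
  finally show ?thesis .
qed

end

section \<open>Bounds for potentials, their limits, and atoms\<close>

lemma reg_log_le:
  assumes "norm z \<le> r" "norm \<xi> \<le> R" "0 \<le> e" "e \<le> 1" "0 \<le> r" "0 \<le> R"
  shows "ln ((norm (z - \<xi>))\<^sup>2 + e\<^sup>2) / 2 \<le> ln ((r + R)\<^sup>2 + 1) / 2"
proof (cases "(norm (z - \<xi>))\<^sup>2 + e\<^sup>2 = 0")
  \<comment> \<open>This happens only when e = 0 and z = \<xi>; there \<open>ln 0\<close> is 0 by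
    convention, and the right side is nonnegative.\<close>
  case True
  then show ?thesis by (simp del: sum_power2_eq_zero_iff)
next
  case False
  then have "(norm (z - \<xi>))\<^sup>2 + e\<^sup>2 > 0" by (metis sum_power2_ge_zero order_le_less)
  moreover have "norm (z - \<xi>) \<le> r + R" using norm_triangle_ineq4[of z \<xi>] assms by linarith
  then have "(norm (z - \<xi>))\<^sup>2 \<le> (r + R)\<^sup>2" by (intro power_mono) auto
  moreover have "e\<^sup>2 \<le> 1" using assms by (simp add: power_le_one)
  ultimately have "ln ((norm (z - \<xi>))\<^sup>2 + e\<^sup>2) \<le> ln ((r + R)\<^sup>2 + 1)"
    by (subst ln_le_cancel_iff) (linarith)+
  then show ?thesis by simp
qed

text \<open>Both directions follow from ln x \<le> x - 1, applied to |w|^2 + e^2 and to 1/|w|. The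
  bound is free of e and serves as majorant for e tending to 0.\<close>

lemma abs_reg_log_le:
  assumes "w \<noteq> (0::complex)" "0 \<le> e" "e \<le> 1"
  shows "\<bar>ln ((norm w)\<^sup>2 + e\<^sup>2) / 2\<bar> \<le> norm w powr -1 + ((norm w)\<^sup>2 + 1)"
proof -
  have w: "norm w > 0" using assms by simp
  have e: "e\<^sup>2 \<le> 1" using assms by (simp add: power_le_one)
  have pos: "(norm w)\<^sup>2 + e\<^sup>2 > 0" using w by (simp add: add_pos_nonneg)
  have "ln ((norm w)\<^sup>2 + e\<^sup>2) \<le> (norm w)\<^sup>2 + e\<^sup>2 - 1" by (rule ln_le_minus_one[OF pos])
  then have 1: "ln ((norm w)\<^sup>2 + e\<^sup>2) / 2 \<le> (norm w)\<^sup>2 + 1" using e by (simp add: field_simps) (smt (verit) zero_le_power2)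
  have "ln (1 / norm w) \<le> 1 / norm w - 1" using w by (intro ln_le_minus_one) auto
  then have "- ln (norm w) \<le> 1 / norm w" using w by (simp add: ln_div)
  moreover have "2 * ln (norm w) = ln ((norm w)\<^sup>2)" using w by (simp add: ln_realpow)
  moreover have "ln ((norm w)\<^sup>2) \<le> ln ((norm w)\<^sup>2 + e\<^sup>2)" using w pos by (subst ln_le_cancel_iff) auto
  ultimately have 2: "- (ln ((norm w)\<^sup>2 + e\<^sup>2) / 2) \<le> norm w powr -1" using w by (simp add: powr_minus_divide)
  have "0 \<le> norm w powr -1" "0 \<le> (norm w)\<^sup>2 + 1" by auto
  then show ?thesis using 1 2 by linarith
qed

context compact_prob
begin

lemma reg_pot_le:
  assumes "norm z \<le> r" "0 < e" "e \<le> 1" "0 \<le> r"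
  shows "reg_pot e \<mu> z \<le> ln ((r + R0)\<^sup>2 + 1) / 2"
proof -
  have "reg_pot e \<mu> z \<le> (\<integral>\<xi>. ln ((r + R0)\<^sup>2 + 1) / 2 \<partial>\<mu>)"
    unfolding reg_pot_def
  proof (rule integral_mono_AE)
    show "AE \<xi> in \<mu>. ln ((norm (z - \<xi>))\<^sup>2 + e\<^sup>2) / 2 \<le> ln ((r + R0)\<^sup>2 + 1) / 2"
      using supp_mu by eventually_elim (rule reg_log_le, use assms R0_nonneg in auto)
  qed (use integrable_reg_log assms in auto)
  then show ?thesis by simp
qed

lemma reg_pot_tendsto:
  assumes i: "integrable \<mu> (\<lambda>\<xi>. norm (z - \<xi>) powr - 1)" and na: "AE \<xi> in \<mu>. \<xi> \<noteq> z"
  shows "(\<lambda>n. reg_pot (eps n) \<mu> z) \<longlonglongrightarrow> reg_pot 0 \<mu> z"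
  unfolding reg_pot_def
proof (rule integral_dominated_convergence[where w = "\<lambda>\<xi>. norm (z - \<xi>) powr -1 + ((norm (z - \<xi>))\<^sup>2 + 1)"])
  have "integrable \<mu> (\<lambda>\<xi>. (norm (z - \<xi>))\<^sup>2 + 1)"
  proof (rule integrable_bounded_on_support)
    fix \<xi> :: complex assume "norm \<xi> \<le> R0"
    then have "norm (z - \<xi>) \<le> norm z + R0" using norm_triangle_ineq4[of z \<xi>] by linarith
    then show "norm ((norm (z - \<xi>))\<^sup>2 + 1) \<le> (norm z + R0)\<^sup>2 + 1" by (auto intro!: power_mono)
  qed measurable
  then show "integrable \<mu> (\<lambda>\<xi>. norm (z - \<xi>) powr -1 + ((norm (z - \<xi>))\<^sup>2 + 1))"
    using i by (rule Bochner_Integration.integrable_add[rotated])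
  show "AE \<xi> in \<mu>. (\<lambda>n. ln ((norm (z - \<xi>))\<^sup>2 + (eps n)\<^sup>2) / 2) \<longlonglongrightarrow> ln ((norm (z - \<xi>))\<^sup>2 + 0\<^sup>2) / 2"
    using na by eventually_elim (intro tendsto_intros LIMSEQ_inverse_real_of_nat, auto)
  show "AE \<xi> in \<mu>. norm (ln ((norm (z - \<xi>))\<^sup>2 + (eps n)\<^sup>2) / 2) \<le> norm (z - \<xi>) powr -1 + ((norm (z - \<xi>))\<^sup>2 + 1)" for n
    using na
  proof eventually_elim
    fix \<xi> :: complex assume "\<xi> \<noteq> z"
    then show "norm (ln ((norm (z - \<xi>))\<^sup>2 + (eps n)\<^sup>2) / 2) \<le> norm (z - \<xi>) powr -1 + ((norm (z - \<xi>))\<^sup>2 + 1)"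
      using abs_reg_log_le[of "z - \<xi>" "eps n"] eps_pos[of n] eps_le_1[of n] unfolding real_norm_def by simp
  qed
qed (rule borel_measurable_muI, measurable)+

lemma AE_reg_pot_tendsto: "AE z in lborel. (\<lambda>n. reg_pot (eps n) \<mu> z) \<longlonglongrightarrow> reg_pot 0 \<mu> z"
proof -
  have "AE z in lborel. integrable \<mu> (\<lambda>\<xi>. norm (z - \<xi>) powr - 1)" by (rule AE_integrable_powr) auto
  then show ?thesis using AE_no_atom by eventually_elim (rule reg_pot_tendsto)
qed

text \<open>An atom of mass m contributes m ln|z - a| up to regularisation, which is very negative
  near \<open>a\<close>, while the rest of the measure contributes a quantity bounded above. The
  same radius works for all small e, so that the truncated potentials vanish near \<open>a\<close>
  along the whole regularisation.\<close>

lemma reg_pot_near_atom: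
  assumes atom: "measure \<mu> {a} > 0"
  obtains d where "0 < d" "\<And>e z. 0 < e \<Longrightarrow> e \<le> d \<Longrightarrow> norm (z - a) \<le> d \<Longrightarrow> reg_pot e \<mu> z < - M"
proof -
  define m where "m = measure \<mu> {a}"
  define B where "B = ln (((norm a + 1) + R0)\<^sup>2 + 1) / 2"
  \<comment> \<open>The level L solves B + m (L - B) = - M - 1. With d \<le> exp L / 2, points and
    parameters within \<open>d\<close> satisfy ln(|z - a|^2 + e^2)/2 \<le> L.\<close>
  define L where "L = B - (M + B + 1) / m"
  define d where "d = min 1 (exp L / 2)"
  have m: "m > 0" using atom by (simp add: m_def)
  have d: "0 < d" "d \<le> 1" "2 * d\<^sup>2 \<le> (exp L)\<^sup>2"
  proof -
    have "d\<^sup>2 \<le> (exp L / 2)\<^sup>2" by (intro power_mono) (auto simp: d_def)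
    also have "\<dots> \<le> (exp L)\<^sup>2 / 2" by (simp add: power_divide)
    finally show "2 * d\<^sup>2 \<le> (exp L)\<^sup>2" by simp
  qed (auto simp: d_def)
  show ?thesis
  proof (rule that[OF d(1)])
    fix e z assume e: "0 < e" "e \<le> d" and z: "norm (z - a) \<le> d"
    let ?l = "ln ((norm (z - a))\<^sup>2 + e\<^sup>2) / 2"
    have nz: "norm z \<le> norm a + 1" using norm_triangle_ineq2[of z a] z d by linarith
    have pos: "(norm (z - a))\<^sup>2 + e\<^sup>2 > 0" using e by (simp add: add_nonneg_pos)
    have "(norm (z - a))\<^sup>2 + e\<^sup>2 \<le> d\<^sup>2 + d\<^sup>2" using z e by (intro add_mono power_mono) auto
    then have "(norm (z - a))\<^sup>2 + e\<^sup>2 \<le> (exp L)\<^sup>2" using d by linarith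
    then have "ln ((norm (z - a))\<^sup>2 + e\<^sup>2) \<le> ln ((exp L)\<^sup>2)" using pos by (subst ln_le_cancel_iff) auto
    then have l: "?l \<le> L" by (simp add: ln_realpow)
    have ia: "integrable \<mu> (indicator {a} :: complex \<Rightarrow> real)"
      by (intro integrable_real_indicator) (auto simp: sets_mu emeasure_eq_measure)
    have "reg_pot e \<mu> z \<le> (\<integral>\<xi>. B + indicator {a} \<xi> * (?l - B) \<partial>\<mu>)"
      unfolding reg_pot_def
    proof (rule integral_mono_AE)
      show "integrable \<mu> (\<lambda>\<xi>. B + indicator {a} \<xi> * (?l - B))"
        by (intro Bochner_Integration.integrable_add integrable_mult_left ia) auto
      show "AE \<xi> in \<mu>. ln ((norm (z - \<xi>))\<^sup>2 + e\<^sup>2) / 2 \<le> B + indicator {a} \<xi> * (?l - B)"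
        using supp_mu
      proof eventually_elim
        fix \<xi> :: complex assume "norm \<xi> \<le> R0"
        then have "ln ((norm (z - \<xi>))\<^sup>2 + e\<^sup>2) / 2 \<le> B"
          unfolding B_def using nz e d R0_nonneg by (intro reg_log_le) auto
        then show "ln ((norm (z - \<xi>))\<^sup>2 + e\<^sup>2) / 2 \<le> B + indicator {a} \<xi> * (?l - B)"
          by (auto simp: indicator_def)
      qed
    qed (use integrable_reg_log e in auto)
    also have "\<dots> = B + m * (?l - B)"
      using ia by (simp add: m_def integrable_mult_left)
    also have "\<dots> \<le> B + m * (L - B)" using l m by simp
    also have "\<dots> = - M - 1" using m by (simp add: L_def)
    finally show "reg_pot e \<mu> z < - M" by simp
  qed
qed

text \<open>If the pole is within 2r of \<open>a\<close>, the disc lies in a disc of radius 3r about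
  the pole, and the planar estimate gives (4 sqrt(3r))^2 = 48 r. If the pole is farther away, the
  kernel is bounded on the disc and its area is used. The first bound is the majorant, and the
  second the limit, in the argument about poles below.\<close>

lemma average_kernel_le:
  fixes a \<xi> :: complex
  assumes r: "r > 0"
  shows "ennreal (1/r) * (\<integral>\<^sup>+z. ennreal (norm (z - \<xi>) powr - 1) * indicator (cball a r) z \<partial>lborel) \<le> ennreal 48"
    and "\<xi> \<noteq> a \<Longrightarrow> r \<le> norm (\<xi> - a) / 2 \<Longrightarrow>
      ennreal (1/r) * (\<integral>\<^sup>+z. ennreal (norm (z - \<xi>) powr - 1) * indicator (cball a r) z \<partial>lborel) \<le> ennreal (2 * pi * r / norm (\<xi> - a))"
proof -
  have far: "ennreal (1/r) * (\<integral>\<^sup>+z. ennreal (norm (z - \<xi>) powr - 1) * indicator (cball a r) z \<partial>lborel) \<le> ennreal (pi * r / D)"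
    if D: "D > 0" "\<And>z. norm (z - a) \<le> r \<Longrightarrow> norm (z - \<xi>) \<ge> D" for D
  proof -
    have "(\<integral>\<^sup>+z. ennreal (norm (z - \<xi>) powr - 1) * indicator (cball a r) z \<partial>lborel)
       \<le> (\<integral>\<^sup>+z. ennreal (1/D) * indicator (cball a r) z \<partial>lborel)"
    proof (intro nn_integral_mono)
      fix z
      show "ennreal (norm (z - \<xi>) powr - 1) * indicator (cball a r) z \<le> ennreal (1/D) * indicator (cball a r) z"
      proof (cases "norm (z - a) \<le> r")
        case True
        then have "norm (z - \<xi>) powr - 1 \<le> 1 / D"
          using D(1) D(2)[OF True] by (simp add: powr_minus_divide frac_le)
        then show ?thesis by (intro mult_right_mono ennreal_leI) auto
      qed (simp add: dist_norm norm_minus_commute)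
    qed
    also have "\<dots> = ennreal (1/D) * ennreal (pi * r\<^sup>2)"
      using r by (subst nn_integral_cmult_indicator) (auto simp: emeasure_cball unit_ball_vol_2)
    finally have "ennreal (1/r) * (\<integral>\<^sup>+z. ennreal (norm (z - \<xi>) powr - 1) * indicator (cball a r) z \<partial>lborel)
       \<le> ennreal (1/r) * (ennreal (1/D) * ennreal (pi * r\<^sup>2))" by (rule mult_left_mono) simp
    also have "\<dots> = ennreal (pi * r / D)"
      using r D by (simp add: ennreal_mult[symmetric] power2_eq_square)
    finally show ?thesis .
  qed
  show "ennreal (1/r) * (\<integral>\<^sup>+z. ennreal (norm (z - \<xi>) powr - 1) * indicator (cball a r) z \<partial>lborel) \<le> ennreal (2 * pi * r / norm (\<xi> - a))"
    if "\<xi> \<noteq> a" "r \<le> norm (\<xi> - a) / 2"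
  proof -
    have "norm (z - \<xi>) \<ge> norm (\<xi> - a) / 2" if "norm (z - a) \<le> r" for z
      using norm_triangle_ineq[of "\<xi> - z" "z - a"] that \<open>r \<le> norm (\<xi> - a) / 2\<close> by (simp add: norm_minus_commute)
    from far[OF _ this] show ?thesis using that by (simp add: field_simps)
  qed
  show "ennreal (1/r) * (\<integral>\<^sup>+z. ennreal (norm (z - \<xi>) powr - 1) * indicator (cball a r) z \<partial>lborel) \<le> ennreal 48"
  proof (cases "norm (\<xi> - a) \<le> 2 * r")
    case True
    have "cball a r \<subseteq> cball \<xi> (3 * r)"
    proof
      fix z assume "z \<in> cball a r"
      then show "z \<in> cball \<xi> (3 * r)" using True norm_triangle_ineq[of "\<xi> - a" "a - z"] by (simp add: dist_norm)
    qed
    then have "(\<integral>\<^sup>+z. ennreal (norm (z - \<xi>) powr - 1) * indicator (cball a r) z \<partial>lborel)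
       \<le> (\<integral>\<^sup>+z. ennreal (norm (z - \<xi>) powr - 1) * indicator (cball \<xi> (3 * r)) z \<partial>lborel)"
      by (intro nn_integral_mono mult_left_mono) (auto simp: indicator_def)
    also have "\<dots> \<le> ennreal ((2 * (3 * r) powr (1 - 1/2) / (1 - 1/2))\<^sup>2)"
      by (rule nn_integral_norm_powr_cball) (use r in auto)
    also have "(2 * (3 * r) powr (1 - 1/2) / (1 - 1/2))\<^sup>2 = 48 * r"
      using r by (simp add: power_mult_distrib powr_half_sqrt)
    finally have "ennreal (1/r) * (\<integral>\<^sup>+z. ennreal (norm (z - \<xi>) powr - 1) * indicator (cball a r) z \<partial>lborel)
       \<le> ennreal (1/r) * ennreal (48 * r)" by (rule mult_left_mono) simp
    also have "\<dots> = ennreal 48" using r by (simp add: ennreal_mult[symmetric])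
    finally show ?thesis .
  next
    case False
    have "norm (z - \<xi>) \<ge> r" if "norm (z - a) \<le> r" for z
      using norm_triangle_ineq[of "\<xi> - z" "z - a"] that False by (simp add: norm_minus_commute)
    from far[OF r this] have "ennreal (1/r) * (\<integral>\<^sup>+z. ennreal (norm (z - \<xi>) powr - 1) * indicator (cball a r) z \<partial>lborel) \<le> ennreal pi"
      using r by simp
    also have "\<dots> \<le> ennreal 48" using pi_less_4 by (intro ennreal_leI) simp
    finally show ?thesis .
  qed
qed

text \<open>Without an atom at \<open>a\<close>, the averages (1/r) times the integral of |grad u|
  over the disc of radius r tend to 0 by dominated convergence in \<open>\<xi>\<close>. A gradient
  of size at least c/|z - a| keeps them above c pi.\<close>

lemma atom_of_pole:
  assumes c: "c > 0" and d: "d > 0"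
    and ge: "AE z in lborel. norm (z - a) < d \<longrightarrow> c / norm (z - a) \<le> norm (reg_grad 0 \<mu> z)"
  shows "measure \<mu> {a} > 0"
proof (rule ccontr)
  assume "\<not> measure \<mu> {a} > 0"
  then have "{a} \<in> null_sets \<mu>"
    using measure_nonneg[of \<mu> "{a}"] by (auto simp: null_sets_def emeasure_eq_measure sets_mu)
  then have na: "AE \<xi> in \<mu>. \<xi> \<noteq> a" by (auto dest: AE_not_in)
  define J where "J r \<xi> = ennreal (1/r) * (\<integral>\<^sup>+z. ennreal (norm (z - \<xi>) powr - 1) * indicator (cball a r) z \<partial>lborel)" for r :: real and \<xi>
  have m0: "(\<lambda>(z, \<xi>::complex). ennreal (norm (z - \<xi>) powr - 1) * indicator (cball a r) z) \<in> borel_measurable (borel \<Otimes>\<^sub>M borel)" for r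
    unfolding split_def by measurable
  have Jm: "J r \<in> borel_measurable \<mu>" for r
    unfolding J_def
    by (intro borel_measurable_muI borel_measurable_times_ennreal borel_measurable_const
        lborel.borel_measurable_nn_integral) (simp add: split_def, measurable)
  have "(\<lambda>n. \<integral>\<^sup>+\<xi>. J (eps n) \<xi> \<partial>\<mu>) \<longlonglongrightarrow> (\<integral>\<^sup>+\<xi>. 0 \<partial>\<mu>)"
  proof (rule nn_integral_dominated_convergence[where w = "\<lambda>_. ennreal 48"])
    show "AE \<xi> in \<mu>. J (eps n) \<xi> \<le> ennreal 48" for n
      unfolding J_def by (intro AE_I2 average_kernel_le(1) eps_pos)
    show "(\<integral>\<^sup>+\<xi>. ennreal 48 \<partial>\<mu>) < \<infinity>" by (simp add: emeasure_eq_measure)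
    show "AE \<xi> in \<mu>. (\<lambda>n. J (eps n) \<xi>) \<longlonglongrightarrow> 0"
      using na
    proof eventually_elim
      fix \<xi> :: complex assume ne: "\<xi> \<noteq> a"
      have "eventually (\<lambda>n. eps n < norm (\<xi> - a) / 2) sequentially"
        using ne by (intro order_tendstoD(2)[OF LIMSEQ_inverse_real_of_nat]) auto
      then have "eventually (\<lambda>n. J (eps n) \<xi> \<le> ennreal (2 * pi * eps n / norm (\<xi> - a))) sequentially"
        by eventually_elim (unfold J_def, rule average_kernel_le(2)[OF eps_pos ne], simp)
      moreover have "(\<lambda>n. ennreal (2 * pi * eps n / norm (\<xi> - a))) \<longlonglongrightarrow> ennreal (2 * pi * 0 / norm (\<xi> - a))"
        by (intro tendsto_ennrealI tendsto_intros LIMSEQ_inverse_real_of_nat) (use ne in auto)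
      ultimately show "(\<lambda>n. J (eps n) \<xi>) \<longlonglongrightarrow> 0"
        by (intro tendsto_sandwich[where f = "\<lambda>_. 0" and g = "\<lambda>n. J (eps n) \<xi>"]) auto
    qed
  qed (auto intro: Jm)
  moreover have "eventually (\<lambda>n. ennreal (c * pi) \<le> (\<integral>\<^sup>+\<xi>. J (eps n) \<xi> \<partial>\<mu>)) sequentially"
  proof -
    have "eventually (\<lambda>n. eps n < d) sequentially"
      using d by (intro order_tendstoD(2)[OF LIMSEQ_inverse_real_of_nat]) auto
    then show ?thesis
    proof eventually_elim
      fix n assume n: "eps n < d"
      define r where "r = eps n"
      have r: "r > 0" "r < d" using n eps_pos by (auto simp: r_def)
      let ?f = "\<lambda>(z::complex) (\<xi>::complex). ennreal (norm (z - \<xi>) powr - 1) * indicator (cball a r) z"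
      interpret P: pair_sigma_finite "lborel :: complex measure" \<mu> by (rule pair_sigma_finite_lborel_mu)
      have m: "case_prod ?f \<in> borel_measurable (lborel \<Otimes>\<^sub>M \<mu>)" by (rule borel_measurable_pairI[OF m0])
      have mf: "(\<lambda>\<xi>. ?f z \<xi>) \<in> borel_measurable \<mu>" for z by (rule borel_measurable_muI) measurable
      have "ennreal (c / r) * ennreal (pi * r\<^sup>2) = (\<integral>\<^sup>+z. ennreal (c / r) * indicator (cball a r) z \<partial>lborel)"
        using r by (subst nn_integral_cmult_indicator) (auto simp: emeasure_cball unit_ball_vol_2)
      also have "\<dots> \<le> (\<integral>\<^sup>+z. ennreal (norm (reg_grad 0 \<mu> z)) * indicator (cball a r) z \<partial>lborel)"
      proof (rule nn_integral_mono_AE)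
        show "AE z in lborel. ennreal (c / r) * indicator (cball a r) z \<le> ennreal (norm (reg_grad 0 \<mu> z)) * indicator (cball a r) z"
          using ge AE_lborel_singleton[of a]
        proof eventually_elim
          fix z assume z: "norm (z - a) < d \<longrightarrow> c / norm (z - a) \<le> norm (reg_grad 0 \<mu> z)" "z \<noteq> a"
          have "c / r \<le> norm (reg_grad 0 \<mu> z)" if "norm (z - a) \<le> r"
          proof -
            have "c / r \<le> c / norm (z - a)" using that r c z by (intro divide_left_mono) auto
            then show ?thesis using z that r by simp
          qed
          then show "ennreal (c / r) * indicator (cball a r) z \<le> ennreal (norm (reg_grad 0 \<mu> z)) * indicator (cball a r) z"
            by (auto simp: indicator_def dist_norm norm_minus_commute intro!: ennreal_leI)
        qed
      qed
      also have "\<dots> \<le> (\<integral>\<^sup>+z. (\<integral>\<^sup>+\<xi>. ?f z \<xi> \<partial>\<mu>) \<partial>lborel)"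
      proof (intro nn_integral_mono)
        fix z
        have "ennreal (norm (reg_grad 0 \<mu> z)) \<le> (\<integral>\<^sup>+\<xi>. ennreal (norm (reg_kernel 0 (z - \<xi>))) \<partial>\<mu>)"
          unfolding reg_grad_def by (rule ennreal_norm_integral_le)
        also have "\<dots> \<le> (\<integral>\<^sup>+\<xi>. ennreal (norm (z - \<xi>) powr -1) \<partial>\<mu>)"
          by (intro nn_integral_mono ennreal_leI norm_reg_kernel_le)
        finally show "ennreal (norm (reg_grad 0 \<mu> z)) * indicator (cball a r) z \<le> (\<integral>\<^sup>+\<xi>. ?f z \<xi> \<partial>\<mu>)"
        proof (cases "z \<in> cball a r")
          case False
          then have "indicator (cball a r) z = (0::ennreal)" by (simp add: indicator_def)
          then show ?thesis by (simp only: mult_zero_right zero_le)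
        qed (simp only: indicator_simps mult_1_right)
      qed
      also have "\<dots> = (\<integral>\<^sup>+\<xi>. (\<integral>\<^sup>+z. ?f z \<xi> \<partial>lborel) \<partial>\<mu>)"
        using P.Fubini[OF m] by simp
      finally have "ennreal (1/r) * (ennreal (c / r) * ennreal (pi * r\<^sup>2)) \<le> ennreal (1/r) * (\<integral>\<^sup>+\<xi>. (\<integral>\<^sup>+z. ?f z \<xi> \<partial>lborel) \<partial>\<mu>)"
        by (rule mult_left_mono) simp
      also have "\<dots> = (\<integral>\<^sup>+\<xi>. J r \<xi> \<partial>\<mu>)"
        unfolding J_def
        by (rule nn_integral_cmult[symmetric], rule borel_measurable_muI, rule lborel.borel_measurable_nn_integral) 
           (simp add: split_def, measurable)
      also have "ennreal (1/r) * (ennreal (c / r) * ennreal (pi * r\<^sup>2)) = ennreal (c * pi)"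
        using r c by (simp add: ennreal_mult[symmetric] power2_eq_square)
      finally show "ennreal (c * pi) \<le> (\<integral>\<^sup>+\<xi>. J (eps n) \<xi> \<partial>\<mu>)" by (simp add: r_def)
    qed
  qed
  ultimately have "ennreal (c * pi) \<le> 0"
    by (intro tendsto_lowerbound[where f = "\<lambda>n. \<integral>\<^sup>+\<xi>. J (eps n) \<xi> \<partial>\<mu>"]) auto
  then show False
    using mult_pos_pos[OF c pi_gt_zero] by (simp only: le_zero_eq ennreal_eq_0_iff)
qed

end

section \<open>Local behaviour at poles and at infinity\<close>

text \<open>Factoring out the orders m and l of \<open>a\<close> in numerator and denominator leaves
  a quotient continuous and nonzero at \<open>a\<close>. The split l \<le> m + 1 separates poles of
  order at most one, whose square root is a singularity of order at most 1/2, from poles of order at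
  least two.\<close>

lemma rational_function_local:
  fixes p q :: "complex poly" and a :: complex
  assumes "p \<noteq> 0" "q \<noteq> 0"
  obtains (simple) K d where "0 < K" "0 < d"
      "\<And>z. z \<noteq> a \<Longrightarrow> norm (z - a) < d \<Longrightarrow> norm (poly p z / poly q z) \<le> K / norm (z - a)"
  | (high) c d where "0 < c" "0 < d"
      "\<And>z. z \<noteq> a \<Longrightarrow> norm (z - a) < d \<Longrightarrow> c / (norm (z - a))\<^sup>2 \<le> norm (poly p z / poly q z)"
proof -
  define m where "m = order a p"
  define l where "l = order a q"
  obtain p1 where p1: "p = [:-a, 1:] ^ m * p1" "\<not> [:-a, 1:] dvd p1" using order_decomp[OF assms(1)] m_def by blast
  obtain q1 where q1: "q = [:-a, 1:] ^ l * q1" "\<not> [:-a, 1:] dvd q1" using order_decomp[OF assms(2)] l_def by blast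
  have nz: "poly p1 a \<noteq> 0" "poly q1 a \<noteq> 0" using p1(2) q1(2) by (auto simp: poly_eq_0_iff_dvd)
  define f where "f z = norm (poly p1 z / poly q1 z)" for z
  define A where "A = f a"
  have A: "A > 0" using nz by (simp add: A_def f_def)
  have "(f \<longlongrightarrow> A) (at a)"
    unfolding A_def f_def using nz by (intro tendsto_intros isContD[OF poly_isCont]) auto
  from order_tendstoD(1)[OF this, of "A / 2"] order_tendstoD(2)[OF this, of "2 * A"]
  have "eventually (\<lambda>z. f z > A / 2) (at a)" "eventually (\<lambda>z. f z < 2 * A) (at a)" using A by auto
  then have "eventually (\<lambda>z. A / 2 < f z \<and> f z < 2 * A) (at a)" by eventually_elim auto
  then obtain d0 where d0: "d0 > 0" "\<And>z. z \<noteq> a \<Longrightarrow> norm (z - a) < d0 \<Longrightarrow> A / 2 < f z \<and> f z < 2 * A"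
    unfolding eventually_at dist_norm by auto
  define d where "d = min d0 1"
  have d: "d > 0" using d0 by (simp add: d_def)
  have eq: "norm (poly p z / poly q z) = (norm (z - a)) ^ m / (norm (z - a)) ^ l * f z" for z
    by (simp add: p1(1) q1(1) f_def norm_mult norm_divide norm_power)
  show ?thesis
  proof (cases "l \<le> Suc m")
    case True
    have "norm (poly p z / poly q z) \<le> (2 * A) / norm (z - a)" if z: "z \<noteq> a" "norm (z - a) < d" for z
    proof -
      define x where "x = norm (z - a)"
      have x: "0 < x" "x \<le> 1" using z by (auto simp: x_def d_def)
      have "x ^ Suc m \<le> x ^ l" using x True by (intro power_decreasing) auto
      then have "x ^ m / x ^ l \<le> 1 / x" using x by (simp add: divide_simps mult.commute)
      moreover have "f z \<le> 2 * A" "0 \<le> f z" using d0(2)[of z] z by (auto simp: d_def f_def)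
      ultimately have "x ^ m / x ^ l * f z \<le> 1 / x * (2 * A)" using x by (intro mult_mono) auto
      then show ?thesis unfolding eq x_def by simp
    qed
    then show ?thesis using A by (intro simple[OF _ d, of "2 * A"]) auto
  next
    case False
    have "(A / 2) / (norm (z - a))\<^sup>2 \<le> norm (poly p z / poly q z)" if z: "z \<noteq> a" "norm (z - a) < d" for z
    proof -
      define x where "x = norm (z - a)"
      have x: "0 < x" "x \<le> 1" using z by (auto simp: x_def d_def)
      have "x ^ l \<le> x ^ m * x\<^sup>2"
        unfolding power_add[symmetric] using x False by (intro power_decreasing) auto
      then have "1 / x\<^sup>2 \<le> x ^ m / x ^ l" using x by (simp add: divide_simps)
      moreover have "A / 2 \<le> f z" using d0(2)[of z] z by (auto simp: d_def)
      ultimately have "1 / x\<^sup>2 * (A / 2) \<le> x ^ m / x ^ l * f z" using x A by (intro mult_mono) auto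
      then show ?thesis unfolding eq x_def by simp
    qed
    then show ?thesis using A by (intro high[OF _ d, of "A / 2"]) auto
  qed
qed

lemma AE_imp_open_empty:
  fixes S :: "'a::euclidean_space set"
  assumes "open S" "AE z in lborel. z \<notin> S"
  shows "S = {}"
proof (rule ccontr)
  assume "S \<noteq> {}"
  with assms(1) have "\<not> negligible S" by (rule open_not_negligible)
  moreover have "S \<in> null_sets lborel"
    using assms by (subst AE_iff_null_sets) auto
  then have "negligible S" by (simp add: negligible_iff_null_sets null_sets_completionI)
  ultimately show False by simp
qed

text \<open>Convergence to zero is a local question because finitely many of the balls cover the
  compact disc carrying all the functions.\<close>

lemma nn_integral_tendsto_0_local:
  fixes F :: "nat \<Rightarrow> 'a::euclidean_space \<Rightarrow> ennreal"
  assumes m: "\<And>n. F n \<in> borel_measurable borel"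
    and supp: "\<And>n z. norm z > r \<Longrightarrow> F n z = 0"
    and loc: "\<And>a. \<exists>d>0. (\<lambda>n. \<integral>\<^sup>+z. F n z * indicator (ball a d) z \<partial>lborel) \<longlonglongrightarrow> 0"
  shows "(\<lambda>n. \<integral>\<^sup>+z. F n z \<partial>lborel) \<longlonglongrightarrow> 0"
proof -
  have "\<forall>a. \<exists>d. d > 0 \<and> (\<lambda>n. \<integral>\<^sup>+z. F n z * indicator (ball a d) z \<partial>lborel) \<longlonglongrightarrow> 0"
    using loc by blast
  from choice[OF this] obtain d where d': "\<forall>a. d a > 0 \<and> (\<lambda>n. \<integral>\<^sup>+z. F n z * indicator (ball a (d a)) z \<partial>lborel) \<longlonglongrightarrow> 0" ..
  then have d: "\<And>a. d a > 0" "\<And>a. (\<lambda>n. \<integral>\<^sup>+z. F n z * indicator (ball a (d a)) z \<partial>lborel) \<longlonglongrightarrow> 0"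
    by blast+
  have sub: "cball (0::'a) r \<subseteq> (\<Union>a\<in>cball 0 r. ball a (d a))" using d(1) by auto
  obtain T where T: "T \<subseteq> cball 0 r" "finite T" "cball (0::'a) r \<subseteq> (\<Union>a\<in>T. ball a (d a))"
    by (rule compactE_image[OF compact_cball _ sub], rule open_ball, assumption)
  have le: "F n z \<le> (\<Sum>a\<in>T. F n z * indicator (ball a (d a)) z)" for n z
  proof (cases "norm z \<le> r")
    case True
    then obtain a where a: "a \<in> T" "z \<in> ball a (d a)" using T(3) by auto
    have "F n z * indicator (ball a (d a)) z \<le> (\<Sum>a\<in>T. F n z * indicator (ball a (d a)) z)"
      using T(2) a(1) by (intro member_le_sum) auto
    then show ?thesis using a by simp
  qed (simp add: supp)
  have up: "(\<integral>\<^sup>+z. F n z \<partial>lborel) \<le> (\<Sum>a\<in>T. \<integral>\<^sup>+z. F n z * indicator (ball a (d a)) z \<partial>lborel)" for n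
  proof -
    have "(\<integral>\<^sup>+z. F n z \<partial>lborel) \<le> (\<integral>\<^sup>+z. (\<Sum>a\<in>T. F n z * indicator (ball a (d a)) z) \<partial>lborel)"
      by (intro nn_integral_mono le)
    also have "\<dots> = (\<Sum>a\<in>T. \<integral>\<^sup>+z. F n z * indicator (ball a (d a)) z \<partial>lborel)"
      by (intro nn_integral_sum borel_measurable_times_ennreal borel_measurable_indicator) (auto simp: m)
    finally show ?thesis .
  qed
  have lim: "(\<lambda>n. \<Sum>a\<in>T. \<integral>\<^sup>+z. F n z * indicator (ball a (d a)) z \<partial>lborel) \<longlonglongrightarrow> 0"
    using tendsto_sum[where I = T, OF d(2)] by simp
  show ?thesis
    by (rule tendsto_sandwich[OF always_eventually always_eventually tendsto_const lim]) (use up in simp_all)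
qed

lemma reg_kernel_0_diff:
  "norm (reg_kernel 0 x - reg_kernel 0 y) = norm (x - y) / (norm x * norm y)" if "x \<noteq> 0" "y \<noteq> 0"
proof -
  have "reg_kernel 0 x - reg_kernel 0 y = cnj ((y - x) / (x * y))"
    unfolding reg_kernel_0 complex_cnj_diff[symmetric] using that by (simp add: diff_divide_eq_iff divide_diff_eq_iff)
  then show ?thesis by (simp only: complex_mod_cnj norm_divide norm_mult norm_minus_commute)
qed

section \<open>Potential and gradient outside the disc carrying the measure\<close>

context compact_prob
begin

lemma dist_support: "norm \<xi> \<le> R0 \<Longrightarrow> norm z - R0 \<le> norm (z - \<xi>)"
  using norm_triangle_ineq2[of z \<xi>] by linarith

lemma AE_outside:
  assumes "norm z > R0"
  shows "AE \<xi> in \<mu>. \<xi> \<noteq> z" "integrable \<mu> (\<lambda>\<xi>. norm (z - \<xi>) powr -1)" "integrable \<mu> (\<lambda>\<xi>. reg_kernel 0 (z - \<xi>))"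
proof -
  show "AE \<xi> in \<mu>. \<xi> \<noteq> z" using supp_mu by eventually_elim (use assms in auto)
  have *: "integrable \<mu> f" if f: "f \<in> borel_measurable borel" "\<And>\<xi>. norm (f \<xi>) \<le> norm (z - \<xi>) powr -1" for f :: "complex \<Rightarrow> 'b::{banach, second_countable_topology}"
  proof (rule integrable_bounded_on_support[OF f(1)])
    fix \<xi> :: complex assume "norm \<xi> \<le> R0"
    then have "norm z - R0 \<le> norm (z - \<xi>)" by (rule dist_support)
    then have "norm (z - \<xi>) powr -1 \<le> 1 / (norm z - R0)" using assms by (simp add: powr_minus_divide frac_le)
    then show "norm (f \<xi>) \<le> 1 / (norm z - R0)" using f(2)[of \<xi>] by linarith
  qed
  show "integrable \<mu> (\<lambda>\<xi>. norm (z - \<xi>) powr -1)" by (rule *) auto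
  show "integrable \<mu> (\<lambda>\<xi>. reg_kernel 0 (z - \<xi>))" by (rule *) (use norm_reg_kernel_le[of 0] in auto)
qed

text \<open>Seen from outside the disc, every kernel pushes outwards: z . (z - \<xi>) \<ge> |z| (|z|
  - R0) > 0. This fixes the sign of the square root near infinity.\<close>

lemma reg_grad_inner_pos:
  assumes "norm z > R0"
  shows "z \<bullet> reg_grad 0 \<mu> z > 0"
proof -
  define c where "c = norm z * (norm z - R0) / (norm z + R0)\<^sup>2"
  have nz: "norm z > 0" using assms R0_nonneg by linarith
  have c: "c > 0" using assms nz R0_nonneg by (auto simp: c_def intro!: divide_pos_pos mult_pos_pos zero_less_power)
  have "z \<bullet> reg_grad 0 \<mu> z = (\<integral>\<xi>. z \<bullet> reg_kernel 0 (z - \<xi>) \<partial>\<mu>)"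
    unfolding reg_grad_def using AE_outside(3)[OF assms] by simp
  also have "\<dots> \<ge> (\<integral>\<xi>. c \<partial>\<mu>)"
  proof (rule integral_mono_AE)
    show "AE \<xi> in \<mu>. c \<le> z \<bullet> reg_kernel 0 (z - \<xi>)"
      using supp_mu
    proof eventually_elim
      fix \<xi> :: complex assume \<xi>: "norm \<xi> \<le> R0"
      have "0 < norm (z - \<xi>)" using dist_support[OF \<xi>, of z] assms by linarith
      moreover have "norm (z - \<xi>) \<le> norm z + R0" using norm_triangle_ineq4[of z \<xi>] \<xi> by linarith
      ultimately have n: "0 < (norm (z - \<xi>))\<^sup>2" "(norm (z - \<xi>))\<^sup>2 \<le> (norm z + R0)\<^sup>2" by (auto intro: power_mono)
      have "z \<bullet> \<xi> \<le> norm z * norm \<xi>" by (rule norm_cauchy_schwarz)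
      also have "\<dots> \<le> norm z * R0" using \<xi> by (intro mult_left_mono) auto
      finally have "norm z * (norm z - R0) \<le> z \<bullet> (z - \<xi>)"
        by (simp add: inner_diff_right power2_norm_eq_inner[symmetric] power2_eq_square algebra_simps)
      then have "c \<le> (z \<bullet> (z - \<xi>)) / (norm (z - \<xi>))\<^sup>2"
        unfolding c_def using n assms nz by (intro frac_le) (auto elim!: order_trans[rotated])
      then show "c \<le> z \<bullet> reg_kernel 0 (z - \<xi>)" by (simp add: reg_kernel_def divide_inverse mult.commute)
    qed
  qed (use AE_outside(3)[OF assms] in auto)
  finally show ?thesis using c by simp
qed

lemma continuous_reg_grad_0:
  "continuous_on {z. norm z > R0} (reg_grad 0 \<mu>)"
proof (rule continuous_on_subset[of "{z. norm z > R0}"], unfold continuous_on_eq_continuous_at[OF open_Collect_less[OF continuous_on_const continuous_on_norm_id]], intro ballI)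
  fix z :: complex assume "z \<in> {z. R0 < norm z}"
  then have z: "norm z > R0" by simp
  define \<delta> where "\<delta> = (norm z - R0) / 2"
  have \<delta>: "\<delta> > 0" using z by (simp add: \<delta>_def)
  have ev: "eventually (\<lambda>y. norm y > R0 + \<delta>) (at z)"
    using z by (intro order_tendstoD[OF tendsto_norm[OF tendsto_ident_at]]) (simp add: \<delta>_def field_simps)
  show "isCont (reg_grad 0 \<mu>) z"
    unfolding isCont_def
  proof (rule LIM_zero_cancel, rule tendsto_0_le[where K = 1])
    show "((\<lambda>y. norm (y - z) / \<delta>\<^sup>2) \<longlongrightarrow> 0) (at z)"
    proof -
      have "((\<lambda>y. norm (y - z) / \<delta>\<^sup>2) \<longlongrightarrow> norm (z - z) / \<delta>\<^sup>2) (at z)"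
        by (intro tendsto_intros) (use \<delta> in auto)
      then show ?thesis by simp
    qed
    show "eventually (\<lambda>y. norm (reg_grad 0 \<mu> y - reg_grad 0 \<mu> z) \<le> norm (norm (y - z) / \<delta>\<^sup>2) * 1) (at z)"
      using ev
    proof eventually_elim
      fix y :: complex assume y: "R0 + \<delta> < norm y"
      have "reg_grad 0 \<mu> y - reg_grad 0 \<mu> z = (\<integral>\<xi>. reg_kernel 0 (y - \<xi>) - reg_kernel 0 (z - \<xi>) \<partial>\<mu>)"
        unfolding reg_grad_def using AE_outside(3)[of y] AE_outside(3)[OF z] y \<delta> by simp
      also have "norm \<dots> \<le> norm (y - z) / \<delta>\<^sup>2"
      proof (rule integral_norm_bound_on_support)
        fix \<xi> :: complex assume \<xi>: "norm \<xi> \<le> R0"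
        have ge: "norm (y - \<xi>) \<ge> \<delta>" "norm (z - \<xi>) \<ge> \<delta>"
        proof -
          have "norm z - R0 = 2 * \<delta>" by (simp add: \<delta>_def)
          then show "norm (y - \<xi>) \<ge> \<delta>" "norm (z - \<xi>) \<ge> \<delta>"
            using dist_support[OF \<xi>, of y] dist_support[OF \<xi>, of z] y \<delta> by linarith+
        qed
        then have "norm (reg_kernel 0 (y - \<xi>) - reg_kernel 0 (z - \<xi>)) = norm (y - z) / (norm (y - \<xi>) * norm (z - \<xi>))"
          using \<delta> by (subst reg_kernel_0_diff) auto
        also have "\<dots> \<le> norm (y - z) / \<delta>\<^sup>2"
          unfolding power2_eq_square using ge \<delta> by (intro divide_left_mono mult_mono mult_pos_pos) auto
        finally show "norm (reg_kernel 0 (y - \<xi>) - reg_kernel 0 (z - \<xi>)) \<le> norm (y - z) / \<delta>\<^sup>2" .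
      qed measurable
      finally show "norm (reg_grad 0 \<mu> y - reg_grad 0 \<mu> z) \<le> norm (norm (y - z) / \<delta>\<^sup>2) * 1" by simp
    qed
  qed
qed auto

lemma reg_grad_diff_outside:
  assumes "norm z > R0" "e > 0"
  shows "norm (reg_grad e \<mu> z - reg_grad 0 \<mu> z) \<le> e powr (1/4) * (norm z - R0) powr - (5/4)"
proof -
  have "reg_grad e \<mu> z - reg_grad 0 \<mu> z = (\<integral>\<xi>. reg_kernel e (z - \<xi>) - reg_kernel 0 (z - \<xi>) \<partial>\<mu>)"
    unfolding reg_grad_def using AE_outside(3)[OF assms(1)] integrable_reg_kernel[OF assms(2)] by simp
  also have "norm \<dots> \<le> e powr (1/4) * (norm z - R0) powr - (5/4)"
  proof (rule integral_norm_bound_on_support)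
    fix \<xi> :: complex assume \<xi>: "norm \<xi> \<le> R0"
    have "norm (reg_kernel e (z - \<xi>) - reg_kernel 0 (z - \<xi>)) \<le> e powr (1/4) * norm (z - \<xi>) powr - (5/4)"
      by (rule reg_kernel_diff_le[OF assms(2)])
    also have "\<dots> \<le> e powr (1/4) * (norm z - R0) powr - (5/4)"
      using dist_support[OF \<xi>, of z] assms by (intro mult_left_mono powr_mono2') auto
    finally show "norm (reg_kernel e (z - \<xi>) - reg_kernel 0 (z - \<xi>)) \<le> e powr (1/4) * (norm z - R0) powr - (5/4)" .
  qed measurable
  finally show ?thesis .
qed

lemma reg_pot_0_bounds:
  assumes "norm z > R0"
  shows "ln (norm z - R0) \<le> reg_pot 0 \<mu> z" "reg_pot 0 \<mu> z \<le> ln (norm z + R0)"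
proof -
  have b: "ln (norm z - R0) \<le> ln ((norm (z - \<xi>))\<^sup>2 + 0\<^sup>2) / 2" "ln ((norm (z - \<xi>))\<^sup>2 + 0\<^sup>2) / 2 \<le> ln (norm z + R0)"
    if \<xi>: "norm \<xi> \<le> R0" for \<xi>
  proof -
    have n: "norm z - R0 \<le> norm (z - \<xi>)" "norm (z - \<xi>) \<le> norm z + R0"
      using dist_support[OF \<xi>, of z] norm_triangle_ineq4[of z \<xi>] \<xi> by auto
    have "ln ((norm (z - \<xi>))\<^sup>2 + 0\<^sup>2) / 2 = ln (norm (z - \<xi>))" using n assms by (simp add: ln_realpow)
    then show "ln (norm z - R0) \<le> ln ((norm (z - \<xi>))\<^sup>2 + 0\<^sup>2) / 2" "ln ((norm (z - \<xi>))\<^sup>2 + 0\<^sup>2) / 2 \<le> ln (norm z + R0)"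
      using n assms R0_nonneg by (auto simp del: ln_le_cancel_iff intro!: ln_mono)
  qed
  have i: "integrable \<mu> (\<lambda>\<xi>. ln ((norm (z - \<xi>))\<^sup>2 + 0\<^sup>2) / 2)"
  proof (rule integrable_bounded_on_support)
    fix \<xi> :: complex assume "norm \<xi> \<le> R0"
    from b[OF this] show "norm (ln ((norm (z - \<xi>))\<^sup>2 + 0\<^sup>2) / 2) \<le> \<bar>ln (norm z - R0)\<bar> + \<bar>ln (norm z + R0)\<bar>"
      unfolding real_norm_def by linarith
  qed measurable
  have "(\<integral>\<xi>. ln (norm z - R0) \<partial>\<mu>) \<le> reg_pot 0 \<mu> z" unfolding reg_pot_def
    by (rule integral_mono_AE[OF _ i]) (use supp_mu b in \<open>auto elim!: eventually_mono\<close>)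
  then show "ln (norm z - R0) \<le> reg_pot 0 \<mu> z" by simp
  have "reg_pot 0 \<mu> z \<le> (\<integral>\<xi>. ln (norm z + R0) \<partial>\<mu>)" unfolding reg_pot_def
    by (rule integral_mono_AE[OF i]) (use supp_mu b in \<open>auto elim!: eventually_mono\<close>)
  then show "reg_pot 0 \<mu> z \<le> ln (norm z + R0)" by simp
qed

end

section \<open>Two measures whose Cauchy transforms have equal squares\<close>

lemma nn_integral_tendsto_0_mult:
  assumes "\<And>n. f n \<le> ennreal (c n)" "c \<longlonglongrightarrow> 0"
  shows "f \<longlonglongrightarrow> (0::ennreal)"
proof (rule tendsto_sandwich[OF always_eventually always_eventually tendsto_const])
  show "(\<lambda>n. ennreal (c n)) \<longlonglongrightarrow> 0" using tendsto_ennrealI[OF assms(2)] by simp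
qed (use assms in auto)

context compact_prob
begin

lemma integrable_norm_reg_grad:
  assumes "0 < r"
  shows "integrable lborel (\<lambda>z. norm (reg_grad 0 \<mu> z) * indicator (cball 0 r) z)"
proof (rule integrableI_bounded)
  have "(\<integral>\<^sup>+z. ennreal (norm (reg_grad 0 \<mu> z) * norm (z - 0) powr - 0) * indicator (cball 0 r) z \<partial>lborel) \<le> ennreal (2 * riesz_const (1 + 0) (r + 2 * R0))"
    by (rule nn_integral_reg_grad_weighted) (use assms R0_nonneg in auto)
  also have "\<dots> < \<infinity>" by simp
  also have "(\<integral>\<^sup>+z. ennreal (norm (reg_grad 0 \<mu> z) * norm (z - 0) powr - 0) * indicator (cball 0 r) z \<partial>lborel)
     = (\<integral>\<^sup>+z. ennreal (norm (norm (reg_grad 0 \<mu> z) * indicator (cball 0 r) z)) \<partial>lborel)"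
    by (intro nn_integral_cong_AE) (use AE_lborel_singleton[of "0::complex"] in eventually_elim, auto simp: indicator_def)
  finally show "(\<integral>\<^sup>+z. ennreal (norm (norm (reg_grad 0 \<mu> z) * indicator (cball 0 r) z)) \<partial>lborel) < \<infinity>" .
qed measurable

end

text \<open>The rational function p/q enters through the size of the gradients: it locates their
  singularities and tells their order.\<close>

locale equal_square = m1: compact_prob \<mu>1 R0 + m2: compact_prob \<mu>2 R0 for \<mu>1 \<mu>2 R0 +
  fixes p q :: "complex poly"
  assumes nonzero: "p \<noteq> 0" "q \<noteq> 0"
    and square_eq: "AE z in lborel. (reg_grad 0 \<mu>1 z)\<^sup>2 = (reg_grad 0 \<mu>2 z)\<^sup>2"
    and square_norm: "AE z in lborel. (norm (reg_grad 0 \<mu>1 z))\<^sup>2 = norm (poly p z / poly q z)"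
begin

lemma norm_eq: "AE z in lborel. norm (reg_grad 0 \<mu>1 z) = norm (reg_grad 0 \<mu>2 z)"
  using square_eq
proof eventually_elim
  fix z assume "(reg_grad 0 \<mu>1 z)\<^sup>2 = (reg_grad 0 \<mu>2 z)\<^sup>2"
  then have "(norm (reg_grad 0 \<mu>1 z))\<^sup>2 = (norm (reg_grad 0 \<mu>2 z))\<^sup>2" by (metis norm_power)
  then show "norm (reg_grad 0 \<mu>1 z) = norm (reg_grad 0 \<mu>2 z)" by simp
qed

lemma square_norm2: "AE z in lborel. (norm (reg_grad 0 \<mu>2 z))\<^sup>2 = norm (poly p z / poly q z)"
  using square_norm norm_eq by eventually_elim simp

text \<open>Equal squares leave only a sign, and the sign -1 contradicts the positive radial
  component of both gradients. The set of disagreement is open by continuity and null by hypothesis,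
  hence empty.\<close>

lemma grad_eq_outside:
  assumes "norm z > R0"
  shows "reg_grad 0 \<mu>1 z = reg_grad 0 \<mu>2 z"
proof -
  define S where "S = {z. norm z > R0} \<inter> (\<lambda>z. reg_grad 0 \<mu>1 z - reg_grad 0 \<mu>2 z) -` (- {0})"
  have o: "open {z::complex. norm z > R0}" by (intro open_Collect_less continuous_intros)
  have "open S"
    unfolding S_def
    by (intro continuous_open_preimage continuous_on_diff m1.continuous_reg_grad_0 m2.continuous_reg_grad_0 o) auto
  moreover have "AE z in lborel. z \<notin> S"
    using square_eq
  proof eventually_elim
    fix z assume sq: "(reg_grad 0 \<mu>1 z)\<^sup>2 = (reg_grad 0 \<mu>2 z)\<^sup>2"
    show "z \<notin> S"
    proof
      assume "z \<in> S"
      then have z: "norm z > R0" "reg_grad 0 \<mu>1 z \<noteq> reg_grad 0 \<mu>2 z" by (auto simp: S_def)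
      then have "reg_grad 0 \<mu>1 z = - reg_grad 0 \<mu>2 z" using sq by (simp add: power2_eq_iff)
      then show False using m1.reg_grad_inner_pos[OF z(1)] m2.reg_grad_inner_pos[OF z(1)] by simp
    qed
  qed
  ultimately have "S = {}" by (rule AE_imp_open_empty)
  then show ?thesis using assms by (auto simp: S_def)
qed

text \<open>Equal gradients make the difference of the potentials constant along the ray through
  \<open>z\<close>, and both potentials are ln|z| + o(1) at infinity. The mean value inequality is
  applied to the regularised potentials, whose gradients differ by an amount tending to zero on the
  ray.\<close>

lemma pot_eq_outside:
  assumes z: "norm z > R0"
  shows "reg_pot 0 \<mu>1 z = reg_pot 0 \<mu>2 z"
proof -
  define w where "w e y = reg_pot e \<mu>2 y - reg_pot e \<mu>1 y" for e y
  have w_lim: "(\<lambda>n. w (eps n) y) \<longlonglongrightarrow> w 0 y" if "norm y > R0" for y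
    unfolding w_def using that by (intro tendsto_intros m1.reg_pot_tendsto m2.reg_pot_tendsto m1.AE_outside m2.AE_outside)
  have nz: "norm z > 0" using z m1.R0_nonneg by linarith
  have big: "norm (s *\<^sub>R z) > R0" if "s \<ge> 1" for s :: real
  proof -
    have "1 * norm z \<le> s * norm z" using that by (intro mult_right_mono) auto
    moreover have "norm (s *\<^sub>R z) = s * norm z" using that by simp
    ultimately show ?thesis using z by linarith
  qed
  have const: "w 0 (s *\<^sub>R z) = w 0 z" if s: "s \<ge> 1" for s
  proof -
    define \<delta> where "\<delta> = norm z - R0"
    have \<delta>: "\<delta> > 0" using z by (simp add: \<delta>_def)
    \<comment> \<open>Each of the two gradients is within half of \<open>B n\<close> of its
      unregularised version, and those versions coincide on the ray, which stays at distance at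
      least \<open>\<delta>\<close> from the disc.\<close>
    define B where "B n = 2 * (eps n powr (1/4) * \<delta> powr - (5/4))" for n
    have "norm (w (eps n) (s *\<^sub>R z) - w (eps n) z) \<le> B n * norm (s *\<^sub>R z - z)" for n
    proof (rule differentiable_bound[of "closed_segment z (s *\<^sub>R z)"])
      fix y assume "y \<in> closed_segment z (s *\<^sub>R z)"
      then obtain u where u: "0 \<le> u" "u \<le> 1" "y = (1 - u) *\<^sub>R z + u *\<^sub>R (s *\<^sub>R z)" by (auto simp: in_segment)
      define v where "v = 1 - u + u * s"
      have v: "v \<ge> 1" using u s mult_left_mono[of 1 s u] by (simp add: v_def)
      have y: "y = v *\<^sub>R z" using u by (simp add: v_def algebra_simps)
      have ny: "norm y - R0 \<ge> \<delta>" using v nz by (simp add: y \<delta>_def)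
      show "(w (eps n) has_derivative (\<lambda>h. (reg_grad (eps n) \<mu>2 y - reg_grad (eps n) \<mu>1 y) \<bullet> h)) (at y within closed_segment z (s *\<^sub>R z))"
        unfolding w_def[abs_def] inner_diff_left
        by (intro has_derivative_diff has_derivative_at_withinI[OF m1.reg_pot_has_derivative] has_derivative_at_withinI[OF m2.reg_pot_has_derivative] eps_pos)
      have 1: "norm (reg_grad (eps n) \<mu>1 y - reg_grad 0 \<mu>1 y) \<le> eps n powr (1/4) * \<delta> powr - (5/4)"
        using ny \<delta> by (intro order.trans[OF m1.reg_grad_diff_outside[OF _ eps_pos]] mult_left_mono powr_mono2') auto
      have 2: "norm (reg_grad (eps n) \<mu>2 y - reg_grad 0 \<mu>2 y) \<le> eps n powr (1/4) * \<delta> powr - (5/4)"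
        using ny \<delta> by (intro order.trans[OF m2.reg_grad_diff_outside[OF _ eps_pos]] mult_left_mono powr_mono2') auto
      have "reg_grad (eps n) \<mu>2 y - reg_grad (eps n) \<mu>1 y = (reg_grad (eps n) \<mu>2 y - reg_grad 0 \<mu>2 y) - (reg_grad (eps n) \<mu>1 y - reg_grad 0 \<mu>1 y)"
        using grad_eq_outside[of y] ny \<delta> by simp
      then have "norm (reg_grad (eps n) \<mu>2 y - reg_grad (eps n) \<mu>1 y) = norm ((reg_grad (eps n) \<mu>2 y - reg_grad 0 \<mu>2 y) - (reg_grad (eps n) \<mu>1 y - reg_grad 0 \<mu>1 y))"
        by (rule arg_cong)
      then have nb: "norm (reg_grad (eps n) \<mu>2 y - reg_grad (eps n) \<mu>1 y) \<le> B n"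
        using 1 2 norm_triangle_ineq4[of "reg_grad (eps n) \<mu>2 y - reg_grad 0 \<mu>2 y" "reg_grad (eps n) \<mu>1 y - reg_grad 0 \<mu>1 y"]
        unfolding B_def by linarith
      show "onorm (\<lambda>h. (reg_grad (eps n) \<mu>2 y - reg_grad (eps n) \<mu>1 y) \<bullet> h) \<le> B n"
      proof (rule onorm_bound)
        fix h
        have "norm ((reg_grad (eps n) \<mu>2 y - reg_grad (eps n) \<mu>1 y) \<bullet> h) \<le> norm (reg_grad (eps n) \<mu>2 y - reg_grad (eps n) \<mu>1 y) * norm h"
          unfolding real_norm_def by (rule Cauchy_Schwarz_ineq2)
        also have "\<dots> \<le> B n * norm h" using nb by (rule mult_right_mono) simp
        finally show "norm ((reg_grad (eps n) \<mu>2 y - reg_grad (eps n) \<mu>1 y) \<bullet> h) \<le> B n * norm h" .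
      qed (use nb norm_ge_zero order.trans in blast)
    qed auto
    moreover have "(\<lambda>n. B n * norm (s *\<^sub>R z - z)) \<longlonglongrightarrow> 0"
    proof -
      have "(\<lambda>n. eps n powr (1/4)) \<longlonglongrightarrow> 0"
        by (rule tendsto_zero_powrI[OF LIMSEQ_inverse_real_of_nat tendsto_const]) auto
      then have "(\<lambda>n. 2 * (eps n powr (1/4) * \<delta> powr - (5/4)) * norm (s *\<^sub>R z - z)) \<longlonglongrightarrow> 2 * (0 * \<delta> powr - (5/4)) * norm (s *\<^sub>R z - z)"
        by (intro tendsto_intros)
      then show ?thesis by (simp add: B_def)
    qed
    ultimately have "(\<lambda>n. w (eps n) (s *\<^sub>R z) - w (eps n) z) \<longlonglongrightarrow> 0"
      by (rule Lim_null_comparison[OF always_eventually[OF allI]])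
    moreover have "norm (s *\<^sub>R z) > R0" by (rule big[OF s])
    then have "(\<lambda>n. w (eps n) (s *\<^sub>R z) - w (eps n) z) \<longlonglongrightarrow> w 0 (s *\<^sub>R z) - w 0 z"
      by (intro tendsto_diff w_lim z)
    ultimately show ?thesis using LIMSEQ_unique by fastforce
  qed
  \<comment> \<open>Both potentials at s z lie between ln(s|z| - R0) and ln(s|z| + R0), a gap that
    closes as s grows.\<close>
  have lim: "((\<lambda>s. ln (s * norm z + R0) - ln (s * norm z - R0)) \<longlongrightarrow> 0) at_top"
    using nz by real_asymp
  have "eventually (\<lambda>s. norm (w 0 z) \<le> ln (s * norm z + R0) - ln (s * norm z - R0)) at_top"
    using eventually_ge_at_top[of 1]
  proof eventually_elim
    fix s :: real assume s: "1 \<le> s"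
    have n: "norm (s *\<^sub>R z) = s * norm z" using s by simp
    have "norm (s *\<^sub>R z) > R0" by (rule big[OF s])
    from m1.reg_pot_0_bounds[OF this] m2.reg_pot_0_bounds[OF this]
    have "norm (w 0 (s *\<^sub>R z)) \<le> ln (s * norm z + R0) - ln (s * norm z - R0)"
      unfolding n w_def real_norm_def by linarith
    then show "norm (w 0 z) \<le> ln (s * norm z + R0) - ln (s * norm z - R0)" using const[OF s] by simp
  qed
  then have "norm (w 0 z) \<le> 0"
    by (intro tendsto_lowerbound[OF lim]) auto
  then show ?thesis by (simp add: w_def)
qed

text \<open>A pole of order at most one gives gradients of order 1/2 after taking the root. A higher
  pole forces an atom of both measures, and then both potentials fall below any prescribed level
  near it. These are exactly the two situations that a truncated integral can handle.\<close>

lemma pole_dichotomy: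
  obtains (bounded) K d where "0 < K" "0 < d"
      "AE z in lborel. norm (z - a) < d \<longrightarrow> norm (reg_grad 0 \<mu>1 z) \<le> K * norm (z - a) powr - (1/2)"
      "AE z in lborel. norm (z - a) < d \<longrightarrow> norm (reg_grad 0 \<mu>2 z) \<le> K * norm (z - a) powr - (1/2)"
  | (atom) d where "0 < d"
      "\<And>e z. 0 < e \<Longrightarrow> e \<le> d \<Longrightarrow> norm (z - a) < d \<Longrightarrow> reg_pot e \<mu>1 z < - M \<and> reg_pot e \<mu>2 z < - M"
using nonzero
proof (cases rule: rational_function_local[where a = a])
  case (simple K d)
  have *: "AE z in lborel. norm (z - a) < d \<longrightarrow> norm (g z) \<le> sqrt K * norm (z - a) powr - (1/2)"
    if "AE z in lborel. (norm (g z))\<^sup>2 = norm (poly p z / poly q z)" for g :: "complex \<Rightarrow> complex"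
    using that AE_lborel_singleton[of a]
  proof (eventually_elim, intro impI)
    fix z assume z: "(norm (g z))\<^sup>2 = norm (poly p z / poly q z)" "z \<noteq> a" "norm (z - a) < d"
    have "norm (g z) = sqrt ((norm (g z))\<^sup>2)" by simp
    also have "\<dots> \<le> sqrt (K / norm (z - a))" unfolding z(1) using simple(3)[OF z(2,3)] by simp
    also have "\<dots> = sqrt K * norm (z - a) powr - (1/2)"
      using z(2) by (simp add: real_sqrt_divide powr_minus_divide powr_half_sqrt)
    finally show "norm (g z) \<le> sqrt K * norm (z - a) powr - (1/2)" .
  qed
  show ?thesis by (rule bounded[OF _ simple(2) *[OF square_norm] *[OF square_norm2]]) (use simple in auto)
next
  case (high c d)
  have *: "AE z in lborel. norm (z - a) < d \<longrightarrow> sqrt c / norm (z - a) \<le> norm (g z)"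
    if "AE z in lborel. (norm (g z))\<^sup>2 = norm (poly p z / poly q z)" for g :: "complex \<Rightarrow> complex"
    using that AE_lborel_singleton[of a]
  proof (eventually_elim, intro impI)
    fix z assume z: "(norm (g z))\<^sup>2 = norm (poly p z / poly q z)" "z \<noteq> a" "norm (z - a) < d"
    have "sqrt c / norm (z - a) = sqrt (c / (norm (z - a))\<^sup>2)" by (simp add: real_sqrt_divide)
    also have "\<dots> \<le> sqrt ((norm (g z))\<^sup>2)" unfolding z(1) using high(3)[OF z(2,3)] by simp
    finally show "sqrt c / norm (z - a) \<le> norm (g z)" by simp
  qed
  have c: "sqrt c > 0" using high by simp
  have "measure \<mu>1 {a} > 0" by (rule m1.atom_of_pole[OF c high(2) *[OF square_norm]])
  then obtain d1 where d1: "0 < d1" "\<And>e z. 0 < e \<Longrightarrow> e \<le> d1 \<Longrightarrow> norm (z - a) \<le> d1 \<Longrightarrow> reg_pot e \<mu>1 z < - M"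
    using m1.reg_pot_near_atom by blast
  have "measure \<mu>2 {a} > 0" by (rule m2.atom_of_pole[OF c high(2) *[OF square_norm2]])
  then obtain d2 where d2: "0 < d2" "\<And>e z. 0 < e \<Longrightarrow> e \<le> d2 \<Longrightarrow> norm (z - a) \<le> d2 \<Longrightarrow> reg_pot e \<mu>2 z < - M"
    using m2.reg_pot_near_atom by blast
  show ?thesis by (rule atom[of "min d1 d2"]) (use d1 d2 in auto)
qed

text \<open>The difference splits as b_n (g_n - g) . h + (b_n - b_0) g . h. Near a singularity of
  order 1/2 the weighted L^1 estimate controls the first part and dominated convergence the second.
  Near an atom the coefficient itself vanishes, by the condition relating \<open>b n\<close> to the
  truncation level.\<close>

lemma nn_integral_tendsto_product:
  fixes b :: "nat \<Rightarrow> complex \<Rightarrow> real" and b0 :: "complex \<Rightarrow> real"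
  assumes i: "compact_prob \<mu> R0" and \<mu>: "\<mu> = \<mu>1 \<or> \<mu> = \<mu>2" and \<nu>: "\<nu> = \<mu>1 \<or> \<nu> = \<mu>2"
    and bm: "\<And>n. b n \<in> borel_measurable borel" "b0 \<in> borel_measurable borel"
    and bb: "\<And>n z. \<bar>b n z\<bar> \<le> B"
    and b0: "\<And>n z. norm z > r \<Longrightarrow> b n z = 0" "\<And>z. norm z > r \<Longrightarrow> b0 z = 0"
    and bl: "AE z in lborel. (\<lambda>n. b n z) \<longlonglongrightarrow> b0 z"
    and bv: "\<And>n z. reg_pot (eps n) \<mu>1 z < - M \<Longrightarrow> reg_pot (eps n) \<mu>2 z < - M \<Longrightarrow> b n z = 0"
  shows "integrable lborel (\<lambda>z. b0 z * (reg_grad 0 \<mu> z \<bullet> reg_grad 0 \<nu> z))"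
    and "(\<lambda>n. \<integral>z. b n z * (reg_grad (eps n) \<mu> z \<bullet> reg_grad 0 \<nu> z) \<partial>lborel)
            \<longlonglongrightarrow> (\<integral>z. b0 z * (reg_grad 0 \<mu> z \<bullet> reg_grad 0 \<nu> z) \<partial>lborel)"
    and "\<And>n. integrable lborel (\<lambda>z. b n z * (reg_grad (eps n) \<mu> z \<bullet> reg_grad 0 \<nu> z))"
proof -
  interpret m: compact_prob \<mu> R0 by (rule i)
  interpret n: compact_prob \<nu> R0 using \<nu> m1.compact_prob_axioms m2.compact_prob_axioms by auto
  note [measurable] = bm
  have B: "0 \<le> B" using bb[of 0 0] by linarith
  have b0B: "AE z in lborel. \<bar>b0 z\<bar> \<le> B"
    using bl
  proof eventually_elim
    fix z assume "(\<lambda>n. b n z) \<longlonglongrightarrow> b0 z"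
    then have "(\<lambda>n. \<bar>b n z\<bar>) \<longlonglongrightarrow> \<bar>b0 z\<bar>" by (rule tendsto_rabs)
    then show "\<bar>b0 z\<bar> \<le> B" by (rule LIMSEQ_le_const2) (use bb in auto)
  qed
  let ?g = "\<lambda>z. reg_grad 0 \<mu> z" let ?h = "\<lambda>z. reg_grad 0 \<nu> z"
  define D where "D n z = ennreal (norm (b n z * (reg_grad (eps n) \<mu> z \<bullet> ?h z) - b0 z * (?g z \<bullet> ?h z)))" for n z
  have Dm: "D n \<in> borel_measurable borel" for n unfolding D_def by measurable
  \<comment> \<open>Convergence and integrability are shown around each point separately;
    compactness of the disc of radius \<open>r\<close> assembles them afterwards.\<close>
  have loc: "\<exists>d>0. (\<lambda>n. \<integral>\<^sup>+z. D n z * indicator (ball a d) z \<partial>lborel) \<longlonglongrightarrow> 0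
       \<and> (\<integral>\<^sup>+z. ennreal (norm (b0 z * (?g z \<bullet> ?h z))) * indicator (ball a d) z \<partial>lborel) < \<infinity>" for a
  proof (cases rule: pole_dichotomy[where a = a and M = M])
    case (bounded K d)
    have g: "AE z in lborel. norm (z - a) < d \<longrightarrow> norm (?g z) \<le> K * norm (z - a) powr - (1/2)"
      using \<mu> bounded by auto
    have h: "AE z in lborel. norm (z - a) < d \<longrightarrow> norm (?h z) \<le> K * norm (z - a) powr - (1/2)"
      using \<nu> bounded by auto
    have gh: "AE z in lborel. norm (z - a) < d \<longrightarrow> \<bar>?g z \<bullet> ?h z\<bar> \<le> K\<^sup>2 * norm (z - a) powr - 1"
      using g h
    proof (eventually_elim, intro impI)
      fix z assume z: "norm (z - a) < d \<longrightarrow> norm (?g z) \<le> K * norm (z - a) powr - (1/2)"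
        "norm (z - a) < d \<longrightarrow> norm (?h z) \<le> K * norm (z - a) powr - (1/2)" "norm (z - a) < d"
      have "\<bar>?g z \<bullet> ?h z\<bar> \<le> norm (?g z) * norm (?h z)" by (rule Cauchy_Schwarz_ineq2)
      also have "\<dots> \<le> (K * norm (z - a) powr - (1/2)) * (K * norm (z - a) powr - (1/2))"
        using z bounded by (intro mult_mono) auto
      also have "\<dots> = K\<^sup>2 * (norm (z - a) powr - (1/2) * norm (z - a) powr - (1/2))"
        by (simp add: power2_eq_square mult_ac)
      also have "norm (z - a) powr - (1/2) * norm (z - a) powr - (1/2) = norm (z - a) powr - 1"
        by (subst powr_add[symmetric]) simp
      finally show "\<bar>?g z \<bullet> ?h z\<bar> \<le> K\<^sup>2 * norm (z - a) powr - 1" .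
    qed
    define w where "w z = 2 * B * K\<^sup>2 * (norm (z - a) powr - 1 * indicator (cball a d) z)" for z
    have [measurable]: "w \<in> borel_measurable borel" unfolding w_def[abs_def] by measurable
    have wi: "integrable lborel w"
      unfolding w_def[abs_def] using bounded by (intro integrable_mult_right integrable_norm_powr_cball) auto
    have wfin: "(\<integral>\<^sup>+z. ennreal (w z) \<partial>lborel) < \<infinity>"
      using wi B by (subst nn_integral_eq_integral) (auto simp: w_def)
    let ?I = "\<lambda>z. indicator (ball a d) z :: real"
    \<comment> \<open>Here both gradients are unregularised; their product is of order 1 at
      \<open>a\<close>, hence integrable, and only the coefficients move.\<close>
    have part2: "(\<lambda>n. \<integral>\<^sup>+z. ennreal (norm ((b n z - b0 z) * (?g z \<bullet> ?h z) * ?I z)) \<partial>lborel) \<longlonglongrightarrow> (\<integral>\<^sup>+(z::complex). 0 \<partial>lborel)"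
    proof (rule nn_integral_dominated_convergence[where w = "\<lambda>z. ennreal (w z)"])
      show "AE z in lborel. ennreal (norm ((b n z - b0 z) * (?g z \<bullet> ?h z) * ?I z)) \<le> ennreal (w z)" for n
        using gh b0B
      proof eventually_elim
        fix z assume z: "norm (z - a) < d \<longrightarrow> \<bar>?g z \<bullet> ?h z\<bar> \<le> K\<^sup>2 * norm (z - a) powr - 1" "\<bar>b0 z\<bar> \<le> B"
        show "ennreal (norm ((b n z - b0 z) * (?g z \<bullet> ?h z) * ?I z)) \<le> ennreal (w z)"
        proof (cases "norm (z - a) < d")
          case True
          have "\<bar>b n z - b0 z\<bar> \<le> 2 * B" using z(2) bb[of n z] by linarith
          then have "\<bar>b n z - b0 z\<bar> * \<bar>?g z \<bullet> ?h z\<bar> \<le> (2 * B) * (K\<^sup>2 * norm (z - a) powr - 1)"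
            using z True B by (intro mult_mono) auto
          moreover have "?I z = 1" "indicator (cball a d) z = (1::real)" using True by (auto simp: dist_norm norm_minus_commute)
          ultimately show ?thesis unfolding w_def by (intro ennreal_leI) (simp only: real_norm_def abs_mult mult.assoc mult_1_right abs_one)
        qed (simp add: dist_norm norm_minus_commute)
      qed
      show "AE z in lborel. (\<lambda>n. ennreal (norm ((b n z - b0 z) * (?g z \<bullet> ?h z) * ?I z))) \<longlonglongrightarrow> 0"
        using bl
      proof eventually_elim
        fix z assume "(\<lambda>n. b n z) \<longlonglongrightarrow> b0 z"
        then have "(\<lambda>n. norm ((b n z - b0 z) * (?g z \<bullet> ?h z) * ?I z)) \<longlonglongrightarrow> norm ((b0 z - b0 z) * (?g z \<bullet> ?h z) * ?I z)"
          by (intro tendsto_intros)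
        then show "(\<lambda>n. ennreal (norm ((b n z - b0 z) * (?g z \<bullet> ?h z) * ?I z))) \<longlonglongrightarrow> 0"
          using tendsto_ennrealI by fastforce
      qed
      show "(\<integral>\<^sup>+z. ennreal (w z) \<partial>lborel) < \<infinity>" by (rule wfin)
    qed measurable
    define s where "s = max R0 (norm a)"
    define C where "C = B * K * (2 * riesz_const (7/4) (d + 2 * s))"
    \<comment> \<open>The second gradient is replaced by its majorant K |z - a|^(-1/2), which is the
      weight of the regularisation estimate.\<close>
    have part1: "(\<integral>\<^sup>+z. ennreal (norm (b n z * ((reg_grad (eps n) \<mu> z - ?g z) \<bullet> ?h z) * ?I z)) \<partial>lborel) \<le> ennreal (eps n powr (1/4) * C)" for n
    proof -
      have "(\<integral>\<^sup>+z. ennreal (norm (b n z * ((reg_grad (eps n) \<mu> z - ?g z) \<bullet> ?h z) * ?I z)) \<partial>lborel)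
        \<le> (\<integral>\<^sup>+z. ennreal (B * K) * (ennreal (norm (reg_grad (eps n) \<mu> z - ?g z) * norm (z - a) powr - (1/2)) * indicator (cball a d) z) \<partial>lborel)"
      proof (rule nn_integral_mono_AE)
        show "AE z in lborel. ennreal (norm (b n z * ((reg_grad (eps n) \<mu> z - ?g z) \<bullet> ?h z) * ?I z))
           \<le> ennreal (B * K) * (ennreal (norm (reg_grad (eps n) \<mu> z - ?g z) * norm (z - a) powr - (1/2)) * indicator (cball a d) z)"
          using h
        proof eventually_elim
          fix z assume hz: "norm (z - a) < d \<longrightarrow> norm (?h z) \<le> K * norm (z - a) powr - (1/2)"
          show "ennreal (norm (b n z * ((reg_grad (eps n) \<mu> z - ?g z) \<bullet> ?h z) * ?I z))
           \<le> ennreal (B * K) * (ennreal (norm (reg_grad (eps n) \<mu> z - ?g z) * norm (z - a) powr - (1/2)) * indicator (cball a d) z)"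
          proof (cases "norm (z - a) < d")
            case True
            have "\<bar>(reg_grad (eps n) \<mu> z - ?g z) \<bullet> ?h z\<bar> \<le> norm (reg_grad (eps n) \<mu> z - ?g z) * norm (?h z)"
              by (rule Cauchy_Schwarz_ineq2)
            also have "\<dots> \<le> norm (reg_grad (eps n) \<mu> z - ?g z) * (K * norm (z - a) powr - (1/2))"
              using hz True by (intro mult_left_mono) auto
            finally have "\<bar>b n z\<bar> * \<bar>(reg_grad (eps n) \<mu> z - ?g z) \<bullet> ?h z\<bar> \<le> B * (norm (reg_grad (eps n) \<mu> z - ?g z) * (K * norm (z - a) powr - (1/2)))"
              using bb B by (intro mult_mono) auto
            then have "norm (b n z * ((reg_grad (eps n) \<mu> z - ?g z) \<bullet> ?h z) * ?I z) \<le> (B * K) * (norm (reg_grad (eps n) \<mu> z - ?g z) * norm (z - a) powr - (1/2))"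
              using True by (simp add: abs_mult dist_norm norm_minus_commute mult_ac)
            then have "ennreal (norm (b n z * ((reg_grad (eps n) \<mu> z - ?g z) \<bullet> ?h z) * ?I z)) \<le> ennreal ((B * K) * (norm (reg_grad (eps n) \<mu> z - ?g z) * norm (z - a) powr - (1/2)))"
              by (rule ennreal_leI)
            also have "\<dots> = ennreal (B * K) * ennreal (norm (reg_grad (eps n) \<mu> z - ?g z) * norm (z - a) powr - (1/2))"
              using B bounded by (intro ennreal_mult) auto
            finally show ?thesis using True by (simp add: dist_norm norm_minus_commute)
          qed (simp add: dist_norm norm_minus_commute)
        qed
      qed
      also have "\<dots> = ennreal (B * K) * (\<integral>\<^sup>+z. ennreal (norm (reg_grad (eps n) \<mu> z - ?g z) * norm (z - a) powr - (1/2)) * indicator (cball a d) z \<partial>lborel)"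
        by (rule nn_integral_cmult) measurable
      also have "\<dots> \<le> ennreal (B * K) * ennreal (eps n powr (1/4) * (2 * riesz_const (7/4) (d + 2 * s)))"
        by (intro mult_left_mono m.nn_integral_reg_grad_diff_weighted eps_pos) (use bounded in \<open>auto simp: s_def\<close>)
      also have "\<dots> = ennreal (eps n powr (1/4) * C)"
        using B bounded by (subst ennreal_mult[symmetric]) (auto simp: C_def mult_ac)
      finally show ?thesis .
    qed
    have part1': "(\<lambda>n. \<integral>\<^sup>+z. ennreal (norm (b n z * ((reg_grad (eps n) \<mu> z - ?g z) \<bullet> ?h z) * ?I z)) \<partial>lborel) \<longlonglongrightarrow> 0"
    proof (rule nn_integral_tendsto_0_mult[OF part1])
      have "(\<lambda>n. eps n powr (1/4)) \<longlonglongrightarrow> 0"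
        by (rule tendsto_zero_powrI[OF LIMSEQ_inverse_real_of_nat tendsto_const]) auto
      from tendsto_mult_left_zero[OF this] show "(\<lambda>n. eps n powr (1/4) * C) \<longlonglongrightarrow> 0" .
    qed
    have sumle: "(\<integral>\<^sup>+z. D n z * indicator (ball a d) z \<partial>lborel)
       \<le> (\<integral>\<^sup>+z. ennreal (norm (b n z * ((reg_grad (eps n) \<mu> z - ?g z) \<bullet> ?h z) * ?I z)) \<partial>lborel)
        + (\<integral>\<^sup>+z. ennreal (norm ((b n z - b0 z) * (?g z \<bullet> ?h z) * ?I z)) \<partial>lborel)" for n
    proof -
      have "(\<integral>\<^sup>+z. D n z * indicator (ball a d) z \<partial>lborel)
        \<le> (\<integral>\<^sup>+z. ennreal (norm (b n z * ((reg_grad (eps n) \<mu> z - ?g z) \<bullet> ?h z) * ?I z))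
              + ennreal (norm ((b n z - b0 z) * (?g z \<bullet> ?h z) * ?I z)) \<partial>lborel)"
      proof (intro nn_integral_mono)
        fix z
        have "norm (b n z * (reg_grad (eps n) \<mu> z \<bullet> ?h z) - b0 z * (?g z \<bullet> ?h z))
           \<le> norm (b n z * ((reg_grad (eps n) \<mu> z - ?g z) \<bullet> ?h z)) + norm ((b n z - b0 z) * (?g z \<bullet> ?h z))"
          by (rule order.trans[OF _ norm_triangle_ineq]) (simp add: inner_diff_left algebra_simps)
        then show "D n z * indicator (ball a d) z \<le> ennreal (norm (b n z * ((reg_grad (eps n) \<mu> z - ?g z) \<bullet> ?h z) * ?I z))
              + ennreal (norm ((b n z - b0 z) * (?g z \<bullet> ?h z) * ?I z))"
          unfolding D_def by (cases "z \<in> ball a d") (simp_all flip: ennreal_plus add: ennreal_leI)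
      qed
      also have "\<dots> = (\<integral>\<^sup>+z. ennreal (norm (b n z * ((reg_grad (eps n) \<mu> z - ?g z) \<bullet> ?h z) * ?I z)) \<partial>lborel)
        + (\<integral>\<^sup>+z. ennreal (norm ((b n z - b0 z) * (?g z \<bullet> ?h z) * ?I z)) \<partial>lborel)"
        by (rule nn_integral_add) measurable
      finally show ?thesis .
    qed
    have "(\<lambda>n. (\<integral>\<^sup>+z. ennreal (norm (b n z * ((reg_grad (eps n) \<mu> z - ?g z) \<bullet> ?h z) * ?I z)) \<partial>lborel)
        + (\<integral>\<^sup>+z. ennreal (norm ((b n z - b0 z) * (?g z \<bullet> ?h z) * ?I z)) \<partial>lborel)) \<longlonglongrightarrow> 0 + 0"
      using part2 by (intro tendsto_add part1') simp
    then have lim: "(\<lambda>n. (\<integral>\<^sup>+z. ennreal (norm (b n z * ((reg_grad (eps n) \<mu> z - ?g z) \<bullet> ?h z) * ?I z)) \<partial>lborel)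
        + (\<integral>\<^sup>+z. ennreal (norm ((b n z - b0 z) * (?g z \<bullet> ?h z) * ?I z)) \<partial>lborel)) \<longlonglongrightarrow> 0" by simp
    have "(\<lambda>n. \<integral>\<^sup>+z. D n z * indicator (ball a d) z \<partial>lborel) \<longlonglongrightarrow> 0"
      by (rule tendsto_sandwich[OF always_eventually always_eventually tendsto_const lim]) (use sumle in simp_all)
    moreover have "(\<integral>\<^sup>+z. ennreal (norm (b0 z * (?g z \<bullet> ?h z))) * indicator (ball a d) z \<partial>lborel) < \<infinity>"
    proof (rule le_less_trans[OF _ wfin], rule nn_integral_mono_AE)
      show "AE z in lborel. ennreal (norm (b0 z * (?g z \<bullet> ?h z))) * indicator (ball a d) z \<le> ennreal (w z)"
        using gh b0B
      proof eventually_elim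
        fix z assume z: "norm (z - a) < d \<longrightarrow> \<bar>?g z \<bullet> ?h z\<bar> \<le> K\<^sup>2 * norm (z - a) powr - 1" "\<bar>b0 z\<bar> \<le> B"
        show "ennreal (norm (b0 z * (?g z \<bullet> ?h z))) * indicator (ball a d) z \<le> ennreal (w z)"
        proof (cases "norm (z - a) < d")
          case True
          have "\<bar>b0 z\<bar> * \<bar>?g z \<bullet> ?h z\<bar> \<le> (2 * B) * (K\<^sup>2 * norm (z - a) powr - 1)"
            using z True B by (intro mult_mono) auto
          moreover have "indicator (ball a d) z = (1::ennreal)" "indicator (cball a d) z = (1::real)" using True by (auto simp: dist_norm norm_minus_commute)
          ultimately show ?thesis unfolding w_def by (simp only: real_norm_def abs_mult mult.assoc mult_1_right) (rule ennreal_leI)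
        qed (simp add: dist_norm norm_minus_commute)
      qed
    qed
    ultimately show ?thesis using bounded(2) by blast
  next
    case (atom d)
    have ev: "eventually (\<lambda>n. eps n < d) sequentially"
      using atom(1) by (intro order_tendstoD(2)[OF LIMSEQ_inverse_real_of_nat]) auto
    \<comment> \<open>Both regularised potentials lie below the truncation level once
      \<open>eps n\<close> is smaller than \<open>d\<close>, so nothing is left to estimate on this
      ball.\<close>
    have bz: "b n z = 0" if "eps n < d" "norm (z - a) < d" for n z
      using atom(2)[OF eps_pos _ that(2), of n] that(1) by (intro bv) auto
    have b0z: "AE z in lborel. norm (z - a) < d \<longrightarrow> b0 z = 0"
      using bl
    proof (eventually_elim, intro impI)
      fix z assume z: "(\<lambda>n. b n z) \<longlonglongrightarrow> b0 z" "norm (z - a) < d"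
      have "eventually (\<lambda>n. b n z = 0) sequentially" using ev by eventually_elim (use bz z in auto)
      then have "(\<lambda>n. b n z) \<longlonglongrightarrow> 0" by (rule tendsto_eventually)
      then show "b0 z = 0" using z LIMSEQ_unique by blast
    qed
    have "eventually (\<lambda>n. (\<integral>\<^sup>+z. D n z * indicator (ball a d) z \<partial>lborel) = 0) sequentially"
      using ev
    proof eventually_elim
      fix n assume n: "eps n < d"
      have "(\<integral>\<^sup>+z. D n z * indicator (ball a d) z \<partial>lborel) = (\<integral>\<^sup>+(z::complex). 0 \<partial>lborel)"
        by (rule nn_integral_cong_AE) (use b0z in eventually_elim, use bz n in \<open>auto simp: D_def indicator_def dist_norm norm_minus_commute\<close>)
      then show "(\<integral>\<^sup>+z. D n z * indicator (ball a d) z \<partial>lborel) = 0" by simp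
    qed
    then have "(\<lambda>n. \<integral>\<^sup>+z. D n z * indicator (ball a d) z \<partial>lborel) \<longlonglongrightarrow> 0" by (rule tendsto_eventually)
    moreover have "(\<integral>\<^sup>+z. ennreal (norm (b0 z * (?g z \<bullet> ?h z))) * indicator (ball a d) z \<partial>lborel) = (\<integral>\<^sup>+(z::complex). 0 \<partial>lborel)"
      by (rule nn_integral_cong_AE) (use b0z in eventually_elim, auto simp: indicator_def dist_norm norm_minus_commute)
    ultimately show ?thesis using atom(1) by (intro exI[of _ d]) auto
  qed
  have lim: "(\<lambda>n. \<integral>\<^sup>+z. D n z \<partial>lborel) \<longlonglongrightarrow> 0"
  proof (rule nn_integral_tendsto_0_local[OF Dm])
    show "D n z = 0" if "norm z > r" for n z using b0 that by (simp add: D_def)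
    show "\<exists>d>0. (\<lambda>n. \<integral>\<^sup>+z. D n z * indicator (ball a d) z \<partial>lborel) \<longlonglongrightarrow> 0" for a using loc[of a] by blast
  qed
  obtain d where d: "\<And>a. d a > 0" "\<And>a. (\<integral>\<^sup>+z. ennreal (norm (b0 z * (?g z \<bullet> ?h z))) * indicator (ball a (d a)) z \<partial>lborel) < \<infinity>"
  proof -
    have "\<forall>a. \<exists>d. 0 < d \<and> (\<integral>\<^sup>+z. ennreal (norm (b0 z * (?g z \<bullet> ?h z))) * indicator (ball a d) z \<partial>lborel) < \<infinity>"
      using loc by blast
    from choice[OF this] show ?thesis using that by blast
  qed
  show int0: "integrable lborel (\<lambda>z. b0 z * (?g z \<bullet> ?h z))"
  proof (rule integrableI_bounded)
    have sub: "cball (0::complex) r \<subseteq> (\<Union>a\<in>cball 0 r. ball a (d a))" using d(1) by auto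
    obtain T where T: "T \<subseteq> cball 0 r" "finite T" "cball (0::complex) r \<subseteq> (\<Union>a\<in>T. ball a (d a))"
      by (rule compactE_image[OF compact_cball _ sub], rule open_ball, assumption)
    let ?F = "\<lambda>z. ennreal (norm (b0 z * (?g z \<bullet> ?h z)))"
    have "?F z \<le> (\<Sum>a\<in>T. ?F z * indicator (ball a (d a)) z)" for z
    proof (cases "norm z \<le> r")
      case True
      then obtain a where a: "a \<in> T" "z \<in> ball a (d a)" using T(3) by auto
      have "?F z * indicator (ball a (d a)) z \<le> (\<Sum>a\<in>T. ?F z * indicator (ball a (d a)) z)"
        using T(2) a(1) by (intro member_le_sum) auto
      then show ?thesis using a by simp
    qed (simp add: b0)
    then have "(\<integral>\<^sup>+z. ?F z \<partial>lborel) \<le> (\<integral>\<^sup>+z. (\<Sum>a\<in>T. ?F z * indicator (ball a (d a)) z) \<partial>lborel)"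
      by (intro nn_integral_mono)
    also have "\<dots> = (\<Sum>a\<in>T. \<integral>\<^sup>+z. ?F z * indicator (ball a (d a)) z \<partial>lborel)"
      by (intro nn_integral_sum) measurable
    also have "\<dots> < \<infinity>" using d(2) T(2) by (simp add: less_top[symmetric])
    finally show "(\<integral>\<^sup>+z. ?F z \<partial>lborel) < \<infinity>" .
  qed measurable
  show intn: "integrable lborel (\<lambda>z. b n z * (reg_grad (eps n) \<mu> z \<bullet> ?h z))" for n
  proof -
    have "continuous_on (cball 0 r) (reg_grad (eps n) \<mu>)" using m.continuous_reg_grad[OF eps_pos] continuous_on_subset by blast
    then have "compact (reg_grad (eps n) \<mu> ` cball 0 r)" by (rule compact_continuous_image) simp
    then obtain G where G: "\<And>z. z \<in> cball 0 r \<Longrightarrow> norm (reg_grad (eps n) \<mu> z) \<le> G"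
      using compact_imp_bounded bounded_iff by (metis image_eqI)
    define r' where "r' = max r 1"
    have hi: "integrable lborel (\<lambda>z. norm (?h z) * indicator (cball 0 r') z)"
      by (rule n.integrable_norm_reg_grad) (simp add: r'_def)
    show ?thesis
    proof (rule Bochner_Integration.integrable_bound[OF integrable_mult_right[OF hi, of "B * G"]])
      show "AE z in lborel. norm (b n z * (reg_grad (eps n) \<mu> z \<bullet> ?h z)) \<le> norm (B * G * (norm (?h z) * indicator (cball 0 r') z))"
      proof (intro AE_I2)
        fix z
        show "norm (b n z * (reg_grad (eps n) \<mu> z \<bullet> ?h z)) \<le> norm (B * G * (norm (?h z) * indicator (cball 0 r') z))"
        proof (cases "norm z \<le> r")
          case True
          have "\<bar>reg_grad (eps n) \<mu> z \<bullet> ?h z\<bar> \<le> norm (reg_grad (eps n) \<mu> z) * norm (?h z)" by (rule Cauchy_Schwarz_ineq2)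
          also have "\<dots> \<le> G * norm (?h z)" using G[of z] True by (intro mult_right_mono) auto
          finally have "\<bar>b n z\<bar> * \<bar>reg_grad (eps n) \<mu> z \<bullet> ?h z\<bar> \<le> B * (G * norm (?h z))"
            using bb B by (intro mult_mono) auto
          also have "\<dots> \<le> \<bar>B * G * norm (?h z)\<bar>" by (simp add: mult.assoc)
          finally show ?thesis using True by (simp add: abs_mult r'_def)
        qed (simp add: b0)
      qed
    qed measurable
  qed
  show "(\<lambda>n. \<integral>z. b n z * (reg_grad (eps n) \<mu> z \<bullet> ?h z) \<partial>lborel) \<longlonglongrightarrow> (\<integral>z. b0 z * (?g z \<bullet> ?h z) \<partial>lborel)"
  proof (rule tendsto_L1_int[OF _ int0])
    show "(\<lambda>n. \<integral>\<^sup>+z. ennreal (norm (b n z * (reg_grad (eps n) \<mu> z \<bullet> ?h z) - b0 z * (?g z \<bullet> ?h z))) \<partial>lborel) \<longlonglongrightarrow> 0"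
      using lim by (simp only: D_def)
  qed (rule intn)
qed

end

section \<open>Truncated potentials as test functions\<close>

definition pos2 :: "real \<Rightarrow> real" where "pos2 x = (max 0 x)\<^sup>2"

lemma pos2_nonneg [simp]: "0 \<le> pos2 x" and pos2_neg: "x \<le> 0 \<Longrightarrow> pos2 x = 0"
  and pos2_pos: "0 < x \<Longrightarrow> pos2 x = x\<^sup>2"
  by (auto simp: pos2_def max_def)

lemma pos2_le_1: "x \<le> 1 \<Longrightarrow> pos2 x \<le> 1"
  by (auto simp: pos2_def power_le_one)

text \<open>Squaring removes the corner of the positive part: at 0 the difference quotient is at
  most |h|. The derivative is continuous, which is the regularity Green's formula asks for.\<close>

lemma pos2_has_derivative: "(pos2 has_real_derivative 2 * max 0 x) (at x)"
proof (cases "x = 0")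
  case True
  have "((\<lambda>h. pos2 h / h) \<longlongrightarrow> 0) (at 0)"
  proof (rule Lim_null_comparison)
    show "eventually (\<lambda>h::real. norm (pos2 h / h) \<le> \<bar>h\<bar>) (at 0)"
      by (intro always_eventually allI) (auto simp: pos2_def max_def power2_eq_square)
    show "((\<lambda>h::real. \<bar>h\<bar>) \<longlongrightarrow> 0) (at 0)" using tendsto_rabs[OF tendsto_ident_at, of 0 UNIV] by simp
  qed
  then show ?thesis using True by (simp add: DERIV_def pos2_def)
next
  case False
  show ?thesis
  proof (cases "x > 0")
    case True
    have "((\<lambda>x. x\<^sup>2) has_real_derivative 2 * max 0 x) (at x)"
      using True by (auto intro!: derivative_eq_intros)
    then show ?thesis
      by (rule has_field_derivative_transform_within_open[of _ _ _ "{0<..}"]) (use True in \<open>auto simp: pos2_pos\<close>)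
  next
    case 2: False
    have "((\<lambda>x. 0) has_real_derivative 2 * max 0 x) (at x)" using 2 by simp
    then show ?thesis
      by (rule has_field_derivative_transform_within_open[of _ _ _ "{..<0}"]) (use 2 False in \<open>auto simp: pos2_neg\<close>)
  qed
qed

lemma continuous_pos2: "continuous_on S pos2"
  using pos2_has_derivative by (auto intro!: continuous_at_imp_continuous_on DERIV_isCont)

lemma isCont_pos2: "isCont pos2 x"
  using pos2_has_derivative by (rule DERIV_isCont)

lemma has_derivative_grad_compose:
  assumes "(f has_derivative (\<lambda>h. g \<bullet> h)) (at z)" "(\<rho> has_real_derivative \<rho>') (at (f z))"
  shows "((\<lambda>z. \<rho> (f z)) has_derivative (\<lambda>h. (\<rho>' *\<^sub>R g) \<bullet> h)) (at z)"
  using has_derivative_compose[OF assms(1) assms(2)[unfolded has_field_derivative_def]] by simp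

lemma has_derivative_grad_mult:
  assumes "(f has_derivative (\<lambda>h. g \<bullet> h)) (at z)" "(f' has_derivative (\<lambda>h. g' \<bullet> h)) (at z)"
  shows "((\<lambda>z. f z * f' z :: real) has_derivative (\<lambda>h. (f z *\<^sub>R g' + f' z *\<^sub>R g) \<bullet> h)) (at z)"
  using has_derivative_mult[OF assms] by (simp add: inner_add_left mult.commute)

lemma has_derivative_grad_diff:
  assumes "(f has_derivative (\<lambda>h. g \<bullet> h)) (at z)" "(f' has_derivative (\<lambda>h. g' \<bullet> h)) (at z)"
  shows "((\<lambda>z. f z - f' z :: real) has_derivative (\<lambda>h. (g - g') \<bullet> h)) (at z)"
  using has_derivative_diff[OF assms] by (simp add: inner_diff_left)

text \<open>The function \<open>pos2 (1 - pos2 (|z|^2 - r^2))\<close> works: inside the disc the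
  inner argument is nonpositive, and for |z| > r + 1 it is at least 2r + 1 \<ge> 1, so the outer one
  is nonpositive. Its gradient also vanishes on the inner disc.\<close>

lemma C1_cutoff:
  assumes r: "0 \<le> r"
  obtains \<zeta> :: "complex \<Rightarrow> real" and X where
    "\<And>z. (\<zeta> has_derivative (\<lambda>h. X z \<bullet> h)) (at z)" "continuous_on UNIV X"
    "\<And>z. 0 \<le> \<zeta> z" "\<And>z. \<zeta> z \<le> 1" "\<And>z. norm z \<le> r \<Longrightarrow> \<zeta> z = 1" "\<And>z. norm z \<le> r \<Longrightarrow> X z = 0"
    "\<And>z. norm z > r + 1 \<Longrightarrow> \<zeta> z = 0"
proof -
  define t :: "complex \<Rightarrow> real" where "t z = z \<bullet> z - r\<^sup>2" for z
  define \<zeta> where "\<zeta> z = pos2 (1 - pos2 (t z))" for z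
  define X where "X z = (2 * max 0 (1 - pos2 (t z))) *\<^sub>R (0 - (2 * max 0 (t z)) *\<^sub>R (2 *\<^sub>R z - 0))" for z
  have dt: "(t has_derivative (\<lambda>h. (2 *\<^sub>R z - 0) \<bullet> h)) (at z)" for z
  proof -
    have "((\<lambda>z. z \<bullet> z - r\<^sup>2) has_derivative (\<lambda>h. (z \<bullet> h + h \<bullet> z) - 0)) (at z)"
      by (intro has_derivative_diff has_derivative_inner has_derivative_ident has_derivative_const)
    then show ?thesis by (simp add: t_def[abs_def] inner_commute)
  qed
  show ?thesis
  proof (rule that[of \<zeta> X])
    show "(\<zeta> has_derivative (\<lambda>h. X z \<bullet> h)) (at z)" for z
      unfolding \<zeta>_def[abs_def] X_def
      by (intro has_derivative_grad_compose has_derivative_grad_diff pos2_has_derivative dt) simp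
    show "continuous_on UNIV X"
      unfolding X_def[abs_def] t_def by (intro continuous_intros continuous_on_compose2[OF continuous_pos2[of UNIV]]) auto
    show "0 \<le> \<zeta> z" "\<zeta> z \<le> 1" for z by (auto simp: \<zeta>_def intro: pos2_le_1)
    fix z :: complex
    show "\<zeta> z = 1" "X z = 0" if "norm z \<le> r"
    proof -
      have "t z \<le> 0" using power_mono[OF that, of 2] by (simp add: t_def power2_norm_eq_inner)
      then show "\<zeta> z = 1" "X z = 0" by (auto simp: \<zeta>_def X_def pos2_neg pos2_pos)
    qed
    show "\<zeta> z = 0" if "norm z > r + 1"
    proof -
      have "(norm z)\<^sup>2 \<ge> (r + 1)\<^sup>2" using that r by (intro power_mono) auto
      then have "t z \<ge> 1" using r by (simp add: t_def power2_norm_eq_inner[symmetric] power2_sum)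
      then have "pos2 (t z) \<ge> 1" by (simp add: pos2_pos)
      then show ?thesis by (simp add: \<zeta>_def pos2_neg)
    qed
  qed
qed

context equal_square
begin

text \<open>The function T of the uniqueness argument applied to a potential; \<open>M\<close> is
  the truncation level, and \<open>trunc'\<close> below carries T'.\<close>

definition trunc :: "real \<Rightarrow> real \<Rightarrow> complex measure \<Rightarrow> complex \<Rightarrow> real" where
  "trunc M e \<mu> z = pos2 (reg_pot e \<mu> z + M)"

definition trunc' :: "real \<Rightarrow> real \<Rightarrow> complex measure \<Rightarrow> complex \<Rightarrow> real" where
  "trunc' M e \<mu> z = 2 * max 0 (reg_pot e \<mu> z + M)"

text \<open>Green's formula is applied to the C^1 function \<zeta> F(W_e) for e > 0 and then e tends
  to 0. Only the area integrals are identified in the limit: the potentials converge almost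
  everywhere for area, which says nothing about integrals against \<open>\<nu>\<close>. These
  therefore stay a sequence, whose limit is the content of the third claim.\<close>

lemma test_function_limit:
  fixes F F' :: "real \<Rightarrow> real" and \<zeta> :: "complex \<Rightarrow> real" and X :: "complex \<Rightarrow> complex"
    and r M :: real and \<nu> :: "complex measure"
  assumes F: "\<And>x. (F has_real_derivative F' x) (at x)" "continuous_on UNIV F'" "F 0 = 0"
    and chi: "\<And>z. (\<zeta> has_derivative (\<lambda>h. X z \<bullet> h)) (at z)" "continuous_on UNIV X"
    and chi01: "\<And>z. 0 \<le> \<zeta> z" "\<And>z. \<zeta> z \<le> 1"
    and X0: "\<And>z. norm z \<le> R0 \<Longrightarrow> X z = 0"
    and chi0: "\<And>z. norm z > r \<Longrightarrow> \<zeta> z = 0" and r: "0 \<le> r"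
    and nu: "\<nu> = \<mu>1 \<or> \<nu> = \<mu>2"
  defines "W \<equiv> \<lambda>e z. trunc M e \<mu>2 z - trunc M e \<mu>1 z"
  defines "b \<equiv> \<lambda>\<mu> z. \<zeta> z * F' (W 0 z) * trunc' M 0 \<mu> z"
  shows "integrable lborel (\<lambda>z. b \<mu>2 z * (reg_grad 0 \<mu>2 z \<bullet> reg_grad 0 \<nu> z))"
    and "integrable lborel (\<lambda>z. b \<mu>1 z * (reg_grad 0 \<mu>1 z \<bullet> reg_grad 0 \<nu> z))"
    and "(\<lambda>n. - green_const * (\<integral>z. \<zeta> z * F (W (eps n) z) \<partial>\<nu>))
      \<longlonglongrightarrow> (\<integral>z. b \<mu>2 z * (reg_grad 0 \<mu>2 z \<bullet> reg_grad 0 \<nu> z) \<partial>lborel)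
            - (\<integral>z. b \<mu>1 z * (reg_grad 0 \<mu>1 z \<bullet> reg_grad 0 \<nu> z) \<partial>lborel)"
proof -
  interpret n: compact_prob \<nu> R0 using nu m1.compact_prob_axioms m2.compact_prob_axioms by auto
  have cF: "continuous_on UNIV F" using F(1) by (auto intro!: continuous_at_imp_continuous_on DERIV_isCont)
  have cchi: "continuous_on UNIV \<zeta>"
    using chi(1) by (auto intro!: continuous_at_imp_continuous_on has_derivative_continuous)
  have X0': "X z = 0" if "norm z > r" for z
    using has_derivative_eq_0_outside[OF chi(1) chi0 that] by (metis inner_eq_zero_iff)
  have [measurable]: "F \<in> borel_measurable borel" "F' \<in> borel_measurable borel" "X \<in> borel_measurable borel"
    "\<zeta> \<in> borel_measurable borel" "pos2 \<in> borel_measurable borel"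
    by (intro borel_measurable_continuous_onI cF F chi cchi continuous_pos2)+
  have tm [measurable]: "trunc M e \<mu>1 \<in> borel_measurable borel" "trunc M e \<mu>2 \<in> borel_measurable borel"
    "trunc' M e \<mu>1 \<in> borel_measurable borel" "trunc' M e \<mu>2 \<in> borel_measurable borel" for e
    unfolding trunc_def[abs_def] trunc'_def[abs_def] by measurable
  have Wm [measurable]: "W e \<in> borel_measurable borel" for e unfolding W_def by measurable
  \<comment> \<open>The potentials are bounded above on the disc uniformly in e, so their
    truncations are bounded on both sides.\<close>
  define L where "L = \<bar>ln ((r + R0)\<^sup>2 + 1) / 2\<bar> + \<bar>M\<bar>"
  have L: "L \<ge> 0" by (simp add: L_def)
  have Tb: "\<bar>max 0 (reg_pot (eps n) \<mu> z + M)\<bar> \<le> L" if "norm z \<le> r" "\<mu> = \<mu>1 \<or> \<mu> = \<mu>2" for n z \<mu>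
  proof -
    have "reg_pot (eps n) \<mu> z \<le> ln ((r + R0)\<^sup>2 + 1) / 2"
      using that(2) m1.reg_pot_le[OF that(1) eps_pos eps_le_1 r] m2.reg_pot_le[OF that(1) eps_pos eps_le_1 r] by auto
    then show ?thesis unfolding L_def by linarith
  qed
  have T'b: "\<bar>trunc' M (eps n) \<mu> z\<bar> \<le> 2 * L" if "norm z \<le> r" "\<mu> = \<mu>1 \<or> \<mu> = \<mu>2" for n z \<mu>
    using Tb[OF that] by (simp add: trunc'_def)
  have Wb: "\<bar>W (eps n) z\<bar> \<le> L\<^sup>2" if "norm z \<le> r" for n z
  proof -
    have "trunc M (eps n) \<mu> z \<le> L\<^sup>2 \<and> 0 \<le> trunc M (eps n) \<mu> z" if "\<mu> = \<mu>1 \<or> \<mu> = \<mu>2" for \<mu>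
      using Tb[OF \<open>norm z \<le> r\<close> that, of n] unfolding trunc_def pos2_def by (auto intro!: power_mono)
    from this[of \<mu>1] this[of \<mu>2] show ?thesis unfolding W_def by auto
  qed
  have bdd: "\<exists>C\<ge>0. \<forall>x. \<bar>x\<bar> \<le> L\<^sup>2 \<longrightarrow> \<bar>f x\<bar> \<le> C" if "continuous_on UNIV f" for f :: "real \<Rightarrow> real"
  proof -
    have "compact (f ` {-L\<^sup>2..L\<^sup>2})" by (intro compact_continuous_image continuous_on_subset[OF that]) auto
    then obtain C where C: "\<And>x. x \<in> {-L\<^sup>2..L\<^sup>2} \<Longrightarrow> norm (f x) \<le> C"
      using compact_imp_bounded bounded_iff by (metis image_eqI)
    have "C \<ge> 0" using order.trans[OF norm_ge_zero C[of 0]] by simp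
    then show ?thesis using C by (intro exI[of _ C]) (auto simp: abs_le_iff)
  qed
  obtain CF where CF: "CF \<ge> 0" "\<And>x. \<bar>x\<bar> \<le> L\<^sup>2 \<Longrightarrow> \<bar>F x\<bar> \<le> CF" using bdd[OF cF] by blast
  obtain CF' where CF': "CF' \<ge> 0" "\<And>x. \<bar>x\<bar> \<le> L\<^sup>2 \<Longrightarrow> \<bar>F' x\<bar> \<le> CF'" using bdd[OF F(2)] by blast
  have pl: "AE z in lborel. (\<lambda>n. W (eps n) z) \<longlonglongrightarrow> W 0 z \<and> (\<lambda>n. trunc' M (eps n) \<mu>1 z) \<longlonglongrightarrow> trunc' M 0 \<mu>1 z
       \<and> (\<lambda>n. trunc' M (eps n) \<mu>2 z) \<longlonglongrightarrow> trunc' M 0 \<mu>2 z"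
    using m1.AE_reg_pot_tendsto m2.AE_reg_pot_tendsto
  proof eventually_elim
    fix z assume l: "(\<lambda>n. reg_pot (eps n) \<mu>1 z) \<longlonglongrightarrow> reg_pot 0 \<mu>1 z" "(\<lambda>n. reg_pot (eps n) \<mu>2 z) \<longlonglongrightarrow> reg_pot 0 \<mu>2 z"
    show "(\<lambda>n. W (eps n) z) \<longlonglongrightarrow> W 0 z \<and> (\<lambda>n. trunc' M (eps n) \<mu>1 z) \<longlonglongrightarrow> trunc' M 0 \<mu>1 z
       \<and> (\<lambda>n. trunc' M (eps n) \<mu>2 z) \<longlonglongrightarrow> trunc' M 0 \<mu>2 z"
      unfolding W_def trunc_def trunc'_def
      by (intro conjI tendsto_intros isCont_tendsto_compose[OF isCont_pos2] l)
  qed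
  define bn where "bn \<mu> n z = \<zeta> z * F' (W (eps n) z) * trunc' M (eps n) \<mu> z" for \<mu> n z
  have prod: "integrable lborel (\<lambda>z. b \<mu> z * (reg_grad 0 \<mu> z \<bullet> reg_grad 0 \<nu> z))"
     "(\<lambda>n. \<integral>z. bn \<mu> n z * (reg_grad (eps n) \<mu> z \<bullet> reg_grad 0 \<nu> z) \<partial>lborel)
            \<longlonglongrightarrow> (\<integral>z. b \<mu> z * (reg_grad 0 \<mu> z \<bullet> reg_grad 0 \<nu> z) \<partial>lborel)"
     "integrable lborel (\<lambda>z. bn \<mu> n z * (reg_grad (eps n) \<mu> z \<bullet> reg_grad 0 \<nu> z))"
    if mu: "\<mu> = \<mu>1 \<or> \<mu> = \<mu>2" for \<mu> n
  proof -
    have i: "compact_prob \<mu> R0" using mu m1.compact_prob_axioms m2.compact_prob_axioms by auto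
    have [measurable]: "trunc' M e \<mu> \<in> borel_measurable borel" for e using mu tm by auto
    have 1: "bn \<mu> n \<in> borel_measurable borel" for n unfolding bn_def by measurable
    have 2: "b \<mu> \<in> borel_measurable borel" unfolding b_def by measurable
    have 3: "\<bar>bn \<mu> n z\<bar> \<le> CF' * (2 * L)" for n z
    proof (cases "norm z \<le> r")
      case True
      have "\<bar>\<zeta> z\<bar> * \<bar>F' (W (eps n) z)\<bar> * \<bar>trunc' M (eps n) \<mu> z\<bar> \<le> 1 * CF' * (2 * L)"
        using chi01[of z] CF' Wb[OF True] T'b[OF True mu] L by (intro mult_mono) auto
      then show ?thesis by (simp add: bn_def abs_mult)
    qed (use CF' L in \<open>simp add: bn_def chi0\<close>)
    have 4: "bn \<mu> n z = 0" "b \<mu> z = 0" if "norm z > r" for n z using that by (auto simp: bn_def b_def chi0)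
    have 5: "AE z in lborel. (\<lambda>n. bn \<mu> n z) \<longlonglongrightarrow> b \<mu> z"
      using pl
    proof eventually_elim
      fix z assume l: "(\<lambda>n. W (eps n) z) \<longlonglongrightarrow> W 0 z \<and> (\<lambda>n. trunc' M (eps n) \<mu>1 z) \<longlonglongrightarrow> trunc' M 0 \<mu>1 z
       \<and> (\<lambda>n. trunc' M (eps n) \<mu>2 z) \<longlonglongrightarrow> trunc' M 0 \<mu>2 z"
      have "isCont F' (W 0 z)" using F(2) by (simp add: continuous_on_eq_continuous_at)
      then have "(\<lambda>n. F' (W (eps n) z)) \<longlonglongrightarrow> F' (W 0 z)" by (rule isCont_tendsto_compose) (use l in blast)
      moreover have "(\<lambda>n. trunc' M (eps n) \<mu> z) \<longlonglongrightarrow> trunc' M 0 \<mu> z" using l mu by blast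
      ultimately show "(\<lambda>n. bn \<mu> n z) \<longlonglongrightarrow> b \<mu> z"
        unfolding bn_def b_def by (intro tendsto_mult tendsto_const)
    qed
    have 6: "bn \<mu> n z = 0" if "reg_pot (eps n) \<mu>1 z < - M" "reg_pot (eps n) \<mu>2 z < - M" for n z
      using that mu by (auto simp: bn_def trunc'_def)
    show "integrable lborel (\<lambda>z. b \<mu> z * (reg_grad 0 \<mu> z \<bullet> reg_grad 0 \<nu> z))"
     "(\<lambda>n. \<integral>z. bn \<mu> n z * (reg_grad (eps n) \<mu> z \<bullet> reg_grad 0 \<nu> z) \<partial>lborel)
            \<longlonglongrightarrow> (\<integral>z. b \<mu> z * (reg_grad 0 \<mu> z \<bullet> reg_grad 0 \<nu> z) \<partial>lborel)"
     "integrable lborel (\<lambda>z. bn \<mu> n z * (reg_grad (eps n) \<mu> z \<bullet> reg_grad 0 \<nu> z))"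
      using nn_integral_tendsto_product[OF i mu nu, of "bn \<mu>" "b \<mu>" "CF' * (2 * L)" r M] 1 2 3 4 5 6 by blast+
  qed
  show "integrable lborel (\<lambda>z. b \<mu>2 z * (reg_grad 0 \<mu>2 z \<bullet> reg_grad 0 \<nu> z))"
    "integrable lborel (\<lambda>z. b \<mu>1 z * (reg_grad 0 \<mu>1 z \<bullet> reg_grad 0 \<nu> z))" by (auto intro: prod(1))
  define XB where "XB n z = F (W (eps n) z) * (X z \<bullet> reg_grad 0 \<nu> z)" for n z
  define r' where "r' = max r 1"
  obtain BX where BX: "0 \<le> BX" "\<And>z. norm (X z) \<le> BX"
    using bounded_continuous_compact_support[OF chi(2) X0'] by blast
  have XBb: "norm (XB n z) \<le> CF * BX * (norm (reg_grad 0 \<nu> z) * indicator (cball 0 r') z)" for n z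
  proof (cases "norm z \<le> r")
    case True
    have "\<bar>X z \<bullet> reg_grad 0 \<nu> z\<bar> \<le> norm (X z) * norm (reg_grad 0 \<nu> z)" by (rule Cauchy_Schwarz_ineq2)
    also have "\<dots> \<le> BX * norm (reg_grad 0 \<nu> z)" using BX by (intro mult_right_mono) auto
    finally have "\<bar>F (W (eps n) z)\<bar> * \<bar>X z \<bullet> reg_grad 0 \<nu> z\<bar> \<le> CF * (BX * norm (reg_grad 0 \<nu> z))"
      using CF Wb[OF True] by (intro mult_mono) auto
    then show ?thesis using True by (simp add: XB_def abs_mult r'_def mult.assoc)
  qed (use CF BX in \<open>simp add: XB_def X0'\<close>)
  have XBm: "XB n \<in> borel_measurable lborel" for n unfolding XB_def[abs_def] by measurable
  have dom: "integrable lborel (\<lambda>z. CF * BX * (norm (reg_grad 0 \<nu> z) * indicator (cball 0 r') z))"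
    by (intro integrable_mult_right n.integrable_norm_reg_grad) (simp add: r'_def)
  have XBi: "integrable lborel (XB n)" for n
    by (rule Bochner_Integration.integrable_bound[OF dom XBm], intro AE_I2 order.trans[OF XBb]) simp
  \<comment> \<open>The gradient of the cutoff is supported where |z| > R0; there the two potentials
    coincide, so W tends to 0 almost everywhere and F(0) = 0 removes the term.\<close>
  have XBl: "(\<lambda>n. \<integral>z. XB n z \<partial>lborel) \<longlonglongrightarrow> (\<integral>(z::complex). 0 \<partial>lborel)"
  proof (rule integral_dominated_convergence[OF _ XBm dom _ AE_I2[OF XBb]])
    show "AE z in lborel. (\<lambda>n. XB n z) \<longlonglongrightarrow> 0"
      using pl
    proof eventually_elim
      fix z assume l: "(\<lambda>n. W (eps n) z) \<longlonglongrightarrow> W 0 z \<and> (\<lambda>n. trunc' M (eps n) \<mu>1 z) \<longlonglongrightarrow> trunc' M 0 \<mu>1 z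
       \<and> (\<lambda>n. trunc' M (eps n) \<mu>2 z) \<longlonglongrightarrow> trunc' M 0 \<mu>2 z"
      show "(\<lambda>n. XB n z) \<longlonglongrightarrow> 0"
      proof (cases "norm z \<le> R0")
        case False
        then have "W 0 z = 0" using pot_eq_outside[of z] by (simp add: W_def trunc_def)
        moreover have "isCont F (W 0 z)" using cF by (simp add: continuous_on_eq_continuous_at)
        ultimately have "(\<lambda>n. F (W (eps n) z)) \<longlonglongrightarrow> 0"
          using l F(3) isCont_tendsto_compose[of "W 0 z" F "\<lambda>n. W (eps n) z"] by simp
        then show ?thesis unfolding XB_def by (rule tendsto_mult_left_zero)
      qed (simp add: XB_def X0)
    qed
  qed simp
  have eq: "- green_const * (\<integral>z. \<zeta> z * F (W (eps n) z) \<partial>\<nu>)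
     = (\<integral>z. bn \<mu>2 n z * (reg_grad (eps n) \<mu>2 z \<bullet> reg_grad 0 \<nu> z) \<partial>lborel)
     - (\<integral>z. bn \<mu>1 n z * (reg_grad (eps n) \<mu>1 z \<bullet> reg_grad 0 \<nu> z) \<partial>lborel) + (\<integral>z. XB n z \<partial>lborel)" for n
  proof -
    let ?g1 = "reg_grad (eps n) \<mu>1" and ?g2 = "reg_grad (eps n) \<mu>2"
    let ?W = "W (eps n)"
    \<comment> \<open>The gradient of \<zeta> F(W) by the product and chain rules; pairing it with
      the gradient for \<open>\<nu>\<close> produces the two product integrals and the cutoff
      term.\<close>
    define G where "G z = \<zeta> z *\<^sub>R (F' (?W z) *\<^sub>R (trunc' M (eps n) \<mu>2 z *\<^sub>R (?g2 z + 0) - trunc' M (eps n) \<mu>1 z *\<^sub>R (?g1 z + 0)))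
        + F (?W z) *\<^sub>R X z" for z
    have dT: "(trunc M (eps n) \<mu> has_derivative (\<lambda>h. (trunc' M (eps n) \<mu> z *\<^sub>R (reg_grad (eps n) \<mu> z + 0)) \<bullet> h)) (at z)"
      if "(reg_pot (eps n) \<mu> has_derivative (\<lambda>h. reg_grad (eps n) \<mu> z \<bullet> h)) (at z)" for \<mu> z
    proof -
      have "((\<lambda>z. reg_pot (eps n) \<mu> z + M) has_derivative (\<lambda>h. (reg_grad (eps n) \<mu> z + 0) \<bullet> h)) (at z)"
        using has_derivative_add_const[OF that, of M] by simp
      from has_derivative_grad_compose[OF this pos2_has_derivative]
      show ?thesis by (simp only: trunc_def[abs_def] trunc'_def)
    qed
    note d1 = dT[OF m1.reg_pot_has_derivative[OF eps_pos]] and d2 = dT[OF m2.reg_pot_has_derivative[OF eps_pos]]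
    have dW: "(?W has_derivative (\<lambda>h. (trunc' M (eps n) \<mu>2 z *\<^sub>R (?g2 z + 0) - trunc' M (eps n) \<mu>1 z *\<^sub>R (?g1 z + 0)) \<bullet> h)) (at z)" for z
      unfolding W_def by (rule has_derivative_grad_diff[OF d2 d1])
    have dG: "((\<lambda>z. \<zeta> z * F (?W z)) has_derivative (\<lambda>h. G z \<bullet> h)) (at z)" for z
      unfolding G_def by (rule has_derivative_grad_mult[OF chi(1) has_derivative_grad_compose[OF dW F(1)]])
    have cp: "continuous_on UNIV (reg_pot (eps n) \<mu>1)" "continuous_on UNIV (reg_pot (eps n) \<mu>2)"
      using m1.reg_pot_has_derivative[OF eps_pos] m2.reg_pot_has_derivative[OF eps_pos]
      by (auto intro!: continuous_at_imp_continuous_on has_derivative_continuous)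
    have cW: "continuous_on UNIV ?W"
      using dW by (auto intro!: continuous_at_imp_continuous_on has_derivative_continuous)
    have cG: "continuous_on UNIV G"
      unfolding G_def trunc'_def
      by (intro continuous_intros cchi chi(2) cp m1.continuous_reg_grad m2.continuous_reg_grad eps_pos
          continuous_on_compose2[OF F(2) cW] continuous_on_compose2[OF cF cW]) auto
    have "(\<integral>z. G z \<bullet> reg_grad 0 \<nu> z \<partial>lborel) = - green_const * (\<integral>z. \<zeta> z * F (?W z) \<partial>\<nu>)"
      by (rule n.green_mu[OF dG cG, of r]) (simp add: chi0)
    moreover have "G z \<bullet> reg_grad 0 \<nu> z = bn \<mu>2 n z * (?g2 z \<bullet> reg_grad 0 \<nu> z) - bn \<mu>1 n z * (?g1 z \<bullet> reg_grad 0 \<nu> z) + XB n z" for z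
      by (simp add: G_def bn_def XB_def inner_add_left inner_diff_left algebra_simps)
    ultimately show ?thesis
      using prod(3)[of \<mu>1 n] prod(3)[of \<mu>2 n] XBi[of n] by simp
  qed
  have "(\<lambda>n. (\<integral>z. bn \<mu>2 n z * (reg_grad (eps n) \<mu>2 z \<bullet> reg_grad 0 \<nu> z) \<partial>lborel)
     - (\<integral>z. bn \<mu>1 n z * (reg_grad (eps n) \<mu>1 z \<bullet> reg_grad 0 \<nu> z) \<partial>lborel) + (\<integral>z. XB n z \<partial>lborel))
     \<longlonglongrightarrow> (\<integral>z. b \<mu>2 z * (reg_grad 0 \<mu>2 z \<bullet> reg_grad 0 \<nu> z) \<partial>lborel)
            - (\<integral>z. b \<mu>1 z * (reg_grad 0 \<mu>1 z \<bullet> reg_grad 0 \<nu> z) \<partial>lborel) + (\<integral>(z::complex). 0 \<partial>lborel)"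
    by (intro tendsto_add tendsto_diff prod(2) XBl) auto
  then show "(\<lambda>n. - green_const * (\<integral>z. \<zeta> z * F (W (eps n) z) \<partial>\<nu>))
      \<longlonglongrightarrow> (\<integral>z. b \<mu>2 z * (reg_grad 0 \<mu>2 z \<bullet> reg_grad 0 \<nu> z) \<partial>lborel)
            - (\<integral>z. b \<mu>1 z * (reg_grad 0 \<mu>1 z \<bullet> reg_grad 0 \<nu> z) \<partial>lborel)"
    unfolding eq by simp
qed

end

section \<open>Uniqueness\<close>

text \<open>Open boxes generate the Borel sets and are stable under intersection, and the indicator
  of a box is a pointwise limit of C^1 functions with values in [0,1] supported in it.\<close>

lemma measure_eqI_C1:
  fixes \<mu>1 \<mu>2 :: "complex measure"
  assumes p1: "prob_space \<mu>1" and s1: "sets \<mu>1 = sets borel"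
    and p2: "prob_space \<mu>2" and s2: "sets \<mu>2 = sets borel"
    and eq: "\<And>\<phi> G r. (\<And>z. (\<phi> has_derivative (\<lambda>h. G z \<bullet> h)) (at z)) \<Longrightarrow> continuous_on UNIV G \<Longrightarrow>
        (\<And>z. norm z > r \<Longrightarrow> \<phi> z = 0) \<Longrightarrow> (\<integral>\<xi>. \<phi> \<xi> \<partial>\<mu>1) = (\<integral>\<xi>. \<phi> \<xi> \<partial>\<mu>2)"
  shows "\<mu>1 = \<mu>2"
proof (rule measure_eqI_generator_eq[of "range (\<lambda>(a, b). box a b)" UNIV])
  let ?E = "range (\<lambda>(a, b). box a b) :: complex set set"
  interpret p1: prob_space \<mu>1 by fact
  interpret p2: prob_space \<mu>2 by fact
  show "Int_stable ?E"
    by (auto simp: Int_stable_def box_Int_box)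
  show "?E \<subseteq> Pow UNIV" "sets \<mu>1 = sigma_sets UNIV ?E" "sets \<mu>2 = sigma_sets UNIV ?E"
    by (simp_all add: borel_eq_box s1 s2)
  let ?A = "\<lambda>n::nat. box (- (real n *\<^sub>R One)) (real n *\<^sub>R One) :: complex set"
  show "range ?A \<subseteq> ?E" "(\<Union>i. ?A i) = UNIV"
    unfolding UN_box_eq_UNIV by auto
  show "emeasure \<mu>1 (?A i) \<noteq> \<infinity>" for i by simp
  fix X assume "X \<in> ?E"
  then obtain a b where X: "X = box a b" by auto
  show "emeasure \<mu>1 X = emeasure \<mu>2 X"
  proof (cases "box a b = {}")
    case False
    then have ab: "Re a < Re b" "Im a < Im b" by (auto simp: box_ne_empty Basis_complex_def)
    define f where "f e z = (z \<bullet> e - a \<bullet> e) * (b \<bullet> e - z \<bullet> e)" for e z :: complex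
    \<comment> \<open>Positive exactly on the box. The squared positive part is taken of each
      factor, since the product of the raw factors would also be positive where both are
      negative.\<close>
    define m where "m z = pos2 (f 1 z) * pos2 (f \<i> z)" for z
    define df where "df e z = (a \<bullet> e + b \<bullet> e - 2 * (z \<bullet> e)) *\<^sub>R e" for e z :: complex
    define dm where "dm z = pos2 (f 1 z) *\<^sub>R ((2 * max 0 (f \<i> z)) *\<^sub>R df \<i> z) + pos2 (f \<i> z) *\<^sub>R ((2 * max 0 (f 1 z)) *\<^sub>R df 1 z)" for z
    \<comment> \<open>A C^1 clamp of k m: it is 0 where m = 0 and 1 as soon as k m(z) \<ge>
      1.\<close>
    define \<phi> where "\<phi> k z = pos2 (1 - pos2 (1 - real k * m z))" for k z
    define G where "G k z = (2 * max 0 (1 - pos2 (1 - real k * m z))) *\<^sub>R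
        (0 - (2 * max 0 (1 - real k * m z)) *\<^sub>R (0 - real k *\<^sub>R dm z))" for k z
    have fd: "(f e has_derivative (\<lambda>h. df e z \<bullet> h)) (at z)" for e z
    proof -
      have "(f e has_derivative (\<lambda>h. (z \<bullet> e - a \<bullet> e) * (0 - h \<bullet> e) + (h \<bullet> e - 0) * (b \<bullet> e - z \<bullet> e))) (at z)"
        unfolding f_def
        by (intro has_derivative_mult has_derivative_diff has_derivative_inner_left has_derivative_ident has_derivative_const)
      then show ?thesis by (simp add: df_def algebra_simps inner_commute)
    qed
    have fc: "continuous_on UNIV (f e)" for e unfolding f_def by (intro continuous_intros)
    have md: "(m has_derivative (\<lambda>h. dm z \<bullet> h)) (at z)" for z
      unfolding m_def dm_def
      by (intro has_derivative_grad_mult has_derivative_grad_compose pos2_has_derivative fd)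
    have mc: "continuous_on UNIV m"
      unfolding m_def by (intro continuous_intros continuous_on_compose2[OF continuous_pos2[of UNIV] fc]) auto
    have dmc: "continuous_on UNIV dm"
      unfolding dm_def df_def by (intro continuous_intros fc continuous_on_compose2[OF continuous_pos2[of UNIV] fc]) auto
    have \<phi>d: "(\<phi> k has_derivative (\<lambda>h. G k z \<bullet> h)) (at z)" for k z
    proof -
      have c: "((\<lambda>z. 1) has_derivative (\<lambda>h. 0 \<bullet> h)) (at z)" by simp
      have 1: "((\<lambda>z. real k * m z) has_derivative (\<lambda>h. (real k *\<^sub>R dm z) \<bullet> h)) (at z)"
        using has_derivative_mult_right[OF md, of "real k"] by simp
      note 2 = has_derivative_grad_compose[OF has_derivative_grad_diff[OF c 1] pos2_has_derivative]
      show ?thesis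
        unfolding \<phi>_def G_def
        by (rule has_derivative_grad_compose[OF has_derivative_grad_diff[OF c 2] pos2_has_derivative])
    qed
    have Gc: "continuous_on UNIV (G k)" for k
      unfolding G_def by (intro continuous_intros mc dmc continuous_on_compose2[OF continuous_pos2[of UNIV]]) auto
    have mpos: "m z > 0 \<longleftrightarrow> z \<in> X" and mnn: "m z \<ge> 0" for z
    proof -
      have "0 < f 1 z \<longleftrightarrow> Re a < Re z \<and> Re z < Re b" "0 < f \<i> z \<longleftrightarrow> Im a < Im z \<and> Im z < Im b"
        using ab by (auto simp: f_def zero_less_mult_iff)
      moreover have "pos2 x > 0 \<longleftrightarrow> x > 0" for x by (auto simp: pos2_def max_def)
      moreover have "m z > 0 \<longleftrightarrow> pos2 (f 1 z) > 0 \<and> pos2 (f \<i> z) > 0"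
      proof -
        have "0 < x * y \<longleftrightarrow> 0 < x \<and> 0 < y" if "0 \<le> x" "0 \<le> y" for x y :: real
          using that by (auto simp: zero_less_mult_iff)
        then show ?thesis unfolding m_def by simp
      qed
      ultimately show "m z > 0 \<longleftrightarrow> z \<in> X" by (auto simp: X mem_box Basis_complex_def)
      show "m z \<ge> 0" by (simp add: m_def)
    qed
    have \<phi>01: "0 \<le> \<phi> k z" "\<phi> k z \<le> 1" for k z by (auto simp: \<phi>_def intro: pos2_le_1)
    have \<phi>0: "\<phi> k z = 0" if "z \<notin> X" for k z
      using mpos[of z] mnn[of z] that by (simp add: \<phi>_def pos2_def)
    obtain r where r: "X \<subseteq> cball 0 r" using bounded_subset_ballD[OF bounded_box[of a b], of 0] ball_subset_cball X by blast
    have lim: "(\<lambda>k. \<phi> k z) \<longlonglongrightarrow> indicator X z" for z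
    proof (cases "z \<in> X")
      case True
      then have mz: "m z > 0" using mpos by simp
      obtain k0 where k0: "1 / m z < real k0" using reals_Archimedean2 by blast
      have "eventually (\<lambda>k. \<phi> k z = 1) sequentially"
        using eventually_ge_at_top[of k0]
      proof eventually_elim
        fix k assume "k0 \<le> k"
        then have "1 / m z \<le> real k" using k0 by linarith
        then have "1 \<le> real k * m z" using mz by (simp add: divide_le_eq)
        then show "\<phi> k z = 1" by (simp add: \<phi>_def pos2_def)
      qed
      then show ?thesis using True by (simp add: tendsto_eventually)
    qed (simp add: \<phi>0)
    have \<phi>m: "\<phi> k \<in> borel_measurable borel" for k
      unfolding \<phi>_def
      by (intro borel_measurable_continuous_onI continuous_on_compose2[OF continuous_pos2[of UNIV]] continuous_intros mc) auto
    have Xb: "X \<in> sets borel" by (simp add: X)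
    have lim': "(\<lambda>k. \<integral>\<xi>. \<phi> k \<xi> \<partial>\<mu>) \<longlonglongrightarrow> measure \<mu> X" if \<mu>: "prob_space \<mu>" "sets \<mu> = sets borel" for \<mu>
    proof -
      interpret prob_space \<mu> by fact
      have mb: "borel_measurable \<mu> = (borel_measurable borel :: (complex \<Rightarrow> real) set)" by (rule measurable_cong_sets[OF \<mu>(2) refl])
      have "(\<lambda>k. \<integral>\<xi>. \<phi> k \<xi> \<partial>\<mu>) \<longlonglongrightarrow> (\<integral>\<xi>. indicator X \<xi> \<partial>\<mu>)"
      proof (rule integral_dominated_convergence[where w = "\<lambda>_. 1"])
        show "(indicator X :: complex \<Rightarrow> real) \<in> borel_measurable \<mu>" "\<phi> k \<in> borel_measurable \<mu>" for k
          unfolding mb using Xb by (auto intro: \<phi>m)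
      qed (use \<phi>01 lim in \<open>auto simp: abs_of_nonneg\<close>)
      moreover have "(\<integral>\<xi>. indicator X \<xi> \<partial>\<mu>) = measure \<mu> X" using Xb \<mu>(2) by simp
      ultimately show ?thesis by simp
    qed
    have "(\<integral>\<xi>. \<phi> k \<xi> \<partial>\<mu>1) = (\<integral>\<xi>. \<phi> k \<xi> \<partial>\<mu>2)" for k
    proof (rule eq[OF \<phi>d Gc])
      fix z :: complex assume "r < norm z"
      then show "\<phi> k z = 0" using r by (intro \<phi>0) auto
    qed
    then have "measure \<mu>1 X = measure \<mu>2 X"
      using lim'[OF p1 s1] lim'[OF p2 s2] LIMSEQ_unique by simp
    then show ?thesis by (simp add: p1.emeasure_eq_measure p2.emeasure_eq_measure)
  qed (simp add: X)
qed

lemma integrable_prob_cutoff: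
  fixes f :: "complex \<Rightarrow> real"
  assumes "prob_space \<nu>" "sets \<nu> = sets borel" "f \<in> borel_measurable borel" "\<And>z. \<bar>f z\<bar> \<le> B"
  shows "integrable \<nu> f"
proof -
  interpret prob_space \<nu> by fact
  show ?thesis
    by (rule integrable_const_bound[of _ B]) (use assms in \<open>auto simp: measurable_cong_sets[OF assms(2) refl]\<close>)
qed

context equal_square
begin

text \<open>For F(x) = x^2 each limit \<open>L \<nu>\<close> is nonpositive, being a limit of
  -\<open>green_const\<close> times integrals of \<zeta> W^2, whereas their sum is an integral of a
  nonnegative function; so both vanish. This kills the limits for F(x) = x too, and their difference
  is the integral of a nonnegative multiple of |g_1 - g_2|^2.\<close>

lemma truncated_grad_eq:
  "AE z in lborel. norm z \<le> R0 \<longrightarrow> (trunc' M 0 \<mu>1 z + trunc' M 0 \<mu>2 z) * (norm (reg_grad 0 \<mu>1 z - reg_grad 0 \<mu>2 z))\<^sup>2 = 0"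
proof -
  obtain \<zeta> :: "complex \<Rightarrow> real" and X where chi: "\<And>z. (\<zeta> has_derivative (\<lambda>h. X z \<bullet> h)) (at z)" "continuous_on UNIV X"
    and chi01: "\<And>z. 0 \<le> \<zeta> z" "\<And>z. \<zeta> z \<le> 1" and chi1: "\<And>z. norm z \<le> R0 \<Longrightarrow> \<zeta> z = 1" and X0: "\<And>z. norm z \<le> R0 \<Longrightarrow> X z = 0"
    and chi0: "\<And>z. norm z > R0 + 1 \<Longrightarrow> \<zeta> z = 0"
    using C1_cutoff[OF m1.R0_nonneg] by blast
  have rnn: "0 \<le> R0 + 1" using m1.R0_nonneg by simp
  define W where "W = (\<lambda>e z. trunc M e \<mu>2 z - trunc M e \<mu>1 z)"
  let ?g1 = "reg_grad 0 \<mu>1" and ?g2 = "reg_grad 0 \<mu>2"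
  let ?t1 = "trunc' M 0 \<mu>1" and ?t2 = "trunc' M 0 \<mu>2"
  have tp: "?t1 z \<ge> 0" "?t2 z \<ge> 0" for z by (auto simp: trunc'_def)
  have dsq: "((\<lambda>x. x\<^sup>2) has_real_derivative 2 * x) (at x)" for x :: real
    by (auto intro!: derivative_eq_intros)
  have csq: "continuous_on UNIV (\<lambda>x::real. 2 * x)" by (intro continuous_intros)
  note sq = test_function_limit[OF dsq csq _ chi chi01 X0 chi0 rnn, where M = M]
  have did: "((\<lambda>x. x) has_real_derivative 1) (at x)" for x :: real by (rule DERIV_ident)
  have cid: "continuous_on UNIV (\<lambda>x::real. 1::real)" by (intro continuous_intros)
  note id = test_function_limit[OF did cid _ chi chi01 X0 chi0 rnn, where M = M]
  have cont: "continuous_on UNIV \<zeta>" "continuous_on UNIV (W (eps n))" for n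
  proof -
    show "continuous_on UNIV \<zeta>"
      using chi(1) by (auto intro!: continuous_at_imp_continuous_on has_derivative_continuous)
    have "continuous_on UNIV (reg_pot (eps n) \<mu>1)" "continuous_on UNIV (reg_pot (eps n) \<mu>2)"
      using m1.reg_pot_has_derivative[OF eps_pos] m2.reg_pot_has_derivative[OF eps_pos]
      by (auto intro!: continuous_at_imp_continuous_on has_derivative_continuous)
    then show "continuous_on UNIV (W (eps n))"
      unfolding W_def trunc_def by (intro continuous_intros continuous_on_compose2[OF continuous_pos2[of UNIV]]) auto
  qed
  define \<phi> where "\<phi> n z = \<zeta> z * (W (eps n) z)\<^sup>2" for n z
  define \<psi> where "\<psi> n z = \<zeta> z * W (eps n) z" for n z
  have int: "integrable \<nu> (\<phi> n)" "integrable \<nu> (\<psi> n)" if \<nu>: "prob_space \<nu>" "sets \<nu> = sets borel" for \<nu> n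
  proof -
    have c: "continuous_on UNIV (\<phi> n)" "continuous_on UNIV (\<psi> n)" unfolding \<phi>_def \<psi>_def by (intro continuous_intros cont)+
    have z: "\<And>z. norm z > R0 + 1 \<Longrightarrow> \<phi> n z = 0" "\<And>z. norm z > R0 + 1 \<Longrightarrow> \<psi> n z = 0"
      by (auto simp: \<phi>_def \<psi>_def chi0)
    obtain B where "\<And>z. norm (\<phi> n z) \<le> B" using bounded_continuous_compact_support[OF c(1) z(1)] by blast
    then show "integrable \<nu> (\<phi> n)"
      using \<nu> c by (intro integrable_prob_cutoff[of _ _ B]) (auto intro: borel_measurable_continuous_onI)
    obtain B where "\<And>z. norm (\<psi> n z) \<le> B" using bounded_continuous_compact_support[OF c(2) z(2)] by blast
    then show "integrable \<nu> (\<psi> n)"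
      using \<nu> c by (intro integrable_prob_cutoff[of _ _ B]) (auto intro: borel_measurable_continuous_onI)
  qed
  have sqi: "integrable lborel (\<lambda>z. \<zeta> z * (2 * W 0 z) * ?t2 z * (?g2 z \<bullet> reg_grad 0 \<nu> z))"
      "integrable lborel (\<lambda>z. \<zeta> z * (2 * W 0 z) * ?t1 z * (?g1 z \<bullet> reg_grad 0 \<nu> z))"
    if "\<nu> = \<mu>1 \<or> \<nu> = \<mu>2" for \<nu>
    using sq(1,2)[OF _ _ _ that] unfolding W_def by simp_all
  have idi: "integrable lborel (\<lambda>z. \<zeta> z * ?t2 z * (?g2 z \<bullet> reg_grad 0 \<nu> z))"
      "integrable lborel (\<lambda>z. \<zeta> z * ?t1 z * (?g1 z \<bullet> reg_grad 0 \<nu> z))"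
    if "\<nu> = \<mu>1 \<or> \<nu> = \<mu>2" for \<nu>
    using id(1,2)[OF _ _ _ that] by simp_all
  define L where "L \<nu> = (\<integral>z. \<zeta> z * (2 * W 0 z) * ?t2 z * (?g2 z \<bullet> reg_grad 0 \<nu> z) \<partial>lborel)
            - (\<integral>z. \<zeta> z * (2 * W 0 z) * ?t1 z * (?g1 z \<bullet> reg_grad 0 \<nu> z) \<partial>lborel)" for \<nu>
  have Llim: "(\<lambda>n. - green_const * (\<integral>z. \<phi> n z \<partial>\<nu>)) \<longlonglongrightarrow> L \<nu>" if "\<nu> = \<mu>1 \<or> \<nu> = \<mu>2" for \<nu>
    using sq(3)[OF _ _ _ that] unfolding L_def \<phi>_def W_def by simp
  have \<phi>nn: "(\<integral>z. \<phi> n z \<partial>\<nu>) \<ge> 0" for n \<nu>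
    by (intro integral_nonneg_AE AE_I2) (simp add: \<phi>_def chi01)
  have Lle: "L \<nu> \<le> 0" if "\<nu> = \<mu>1 \<or> \<nu> = \<mu>2" for \<nu>
    by (rule LIMSEQ_le_const2[OF Llim[OF that]]) (use \<phi>nn green_const_pos in \<open>auto simp: mult_nonneg_nonneg\<close>)
  \<comment> \<open>Pairing each gradient with both measures combines the four terms into 2 \<zeta>
    W (T'(u_2) - T'(u_1)) (\<rho> + c).\<close>
  have "L \<mu>1 + L \<mu>2 = (\<integral>z. \<zeta> z * (2 * W 0 z) * ?t2 z * (?g2 z \<bullet> ?g1 z) - \<zeta> z * (2 * W 0 z) * ?t1 z * (?g1 z \<bullet> ?g1 z)
       + (\<zeta> z * (2 * W 0 z) * ?t2 z * (?g2 z \<bullet> ?g2 z) - \<zeta> z * (2 * W 0 z) * ?t1 z * (?g1 z \<bullet> ?g2 z)) \<partial>lborel)"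
    unfolding L_def using sqi[of \<mu>1] sqi[of \<mu>2] by simp
  also have "\<dots> \<ge> 0"
  proof (rule integral_nonneg_AE)
    show "AE z in lborel. 0 \<le> \<zeta> z * (2 * W 0 z) * ?t2 z * (?g2 z \<bullet> ?g1 z) - \<zeta> z * (2 * W 0 z) * ?t1 z * (?g1 z \<bullet> ?g1 z)
       + (\<zeta> z * (2 * W 0 z) * ?t2 z * (?g2 z \<bullet> ?g2 z) - \<zeta> z * (2 * W 0 z) * ?t1 z * (?g1 z \<bullet> ?g2 z))"
      using norm_eq
    proof eventually_elim
      fix z assume n: "norm (?g1 z) = norm (?g2 z)"
      define \<rho> where "\<rho> = ?g1 z \<bullet> ?g1 z"
      define c where "c = ?g1 z \<bullet> ?g2 z"
      have \<rho>: "?g2 z \<bullet> ?g2 z = \<rho>" using n by (simp add: \<rho>_def power2_norm_eq_inner[symmetric])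
      have "\<bar>c\<bar> \<le> norm (?g1 z) * norm (?g2 z)" unfolding c_def by (rule Cauchy_Schwarz_ineq2)
      also have "\<dots> = \<rho>" using n by (simp add: \<rho>_def power2_norm_eq_inner[symmetric] power2_eq_square)
      finally have 1: "\<rho> + c \<ge> 0" by linarith
      \<comment> \<open>T and T' are nondecreasing, so the differences T(u_2) - T(u_1) and T'(u_2) -
        T'(u_1) carry the same sign.\<close>
      have 2: "W 0 z * (?t2 z - ?t1 z) \<ge> 0"
      proof (cases "reg_pot 0 \<mu>1 z \<le> reg_pot 0 \<mu>2 z")
        case True
        then have "W 0 z \<ge> 0" "?t2 z - ?t1 z \<ge> 0" by (auto simp: W_def trunc_def trunc'_def pos2_def intro!: power_mono)
        then show ?thesis by (rule mult_nonneg_nonneg)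
      next
        case False
        then have "W 0 z \<le> 0" "?t2 z - ?t1 z \<le> 0" by (auto simp: W_def trunc_def trunc'_def pos2_def intro!: power_mono)
        then show ?thesis by (rule mult_nonpos_nonpos)
      qed
      have "0 \<le> \<zeta> z * 2 * ((W 0 z * (?t2 z - ?t1 z)) * (\<rho> + c))"
        using mult_nonneg_nonneg[OF _ mult_nonneg_nonneg[OF 2 1], of "\<zeta> z * 2"] chi01(1)[of z] by simp
      also have "\<dots> = \<zeta> z * (2 * W 0 z) * ?t2 z * (?g2 z \<bullet> ?g1 z) - \<zeta> z * (2 * W 0 z) * ?t1 z * (?g1 z \<bullet> ?g1 z)
       + (\<zeta> z * (2 * W 0 z) * ?t2 z * (?g2 z \<bullet> ?g2 z) - \<zeta> z * (2 * W 0 z) * ?t1 z * (?g1 z \<bullet> ?g2 z))"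
        unfolding \<rho> inner_commute[of "?g2 z" "?g1 z"] c_def[symmetric] \<rho>_def[symmetric] by (simp add: algebra_simps)
      finally show "0 \<le> \<zeta> z * (2 * W 0 z) * ?t2 z * (?g2 z \<bullet> ?g1 z) - \<zeta> z * (2 * W 0 z) * ?t1 z * (?g1 z \<bullet> ?g1 z)
       + (\<zeta> z * (2 * W 0 z) * ?t2 z * (?g2 z \<bullet> ?g2 z) - \<zeta> z * (2 * W 0 z) * ?t1 z * (?g1 z \<bullet> ?g2 z))" .
    qed
  qed
  finally have L0: "L \<nu> = 0" if "\<nu> = \<mu>1 \<or> \<nu> = \<mu>2" for \<nu>
    using Lle[of \<mu>1] Lle[of \<mu>2] that by auto
  have \<phi>lim: "(\<lambda>n. \<integral>z. \<phi> n z \<partial>\<nu>) \<longlonglongrightarrow> 0" if "\<nu> = \<mu>1 \<or> \<nu> = \<mu>2" for \<nu>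
  proof -
    have "(\<lambda>n. (- green_const * (\<integral>z. \<phi> n z \<partial>\<nu>)) / (- green_const)) \<longlonglongrightarrow> 0 / (- green_const)"
      using Llim[OF that] L0[OF that] green_const_pos by (intro tendsto_intros) auto
    then show ?thesis using green_const_pos by simp
  qed
  have \<psi>lim: "(\<lambda>n. \<integral>z. \<psi> n z \<partial>\<nu>) \<longlonglongrightarrow> 0" if \<nu>: "\<nu> = \<mu>1 \<or> \<nu> = \<mu>2" for \<nu>
  proof -
    interpret n: compact_prob \<nu> R0 using \<nu> m1.compact_prob_axioms m2.compact_prob_axioms by auto
    have ps: "prob_space \<nu>" by (rule n.prob_mu)
    text \<open>The quadratic test function controls the linear one by Cauchy--Schwarz, because $\zeta^2 \le \zeta$.\<close>
    have le: "(\<integral>z. \<psi> n z \<partial>\<nu>)\<^sup>2 \<le> (\<integral>z. \<phi> n z \<partial>\<nu>)" for n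
    proof -
      define m where "m = (\<integral>z. \<psi> n z \<partial>\<nu>)"
      have "0 \<le> (\<integral>z. \<phi> n z - 2 * m * \<psi> n z + m\<^sup>2 \<partial>\<nu>)"
      proof (intro integral_nonneg_AE AE_I2)
        fix z
        have "(\<psi> n z)\<^sup>2 \<le> \<phi> n z"
        proof -
          have "(\<zeta> z)\<^sup>2 \<le> \<zeta> z" using chi01[of z] by (simp add: power2_eq_square mult_left_le)
          then show ?thesis unfolding \<psi>_def \<phi>_def power_mult_distrib by (intro mult_right_mono) auto
        qed
        then have "0 \<le> (\<phi> n z - (\<psi> n z)\<^sup>2) + (\<psi> n z - m)\<^sup>2" by simp
        also have "\<dots> = \<phi> n z - 2 * m * \<psi> n z + m\<^sup>2" by (simp add: power2_eq_square algebra_simps)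
        finally show "0 \<le> \<phi> n z - 2 * m * \<psi> n z + m\<^sup>2" .
      qed
      also have "\<dots> = (\<integral>z. \<phi> n z \<partial>\<nu>) - 2 * m * m + m\<^sup>2"
        using int[OF ps n.sets_mu, of n] by (simp add: m_def)
      finally show ?thesis by (simp add: m_def power2_eq_square)
    qed
    have "(\<lambda>n. (\<integral>z. \<psi> n z \<partial>\<nu>)\<^sup>2) \<longlonglongrightarrow> 0"
      by (rule tendsto_sandwich[OF always_eventually always_eventually tendsto_const \<phi>lim[OF \<nu>]]) (use le in simp_all)
    then have "(\<lambda>n. sqrt ((\<integral>z. \<psi> n z \<partial>\<nu>)\<^sup>2)) \<longlonglongrightarrow> sqrt 0" by (rule tendsto_real_sqrt)
    then show ?thesis by (simp add: tendsto_rabs_zero_iff)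
  qed
  define L' where "L' \<nu> = (\<integral>z. \<zeta> z * ?t2 z * (?g2 z \<bullet> reg_grad 0 \<nu> z) \<partial>lborel)
            - (\<integral>z. \<zeta> z * ?t1 z * (?g1 z \<bullet> reg_grad 0 \<nu> z) \<partial>lborel)" for \<nu>
  have L'0: "L' \<nu> = 0" if \<nu>: "\<nu> = \<mu>1 \<or> \<nu> = \<mu>2" for \<nu>
  proof -
    have "(\<lambda>n. - green_const * (\<integral>z. \<psi> n z \<partial>\<nu>)) \<longlonglongrightarrow> L' \<nu>"
      using id(3)[OF _ _ _ that] unfolding L'_def \<psi>_def W_def by simp
    moreover have "(\<lambda>n. - green_const * (\<integral>z. \<psi> n z \<partial>\<nu>)) \<longlonglongrightarrow> - green_const * 0"
      by (intro tendsto_intros \<psi>lim \<nu>)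
    ultimately show ?thesis using LIMSEQ_unique by fastforce
  qed
  \<comment> \<open>Because the gradients have equal length, the four terms combine to \<zeta>
    (T'(u_1) + T'(u_2)) (\<rho> - c), and 2 (\<rho> - c) is |g_1 - g_2|^2.\<close>
  define f where "f z = \<zeta> z * ?t2 z * (?g2 z \<bullet> ?g2 z) - \<zeta> z * ?t1 z * (?g1 z \<bullet> ?g2 z)
       - (\<zeta> z * ?t2 z * (?g2 z \<bullet> ?g1 z) - \<zeta> z * ?t1 z * (?g1 z \<bullet> ?g1 z))" for z
  have fi: "integrable lborel f"
    unfolding f_def using idi[of \<mu>1] idi[of \<mu>2] by simp
  have "(\<integral>z. f z \<partial>lborel) = L' \<mu>2 - L' \<mu>1"
    unfolding f_def L'_def using idi[of \<mu>1] idi[of \<mu>2] by simp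
  then have f0: "(\<integral>z. f z \<partial>lborel) = 0" using L'0 by simp
  have feq: "AE z in lborel. f z = \<zeta> z * ((?t1 z + ?t2 z) * (norm (?g1 z - ?g2 z))\<^sup>2 / 2)"
    using norm_eq
  proof eventually_elim
    fix z assume n: "norm (?g1 z) = norm (?g2 z)"
    define \<rho> where "\<rho> = ?g1 z \<bullet> ?g1 z"
    define c where "c = ?g1 z \<bullet> ?g2 z"
    have \<rho>: "?g2 z \<bullet> ?g2 z = \<rho>" using n by (simp add: \<rho>_def power2_norm_eq_inner[symmetric])
    have nn: "(norm (?g1 z - ?g2 z))\<^sup>2 = 2 * (\<rho> - c)"
      unfolding power2_norm_eq_inner by (simp add: inner_diff_left inner_diff_right \<rho> \<rho>_def[symmetric] c_def[symmetric] inner_commute[of "?g2 z" "?g1 z"])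
    show "f z = \<zeta> z * ((?t1 z + ?t2 z) * (norm (?g1 z - ?g2 z))\<^sup>2 / 2)"
      unfolding nn f_def \<rho> inner_commute[of "?g2 z" "?g1 z"] c_def[symmetric] \<rho>_def[symmetric] by (simp add: algebra_simps)
  qed
  then have "AE z in lborel. 0 \<le> f z"
  proof eventually_elim
    fix z assume eq: "f z = \<zeta> z * ((?t1 z + ?t2 z) * (norm (?g1 z - ?g2 z))\<^sup>2 / 2)"
    show "0 \<le> f z"
      unfolding eq using chi01(1)[of z] tp[of z] by (intro mult_nonneg_nonneg divide_nonneg_pos add_nonneg_nonneg) auto
  qed
  then have "AE z in lborel. f z = 0"
    using integral_nonneg_eq_0_iff_AE[OF fi] f0 by simp
  then show ?thesis using feq
  proof (eventually_elim, intro impI)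
    fix z assume "f z = 0" "f z = \<zeta> z * ((?t1 z + ?t2 z) * (norm (?g1 z - ?g2 z))\<^sup>2 / 2)" "norm z \<le> R0"
    then show "(?t1 z + ?t2 z) * (norm (?g1 z - ?g2 z))\<^sup>2 = 0" using chi1[of z] by simp
  qed
qed

text \<open>The truncation level runs through the naturals: for each point a level above -u_1(z)
  makes the factor T'(u_1) + T'(u_2) positive, so the gradients must agree.\<close>

lemma AE_grad_eq: "AE z in lborel. reg_grad 0 \<mu>1 z = reg_grad 0 \<mu>2 z"
proof -
  have "AE z in lborel. \<forall>M::nat. norm z \<le> R0 \<longrightarrow> (trunc' M 0 \<mu>1 z + trunc' M 0 \<mu>2 z) * (norm (reg_grad 0 \<mu>1 z - reg_grad 0 \<mu>2 z))\<^sup>2 = 0"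
    unfolding AE_all_countable using truncated_grad_eq by blast
  then show ?thesis
  proof eventually_elim
    fix z assume *: "\<forall>M::nat. norm z \<le> R0 \<longrightarrow> (trunc' M 0 \<mu>1 z + trunc' M 0 \<mu>2 z) * (norm (reg_grad 0 \<mu>1 z - reg_grad 0 \<mu>2 z))\<^sup>2 = 0"
    show "reg_grad 0 \<mu>1 z = reg_grad 0 \<mu>2 z"
    proof (cases "norm z \<le> R0")
      case True
      obtain M :: nat where "- reg_pot 0 \<mu>1 z < real M" using reals_Archimedean2 by blast
      then have "trunc' (real M) 0 \<mu>1 z > 0" "trunc' (real M) 0 \<mu>2 z \<ge> 0" by (auto simp: trunc'_def)
      then have "trunc' (real M) 0 \<mu>1 z + trunc' (real M) 0 \<mu>2 z \<noteq> 0" by linarith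
      then show ?thesis using *[rule_format, OF True, of M] by simp
    qed (use grad_eq_outside in simp)
  qed
qed

text \<open>Equal gradients almost everywhere give equal distributional Laplacians, that is, equal
  integrals of all compactly supported C^1 functions.\<close>

lemma measures_eq: "\<mu>1 = \<mu>2"
proof (rule measure_eqI_C1[OF m1.prob_mu m1.sets_mu m2.prob_mu m2.sets_mu])
  fix \<phi> :: "complex \<Rightarrow> real" and G r
  assume d: "\<And>z. (\<phi> has_derivative (\<lambda>h. G z \<bullet> h)) (at z)" "continuous_on UNIV G" "\<And>z. norm z > r \<Longrightarrow> \<phi> z = 0"
  have [measurable]: "G \<in> borel_measurable borel" by (intro borel_measurable_continuous_onI d)
  have "- green_const * (\<integral>\<xi>. \<phi> \<xi> \<partial>\<mu>1) = (\<integral>z. G z \<bullet> reg_grad 0 \<mu>1 z \<partial>lborel)"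
    by (rule m1.green_mu[OF d, symmetric])
  also have "\<dots> = (\<integral>z. G z \<bullet> reg_grad 0 \<mu>2 z \<partial>lborel)"
    by (rule integral_cong_AE) (measurable, use AE_grad_eq in eventually_elim, simp)
  also have "\<dots> = - green_const * (\<integral>\<xi>. \<phi> \<xi> \<partial>\<mu>2)" by (rule m2.green_mu[OF d])
  finally show "(\<integral>\<xi>. \<phi> \<xi> \<partial>\<mu>1) = (\<integral>\<xi>. \<phi> \<xi> \<partial>\<mu>2)" using green_const_pos by simp
qed

end

text \<open>Every larger radius is offered as well, so that two measures can be placed in one common
  disc.\<close>

lemma compact_prob_of_compact:
  assumes "sets \<mu> = sets borel" "prob_space \<mu>" "compact K" "emeasure \<mu> (UNIV - K) = 0"
  obtains r where "\<And>R. r \<le> R \<Longrightarrow> compact_prob \<mu> R"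
proof -
  obtain r where r: "0 < r" "K \<subseteq> cball 0 r" using bounded_subset_ballD[OF compact_imp_bounded[OF assms(3)], of 0] ball_subset_cball by blast
  have "UNIV - K \<in> null_sets \<mu>" using assms compact_imp_closed[of K] by (auto simp: null_sets_def)
  then have "AE \<xi> in \<mu>. \<xi> \<notin> UNIV - K" by (rule AE_not_in)
  then have *: "AE \<xi> in \<mu>. norm \<xi> \<le> r" by eventually_elim (use r in auto)
  show ?thesis
  proof (rule that[of r])
    fix R assume "r \<le> R"
    show "compact_prob \<mu> R"
      by (rule compact_prob.intro) (use assms r \<open>r \<le> R\<close> * in \<open>auto elim: eventually_mono\<close>)
  qed
qed

theorem cauchy_transform_square_unique:
  fixes p q :: "complex poly"
  assumes "p \<noteq> 0" "q \<noteq> 0"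
    and m1: "sets \<mu>1 = sets borel" "prob_space \<mu>1" "compact K1" "emeasure \<mu>1 (UNIV - K1) = 0"
      "AE z in lborel. (cauchy_transform \<mu>1 z)\<^sup>2 = poly p z / poly q z"
    and m2: "sets \<mu>2 = sets borel" "prob_space \<mu>2" "compact K2" "emeasure \<mu>2 (UNIV - K2) = 0"
      "AE z in lborel. (cauchy_transform \<mu>2 z)\<^sup>2 = poly p z / poly q z"
  shows "\<mu>1 = \<mu>2"
proof -
  obtain r1 where r1: "\<And>R. r1 \<le> R \<Longrightarrow> compact_prob \<mu>1 R" using compact_prob_of_compact[OF m1(1-4)] by blast
  obtain r2 where r2: "\<And>R. r2 \<le> R \<Longrightarrow> compact_prob \<mu>2 R" using compact_prob_of_compact[OF m2(1-4)] by blast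
  define R where "R = max r1 r2"
  interpret m1: compact_prob \<mu>1 R by (rule r1) (simp add: R_def)
  interpret m2: compact_prob \<mu>2 R by (rule r2) (simp add: R_def)
  interpret equal_square \<mu>1 \<mu>2 R p q
  proof unfold_locales
    show "p \<noteq> 0" "q \<noteq> 0" by fact+
    show "AE z in lborel. (reg_grad 0 \<mu>1 z)\<^sup>2 = (reg_grad 0 \<mu>2 z)\<^sup>2"
      using m1(5) m2(5) by eventually_elim (simp add: reg_grad_0 flip: complex_cnj_power)
    show "AE z in lborel. (norm (reg_grad 0 \<mu>1 z))\<^sup>2 = norm (poly p z / poly q z)"
      using m1(5)
    proof eventually_elim
      fix z assume "(cauchy_transform \<mu>1 z)\<^sup>2 = poly p z / poly q z"
      then have "norm ((cauchy_transform \<mu>1 z)\<^sup>2) = norm (poly p z / poly q z)" by simp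
      then show "(norm (reg_grad 0 \<mu>1 z))\<^sup>2 = norm (poly p z / poly q z)" by (simp add: reg_grad_0 norm_power)
    qed
  qed
  show ?thesis by (rule measures_eq)
qed

section \<open>Weak compactness of root-counting measures\<close>

lemma binary_expansion:
  fixes x :: real
  assumes "0 \<le> x" "x \<le> 1"
  obtains d :: "nat \<Rightarrow> nat" where "\<And>k. d k \<le> 1" "(\<lambda>k. real (d k) / 2 ^ Suc k) sums x"
proof -
  \<comment> \<open>The remainder after k digits, rescaled to [0,1]. The digit is 1 from 1/2 on, so
    that x = 1 receives digits 1 only.\<close>
  define r where "r = rec_nat x (\<lambda>_ y. 2 * y - (if y \<ge> 1/2 then 1 else 0))"
  define d :: "nat \<Rightarrow> nat" where "d k = (if r k \<ge> 1/2 then 1 else 0)" for k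
  have r0: "r 0 = x" and rS: "r (Suc k) = 2 * r k - real (d k)" for k
    by (auto simp: r_def d_def)
  have rb: "0 \<le> r k \<and> r k \<le> 1" for k
    by (induction k) (use assms in \<open>auto simp: r0 rS d_def\<close>)
  have eq: "(\<Sum>k<n. real (d k) / 2 ^ Suc k) = x - r n / 2 ^ n" for n
    by (induction n) (auto simp: r0 rS field_simps)
  have "(\<lambda>n. r n / 2 ^ n) \<longlonglongrightarrow> 0"
  proof (rule Lim_null_comparison)
    show "eventually (\<lambda>n. norm (r n / 2 ^ n) \<le> (1/2) ^ n) sequentially"
      using rb by (intro always_eventually allI) (auto simp: power_one_over field_simps)
    show "(\<lambda>n. (1/2::real) ^ n) \<longlonglongrightarrow> 0" by (rule LIMSEQ_realpow_zero) auto
  qed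
  then have "(\<lambda>n. x - r n / 2 ^ n) \<longlonglongrightarrow> x - 0" by (intro tendsto_intros)
  then have "(\<lambda>k. real (d k) / 2 ^ Suc k) sums x" unfolding sums_def eq by simp
  then show ?thesis using that[of d] by (simp add: d_def)
qed

text \<open>Schoenberg's auxiliary function, even and 2-periodic, equal to 0 on [0,1/3] and 1 on
  [2/3,1]. Clipping 1/2 - cos(pi x) achieves this because the cosine is 1/2 at pi/3 and -1/2 at 2
  pi/3.\<close>

definition plateau :: "real \<Rightarrow> real" where
  "plateau x = max 0 (min 1 (1/2 - cos (pi * x)))"

lemma plateau_bounds: "0 \<le> plateau x" "plateau x \<le> 1"
  by (auto simp: plateau_def)

lemma continuous_plateau: "continuous_on UNIV plateau"
  unfolding plateau_def[abs_def] by (intro continuous_intros)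

lemma plateau_periodic: "plateau (2 * real n + y) = plateau y"
proof -
  have "cos (pi * (2 * real n + y)) = cos (pi * y + 2 * pi * real n)" by (simp add: algebra_simps)
  also have "\<dots> = cos (pi * y)"
    by (metis cos_int_2pin cos_add sin_int_2pin mult.right_neutral mult_zero_right diff_zero of_int_of_nat_eq mult.assoc)
  finally show ?thesis by (simp add: plateau_def)
qed

lemma plateau_0: "0 \<le> y \<Longrightarrow> y \<le> 1/3 \<Longrightarrow> plateau y = 0"
proof -
  assume "0 \<le> y" "y \<le> 1/3"
  then have "cos (pi / 3) \<le> cos (pi * y)"
    by (intro cos_monotone_0_pi_le) (auto simp: field_simps)
  then show ?thesis by (simp add: plateau_def cos_60)
qed

lemma plateau_1: "2/3 \<le> y \<Longrightarrow> y \<le> 1 \<Longrightarrow> plateau y = 1"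
proof -
  assume y: "2/3 \<le> y" "y \<le> 1"
  then have "cos (pi / 3) \<le> cos (pi * (1 - y))"
    by (intro cos_monotone_0_pi_le) (auto simp: field_simps)
  moreover have "cos (pi * (1 - y)) = - cos (pi * y)" by (simp add: right_diff_distrib cos_diff)
  ultimately show ?thesis by (simp add: plateau_def cos_60)
qed

text \<open>The even and the odd ternary digits of \<open>t\<close> drive the binary digits of the
  real and the imaginary part.\<close>

definition schoenberg :: "real \<Rightarrow> complex" where
  "schoenberg t = Complex (\<Sum>k. plateau (3 ^ (2 * k) * t) / 2 ^ Suc k) (\<Sum>k. plateau (3 ^ (2 * k + 1) * t) / 2 ^ Suc k)"

text \<open>The terms are dominated by the geometric series with sum 1, so the series converges
  uniformly whatever the scaling factors are.\<close>

lemma continuous_plateau_series: "continuous_on UNIV (\<lambda>t. \<Sum>k. plateau (c k * t) / 2 ^ Suc k)"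
  and plateau_series_bounds: "\<bar>\<Sum>k. plateau (c k * t) / 2 ^ Suc k\<bar> \<le> 1"
proof -
  have s: "summable (\<lambda>k. (1/2::real) ^ Suc k)" "(\<Sum>k. (1/2::real) ^ Suc k) = 1"
    using power_half_series by (auto simp: sums_iff)
  have le: "norm (plateau (c k * t) / 2 ^ Suc k) \<le> (1/2) ^ Suc k" for k t
    using plateau_bounds[of "c k * t"] by (simp add: power_one_over divide_right_mono)
  have u: "uniform_limit UNIV (\<lambda>n t. \<Sum>k<n. plateau (c k * t) / 2 ^ Suc k) (\<lambda>t. \<Sum>k. plateau (c k * t) / 2 ^ Suc k) sequentially"
    by (rule Weierstrass_m_test[OF _ s(1)]) (use le in auto)
  show "continuous_on UNIV (\<lambda>t. \<Sum>k. plateau (c k * t) / 2 ^ Suc k)"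
    by (rule uniform_limit_theorem[OF _ u])
       (auto intro!: always_eventually continuous_intros continuous_on_compose2[OF continuous_plateau])
  have "norm (\<Sum>k. plateau (c k * t) / 2 ^ Suc k) \<le> (\<Sum>k. (1/2::real) ^ Suc k)"
    by (rule norm_suminf_le) (use le s in auto)
  then show "\<bar>\<Sum>k. plateau (c k * t) / 2 ^ Suc k\<bar> \<le> 1" using s by simp
qed

lemma continuous_schoenberg: "continuous_on UNIV schoenberg"
proof -
  have eq: "schoenberg = (\<lambda>t. complex_of_real (\<Sum>k. plateau (3 ^ (2 * k) * t) / 2 ^ Suc k) + \<i> * complex_of_real (\<Sum>k. plateau (3 ^ (2 * k + 1) * t) / 2 ^ Suc k))"
    by (simp only: schoenberg_def[abs_def] Complex_eq)
  show ?thesis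
    unfolding eq by (intro continuous_on_add continuous_on_mult continuous_on_const continuous_on_of_real continuous_plateau_series)
qed

lemma norm_schoenberg_le: "norm (schoenberg t) \<le> 2"
  using norm_triangle_mono[OF order_refl order_refl] cmod_le[of "schoenberg t"]
    plateau_series_bounds[of "\<lambda>k. 3 ^ (2 * k)" t] plateau_series_bounds[of "\<lambda>k. 3 ^ (2 * k + 1)" t]
  unfolding schoenberg_def complex.sel by linarith

text \<open>The parameter is the point of the Cantor set whose ternary digits are 2 c_k, where c
  interleaves the binary digits of the two coordinates of \<open>w\<close>. On such points
  \<open>plateau\<close> recovers the digits exactly.\<close>

lemma schoenberg_surj:
  assumes "0 \<le> Re w" "Re w \<le> 1" "0 \<le> Im w" "Im w \<le> 1"
  obtains t where "0 \<le> t" "t \<le> 1" "schoenberg t = w"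
proof -
  obtain a where a: "\<And>k. a k \<le> 1" "(\<lambda>k. real (a k) / 2 ^ Suc k) sums Re w" using binary_expansion assms by blast
  obtain b where b: "\<And>k. b k \<le> 1" "(\<lambda>k. real (b k) / 2 ^ Suc k) sums Im w" using binary_expansion assms by blast
  define c where "c k = (if even k then a (k div 2) else b (k div 2))" for k
  have c: "c k \<le> 1" for k using a b by (simp add: c_def)
  have s3: "summable (\<lambda>k. 2 * (1/3::real) ^ Suc k)" "(\<Sum>k. 2 * (1/3::real) ^ Suc k) = 1"
  proof -
    have "(\<lambda>k. (2/3) * (1/3::real) ^ k) sums ((2/3) * (1 / (1 - 1/3)))"
      by (intro sums_mult geometric_sums) auto
    then have "(\<lambda>k. 2 * (1/3::real) ^ Suc k) sums 1" by simp
    then show "summable (\<lambda>k. 2 * (1/3::real) ^ Suc k)" "(\<Sum>k. 2 * (1/3::real) ^ Suc k) = 1" by (auto simp: sums_iff)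
  qed
  \<comment> \<open>The tail of the ternary expansion from digit m on. By 3 Y_m = 2 c_m + Y_(m+1) it
    lies in [0,1/3] or [2/3,1] according to c_m.\<close>
  define Y where "Y m = (\<Sum>k. 2 * real (c (m + k)) / 3 ^ Suc k)" for m
  have le: "2 * real (c (m + k)) / 3 ^ Suc k \<le> 2 * (1/3) ^ Suc k" for m k
    using c[of "m + k"] by (simp add: power_one_over divide_right_mono)
  have sY: "summable (\<lambda>k. 2 * real (c (m + k)) / 3 ^ Suc k)" for m
    by (rule summable_comparison_test[OF _ s3(1)]) (use le in auto)
  have Y01: "0 \<le> Y m" "Y m \<le> 1" for m
  proof -
    show "0 \<le> Y m" unfolding Y_def by (rule suminf_nonneg[OF sY]) auto
    have "Y m \<le> (\<Sum>k. 2 * (1/3::real) ^ Suc k)" unfolding Y_def by (rule suminf_le[OF le sY s3(1)])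
    then show "Y m \<le> 1" using s3 by simp
  qed
  have Yrec: "3 * Y m = 2 * real (c m) + Y (Suc m)" for m
  proof -
    have "Y m = (\<Sum>k. 2 * real (c (m + Suc k)) / 3 ^ Suc (Suc k)) + 2 * real (c (m + 0)) / 3 ^ Suc 0"
      unfolding Y_def using suminf_split_head[OF sY[of m]] by simp
    also have "(\<Sum>k. 2 * real (c (m + Suc k)) / 3 ^ Suc (Suc k)) = (\<Sum>k. (1/3) * (2 * real (c (Suc m + k)) / 3 ^ Suc k))"
      by (intro suminf_cong) simp
    also have "\<dots> = (1/3) * Y (Suc m)" unfolding Y_def by (rule suminf_mult[OF sY])
    finally show ?thesis by simp
  qed
  \<comment> \<open>All ternary digits are even, so shifting by m places changes the tail by an even
    integer, a multiple of the period of \<open>plateau\<close>.\<close>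
  have ex: "\<exists>N. 3 ^ m * Y 0 = 2 * real N + Y m" for m
  proof (induction m)
    case (Suc m)
    then obtain N where "3 ^ m * Y 0 = 2 * real N + Y m" by blast
    then have "3 ^ Suc m * Y 0 = 2 * real (3 * N + c m) + Y (Suc m)" using Yrec[of m] by simp
    then show ?case by blast
  qed (auto intro: exI[of _ 0])
  have pl: "plateau (3 ^ m * Y 0) = real (c m)" for m
  proof -
    obtain N where "3 ^ m * Y 0 = 2 * real N + Y m" using ex by blast
    then have eq: "plateau (3 ^ m * Y 0) = plateau (Y m)" by (simp add: plateau_periodic)
    have "c m = 0 \<or> c m = 1" using c[of m] by linarith
    then show ?thesis
    proof
      assume "c m = 0"
      then show ?thesis using eq Yrec[of m] Y01[of m] Y01[of "Suc m"] by (simp add: plateau_0)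
    next
      assume "c m = 1"
      then show ?thesis using eq Yrec[of m] Y01[of m] Y01[of "Suc m"] by (simp add: plateau_1)
    qed
  qed
  have "schoenberg (Y 0) = w"
  proof -
    have "c (2 * k) = a k" "c (2 * k + 1) = b k" for k by (auto simp: c_def)
    then have "schoenberg (Y 0) = Complex (\<Sum>k. real (a k) / 2 ^ Suc k) (\<Sum>k. real (b k) / 2 ^ Suc k)"
      unfolding schoenberg_def pl by simp
    then show ?thesis using a(2) b(2) by (simp add: sums_iff complex_eq_iff)
  qed
  then show ?thesis using that Y01[of 0] by blast
qed

text \<open>The curve filling the unit square is moved to the square of side 2R centred at 0. Since
  its norm is at most 2, the affine image has norm at most (4 + 2) R; this is where the radius 6R of
  the limit measures comes from.\<close>

lemma curve_covering_disc:
  assumes R: "R > 0"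
  obtains \<Phi> :: "real \<Rightarrow> complex" where "continuous_on UNIV \<Phi>" "\<And>t. norm (\<Phi> t) \<le> 6 * R"
    "\<And>w. norm w \<le> R \<Longrightarrow> \<exists>t. 0 \<le> t \<and> t \<le> 1 \<and> \<Phi> t = w"
proof -
  define \<Phi> where "\<Phi> t = of_real R * (2 * schoenberg t - Complex 1 1)" for t
  show ?thesis
  proof (rule that[of \<Phi>])
    show "continuous_on UNIV \<Phi>" unfolding \<Phi>_def by (intro continuous_intros continuous_schoenberg)
    show "norm (\<Phi> t) \<le> 6 * R" for t
    proof -
      have "norm (2 * schoenberg t - Complex 1 1) \<le> norm (2 * schoenberg t) + norm (Complex 1 1)" by (rule norm_triangle_ineq4)
      also have "\<dots> \<le> 4 + 2" using norm_schoenberg_le[of t] cmod_le[of "Complex 1 1"] by (intro add_mono) (auto simp: norm_mult)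
      finally show ?thesis using R by (simp add: \<Phi>_def norm_mult)
    qed
    fix w :: complex assume w: "norm w \<le> R"
    define v where "v = Complex ((1 + Re w / R) / 2) ((1 + Im w / R) / 2)"
    have "\<bar>Re w\<bar> \<le> R" "\<bar>Im w\<bar> \<le> R" using w abs_Re_le_cmod[of w] abs_Im_le_cmod[of w] by linarith+
    then have "-1 \<le> Re w / R" "Re w / R \<le> 1" "-1 \<le> Im w / R" "Im w / R \<le> 1" using R by (auto simp: field_simps abs_le_iff)
    then obtain t where t: "0 \<le> t" "t \<le> 1" "schoenberg t = v"
      using schoenberg_surj[of v] by (auto simp: v_def)
    have "2 * Re (schoenberg t) - 1 = Re w / R" "2 * Im (schoenberg t) - 1 = Im w / R" using R by (simp_all add: t v_def field_simps)
    then have "\<Phi> t = w" using R by (simp add: \<Phi>_def complex_eq_iff)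
    then show "\<exists>t. 0 \<le> t \<and> t \<le> 1 \<and> \<Phi> t = w" using t by blast
  qed
qed

text \<open>A curve covering the disc reduces the compactness of planar measures to Helly's selection theorem on the line.\<close>

lemma empirical_measures_convergent_subseq:
  fixes z :: "nat \<Rightarrow> nat \<Rightarrow> complex"
  assumes N: "\<And>n. N n > 0" and zR: "\<And>n i. i < N n \<Longrightarrow> norm (z n i) \<le> R" and R: "R > 0"
  obtains r \<mu> where "strict_mono (r :: nat \<Rightarrow> nat)" "prob_space \<mu>" "sets \<mu> = sets borel" "AE \<xi> in \<mu>. norm \<xi> \<le> 6 * R"
    "\<And>f :: complex \<Rightarrow> 'b::{banach, second_countable_topology}. continuous_on UNIV f \<Longrightarrow> bounded (range f) \<Longrightarrow>
       (\<lambda>k. (\<Sum>i<N (r k). f (z (r k) i)) /\<^sub>R real (N (r k))) \<longlonglongrightarrow> (\<integral>\<xi>. f \<xi> \<partial>\<mu>)"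
proof -
  obtain \<Phi> :: "real \<Rightarrow> complex" where \<Phi>: "continuous_on UNIV \<Phi>" "\<And>t. norm (\<Phi> t) \<le> 6 * R"
    "\<And>w. norm w \<le> R \<Longrightarrow> \<exists>t. 0 \<le> t \<and> t \<le> 1 \<and> \<Phi> t = w" using curve_covering_disc[OF R] by blast
  \<comment> \<open>Each point is lifted to a parameter on the curve. The uniform distribution on
    these parameters is a measure on the line whose image under \<open>\<Phi>\<close> is the
    empirical measure of the points.\<close>
  define t where "t n i = (SOME t. 0 \<le> t \<and> t \<le> 1 \<and> \<Phi> t = z n i)" for n i
  have t: "0 \<le> t n i \<and> t n i \<le> 1 \<and> \<Phi> (t n i) = z n i" if "i < N n" for n i
    unfolding t_def by (rule someI_ex[OF \<Phi>(3)[OF zR[OF that]]])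
  have \<Phi>m [measurable]: "\<Phi> \<in> borel_measurable borel" by (intro borel_measurable_continuous_onI \<Phi>)
  define p where "p n = pmf_of_set {..<N n}" for n
  have sp: "set_pmf (p n) = {..<N n}" for n unfolding p_def using N[of n] by (intro set_pmf_of_set) auto
  define M where "M n = distr (measure_pmf (p n)) borel (t n)" for n
  have rd: "real_distribution (M n)" for n
    unfolding M_def by (intro prob_space.real_distribution_distr[OF prob_space_measure_pmf]) simp
  have intM: "(\<integral>x. f x \<partial>M n) = (\<Sum>i<N n. f (t n i)) /\<^sub>R real (N n)"
    if "f \<in> borel_measurable borel" for n and f :: "real \<Rightarrow> 'c::{banach, second_countable_topology}"
  proof -
    have "(\<integral>x. f x \<partial>M n) = (\<integral>i. f (t n i) \<partial>measure_pmf (p n))"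
      unfolding M_def by (rule integral_distr) (use that in auto)
    also have "\<dots> = (\<Sum>i<N n. pmf (p n) i *\<^sub>R f (t n i))"
      by (rule integral_measure_pmf) (use sp in auto)
    also have "\<dots> = (\<Sum>i<N n. (1 / real (N n)) *\<^sub>R f (t n i))"
    proof (intro sum.cong refl)
      fix i assume "i \<in> {..<N n}"
      moreover have "{..<N n} \<noteq> {}" using N[of n] by auto
      ultimately show "pmf (p n) i *\<^sub>R f (t n i) = (1 / real (N n)) *\<^sub>R f (t n i)"
        unfolding p_def by (simp add: pmf_of_set)
    qed
    finally show ?thesis by (simp add: scaleR_sum_right[symmetric] divide_inverse)
  qed
  have tight: "tight M"
    unfolding tight_def
  proof (intro conjI allI impI rd)
    fix \<epsilon> :: real assume "\<epsilon> > 0"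
    \<comment> \<open>The parameters lie in [0,1]; the left end is moved to -1 because tightness is
      phrased with intervals open on the left.\<close>
    have "measure (M n) {-1<..1} = 1" for n
    proof -
      interpret real_distribution "M n" by (rule rd)
      have "AE x in M n. x \<in> {-1<..1}"
        unfolding M_def by (subst AE_distr_iff) (use t sp in \<open>fastforce simp: AE_measure_pmf_iff\<close>)+
      then show ?thesis using prob_eq_1[of "{-1<..1}"] by simp
    qed
    then show "\<exists>a b. a < b \<and> (\<forall>n. 1 - \<epsilon> < measure (M n) {a<..b})"
      using \<open>\<epsilon> > 0\<close> by (intro exI[of _ "-1"] exI[of _ 1]) auto
  qed
  obtain r M' where r: "strict_mono r" "real_distribution M'" "weak_conv_m (M \<circ> id \<circ> r) M'"
    using tight_imp_convergent_subsubsequence[OF tight strict_mono_id] by blast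
  interpret M': real_distribution M' by (rule r(2))
  have Mb: "borel_measurable M' = (borel_measurable borel :: (real \<Rightarrow> 'c::topological_space) set)" by (rule measurable_cong_sets) simp_all
  \<comment> \<open>Weak convergence on the line passes to the plane, since \<open>f\<close>
    composed with the continuous curve is again bounded and continuous.\<close>
  define \<mu> where "\<mu> = distr M' borel \<Phi>"
  show ?thesis
  proof (rule that[OF r(1), of \<mu>])
    show "prob_space \<mu>" unfolding \<mu>_def by (rule M'.prob_space_distr) simp
    show "sets \<mu> = sets borel" by (simp add: \<mu>_def)
    show "AE \<xi> in \<mu>. norm \<xi> \<le> 6 * R" unfolding \<mu>_def by (subst AE_distr_iff) (use \<Phi> in auto)
    fix f :: "complex \<Rightarrow> 'b::{banach, second_countable_topology}" assume f: "continuous_on UNIV f" "bounded (range f)"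
    have fm [measurable]: "f \<in> borel_measurable borel" by (intro borel_measurable_continuous_onI f)
    obtain B where B: "\<And>x. norm (f x) \<le> B" using f(2) by (auto simp: bounded_iff)
    have c: "continuous_on UNIV (\<lambda>x. f (\<Phi> x))" by (rule continuous_on_compose2[OF f(1) \<Phi>(1)]) auto
    have "(\<lambda>k. \<integral>x. f (\<Phi> x) \<partial>((M \<circ> id \<circ> r) k)) \<longlonglongrightarrow> (\<integral>x. f (\<Phi> x) \<partial>M')"
      by (rule weak_conv_imp_integral_bdd_continuous_conv[OF _ r(2,3), of _ B])
         (use rd B c in \<open>auto simp: continuous_on_eq_continuous_at\<close>)
    moreover have "(\<integral>x. f (\<Phi> x) \<partial>((M \<circ> id \<circ> r) k)) = (\<Sum>i<N (r k). f (z (r k) i)) /\<^sub>R real (N (r k))" for k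
    proof -
      have "(\<Sum>i<N (r k). f (\<Phi> (t (r k) i))) = (\<Sum>i<N (r k). f (z (r k) i))" using t by (intro sum.cong) auto
      then show ?thesis by (simp add: intM)
    qed
    moreover have "(\<integral>x. f (\<Phi> x) \<partial>M') = (\<integral>\<xi>. f \<xi> \<partial>\<mu>)" unfolding \<mu>_def by (subst integral_distr) auto
    ultimately show "(\<lambda>k. (\<Sum>i<N (r k). f (z (r k) i)) /\<^sub>R real (N (r k))) \<longlonglongrightarrow> (\<integral>\<xi>. f \<xi> \<partial>\<mu>)" by simp
  qed
qed

section \<open>Polynomial solutions of the differential equation\<close>

text \<open>With the logarithmic derivative \<sigma> = T'/T one has T''/T = \<sigma>^2 + \<sigma>'.
  Dividing the differential equation by its solution turns it into the Riccati equation.\<close>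

lemma poly_pderiv_prod_roots:
  fixes a :: "'i \<Rightarrow> complex" and w :: complex
  assumes "finite I" "\<And>i. i \<in> I \<Longrightarrow> w \<noteq> a i"
  defines "T \<equiv> \<Prod>i\<in>I. [:- a i, 1:]"
  shows "poly (pderiv T) w = poly T w * (\<Sum>i\<in>I. 1 / (w - a i))"
    and "poly (pderiv (pderiv T)) w = poly T w * ((\<Sum>i\<in>I. 1 / (w - a i))\<^sup>2 - (\<Sum>i\<in>I. 1 / (w - a i)\<^sup>2))"
proof -
  have "poly (pderiv T) w = poly T w * (\<Sum>i\<in>I. 1 / (w - a i)) \<and>
     poly (pderiv (pderiv T)) w = poly T w * ((\<Sum>i\<in>I. 1 / (w - a i))\<^sup>2 - (\<Sum>i\<in>I. 1 / (w - a i)\<^sup>2))"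
    unfolding T_def using assms(1,2)
  proof (induction I rule: finite_induct)
    case (insert j J)
    let ?T = "\<Prod>i\<in>J. [:- a i, 1:]"
    define s where "s = (\<Sum>i\<in>J. 1 / (w - a i))"
    define s2 where "s2 = (\<Sum>i\<in>J. 1 / (w - a i)\<^sup>2)"
    define y where "y = w - a j"
    have y: "y \<noteq> 0" using insert.prems by (auto simp: y_def)
    have IH: "poly (pderiv ?T) w = poly ?T w * s" "poly (pderiv (pderiv ?T)) w = poly ?T w * (s\<^sup>2 - s2)"
      using insert by (auto simp: s_def s2_def)
    have eq: "(\<Prod>i\<in>insert j J. [:- a i, 1:]) = [:- a j, 1:] * ?T" using insert.hyps by simp
    have p0: "poly [:- a j, 1:] w = y" by (simp add: y_def)
    have p1: "pderiv [:- a j, 1:] = 1" by (simp add: pderiv_pCons)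
    have 1: "poly (pderiv ([:- a j, 1:] * ?T)) w = y * poly (pderiv ?T) w + poly ?T w"
      by (simp only: pderiv_mult p1 poly_add poly_mult p0 mult_1_right mult_1_left)
    have 2: "poly (pderiv (pderiv ([:- a j, 1:] * ?T))) w = y * poly (pderiv (pderiv ?T)) w + 2 * poly (pderiv ?T) w"
      by (simp only: pderiv_mult p1 pderiv_add pderiv_1 poly_add poly_mult p0 mult_1_right mult_1_left) simp
    have s': "(\<Sum>i\<in>insert j J. 1 / (w - a i)) = 1 / y + s" "(\<Sum>i\<in>insert j J. 1 / (w - a i)\<^sup>2) = 1 / y\<^sup>2 + s2"
      using insert.hyps by (simp_all add: s_def s2_def y_def)
    have p: "poly ([:- a j, 1:] * ?T) w = y * poly ?T w" by (simp only: poly_mult p0)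
    show ?case
      unfolding eq 1 2 IH s' p using y by (auto simp: field_simps power2_eq_square)
  qed simp
  then show "poly (pderiv T) w = poly T w * (\<Sum>i\<in>I. 1 / (w - a i))"
    "poly (pderiv (pderiv T)) w = poly T w * ((\<Sum>i\<in>I. 1 / (w - a i))\<^sup>2 - (\<Sum>i\<in>I. 1 / (w - a i)\<^sup>2))" by auto
qed

lemma complex_poly_roots_list:
  fixes p :: "complex poly"
  assumes "p \<noteq> 0"
  obtains z where "p = smult (lead_coeff p) (\<Prod>i<degree p. [:- z i, 1:])"
proof -
  obtain A where A: "size A = degree p" "p = smult (lead_coeff p) (\<Prod>x\<in>#A. [:-x, 1:])"
    using alg_closed_imp_factorization[OF assms] by blast
  obtain xs where xs: "mset xs = A" using ex_mset by blast
  have "(\<Prod>x\<in>#A. [:-x, 1:]) = (\<Prod>x\<leftarrow>xs. [:-x, 1:])" unfolding xs[symmetric] mset_map[symmetric] prod_mset_prod_list ..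
  also have "\<dots> = (\<Prod>i<length xs. [:- (xs ! i), 1:])"
    by (subst prod.list_conv_set_nth) (simp add: atLeast0LessThan)
  also have "length xs = degree p" using A(1) xs by auto
  finally show ?thesis using A(2) that[of "\<lambda>i. xs ! i"] by simp
qed

text \<open>A \<open>measure_of\<close> construction has the intended values only for a countably
  additive set function. Identifying it with the image of the uniform distribution on root indices
  supplies this, and repeated indices account for multiplicities.\<close>

lemma root_counting_measure_eq_distr:
  fixes z :: "nat \<Rightarrow> complex"
  assumes S: "S = smult c (\<Prod>i<n. [:- z i, 1:])" "c \<noteq> 0" "n > 0"
  shows "root_counting_measure S = distr (measure_pmf (pmf_of_set {..<n})) borel z"
proof -
  have nz: "(\<Prod>i<n. [:- z i, 1:]) \<noteq> 0" by (simp add: prod_zero_iff)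
  have S0: "S \<noteq> 0" using S nz by simp
  have deg: "degree S = n" using S by (simp add: degree_prod_eq_sum_degree)
  have pr: "proots S = (\<Sum>i<n. {#z i#})"
    unfolding S(1) proots_smult[OF S(2)] by (subst proots_prod) auto
  have ord: "real (order a S) = (\<Sum>i<n. if z i = a then 1 else 0)" for a
    using count_proots[OF S0, of a] unfolding pr by (simp add: count_sum sum.If_cases if_distrib cong: if_cong)
  define p where "p = pmf_of_set {..<n}"
  have ne: "{..<n} \<noteq> {}" using S(3) by auto
  define M where "M = distr (measure_pmf p) borel z"
  have eM: "emeasure M A = ennreal ((\<Sum>w\<in>{w. poly S w = 0} \<inter> A. real (order w S)) / real (degree S))" if A: "A \<in> sets borel" for A
  proof -
    have fin: "finite {w. poly S w = 0}" using S0 by (rule poly_roots_finite)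
    have "(\<Sum>w\<in>{w. poly S w = 0} \<inter> A. real (order w S)) = (\<Sum>w\<in>{w. poly S w = 0} \<inter> A. \<Sum>i<n. if z i = w then 1 else 0)"
      by (simp add: ord)
    also have "\<dots> = (\<Sum>i<n. \<Sum>w\<in>{w. poly S w = 0} \<inter> A. if z i = w then 1 else 0)" by (rule sum.swap)
    also have "\<dots> = (\<Sum>i<n. if z i \<in> A then 1 else 0)"
    proof (intro sum.cong refl)
      fix i assume i: "i \<in> {..<n}"
      have "poly S (z i) = 0" using i unfolding S(1) by (auto simp: poly_prod prod_zero_iff)
      then show "(\<Sum>w\<in>{w. poly S w = 0} \<inter> A. if z i = w then 1 else 0) = (if z i \<in> A then 1 else (0::real))"
        using fin by (simp add: sum.delta)
    qed
    also have "\<dots> = real (card ({..<n} \<inter> z -` A))" by (simp add: sum.If_cases Int_def)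
    finally have eq: "(\<Sum>w\<in>{w. poly S w = 0} \<inter> A. real (order w S)) = real (card ({..<n} \<inter> z -` A))" .
    have "emeasure M A = emeasure (measure_pmf p) (z -` A)"
      unfolding M_def using A by (subst emeasure_distr) auto
    also have "\<dots> = ennreal (real (card ({..<n} \<inter> z -` A)) / real n)"
      unfolding p_def using ne by (subst emeasure_pmf_of_set) (auto simp: ennreal_of_nat_eq_real_of_nat divide_ennreal S(3))
    finally show ?thesis by (simp add: eq deg)
  qed
  have sb: "sigma_sets UNIV (sets borel) = (sets borel :: complex set set)"
    using sets.sigma_sets_eq[of "borel :: complex measure"] by simp
  have "root_counting_measure S = measure_of UNIV (sets borel) (emeasure M)"
    unfolding root_counting_measure_def
    by (rule measure_of_eq) (simp_all add: sb eM)
  also have "\<dots> = measure_of (space M) (sets M) (emeasure M)" by (simp add: M_def)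
  also have "\<dots> = M" by (rule measure_of_of_measure)
  finally show ?thesis by (simp add: M_def p_def)
qed

lemma root_counting_measure_integral:
  fixes f :: "complex \<Rightarrow> 'b::{banach, second_countable_topology}"
  assumes S: "S = smult c (\<Prod>i<n. [:- z i, 1:])" "c \<noteq> 0" "n > 0" and f: "f \<in> borel_measurable borel"
  shows "(\<integral>x. f x \<partial>root_counting_measure S) = (\<Sum>i<n. f (z i)) /\<^sub>R real n"
proof -
  have ne: "{..<n} \<noteq> {}" using S(3) by (auto simp: lessThan_empty_iff)
  have "(\<integral>x. f x \<partial>root_counting_measure S) = (\<integral>i. f (z i) \<partial>measure_pmf (pmf_of_set {..<n}))"
    unfolding root_counting_measure_eq_distr[OF S] by (rule integral_distr) (use f in auto)
  also have "\<dots> = (\<Sum>i<n. pmf (pmf_of_set {..<n}) i *\<^sub>R f (z i))"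
    by (rule integral_measure_pmf) (use ne in auto)
  also have "\<dots> = (\<Sum>i<n. (1 / real n) *\<^sub>R f (z i))"
    using ne by (intro sum.cong refl) (simp add: pmf_of_set)
  finally show ?thesis by (simp add: scaleR_sum_right[symmetric] divide_inverse)
qed

section \<open>Size of the coefficient V and location of the roots\<close>

lemma coeff_mult_top:
  fixes p q :: "'a::comm_semiring_1 poly"
  assumes "degree p \<le> a" "degree q \<le> b"
  shows "coeff (p * q) (a + b) = coeff p a * coeff q b"
proof -
  have "coeff (p * q) (a + b) = (\<Sum>i\<le>a + b. coeff p i * coeff q (a + b - i))" by (rule coeff_mult)
  also have "\<dots> = (\<Sum>i\<in>{a}. coeff p i * coeff q (a + b - i))"
  proof (rule sum.mono_neutral_right)
    show "\<forall>i\<in>{..a + b} - {a}. coeff p i * coeff q (a + b - i) = 0"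
    proof
      fix i assume "i \<in> {..a + b} - {a}"
      then have "i > a \<or> a + b - i > b" by auto
      then show "coeff p i * coeff q (a + b - i) = 0" using assms by (auto simp: coeff_eq_0)
    qed
  qed auto
  finally show ?thesis by simp
qed

text \<open>Comparison of the coefficients of z^(n+1) in the equation. It shows that the leading
  coefficient is asymptotic to -n^2, so V/n^2 converges to minus the limit of the monic
  normalisations.\<close>

lemma lead_coeff_van_vleck:
  fixes Q P V S :: "complex poly"
  assumes "degree Q = 3" "lead_coeff Q = 1" "degree P \<le> 2" "degree V = 1" "degree S = n" "n \<ge> 2"
    and ode: "Q * pderiv (pderiv S) + P * pderiv S + V * S = 0"
  shows "lead_coeff V = - (of_nat n * of_nat (n - 1) + coeff P 2 * of_nat n)"
proof -
  have n: "Suc (Suc (n - 2)) = n" "Suc (n - 1) = n" "Suc (n - 2) = n - 1" using assms by auto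
  have d: "degree (pderiv S) \<le> n - 1" "degree (pderiv (pderiv S)) \<le> n - 2"
    using assms by (auto simp: degree_pderiv)
  have S0: "lead_coeff S \<noteq> 0" using assms by auto
  have "coeff (Q * pderiv (pderiv S)) (3 + (n - 2)) = coeff Q 3 * coeff (pderiv (pderiv S)) (n - 2)"
    by (rule coeff_mult_top) (use assms d in auto)
  also have "coeff (pderiv (pderiv S)) (n - 2) = of_nat (n - 1) * (of_nat n * coeff S n)"
    unfolding coeff_pderiv n ..
  finally have eq: "coeff (Q * pderiv (pderiv S)) (3 + (n - 2)) = coeff Q 3 * (of_nat (n - 1) * (of_nat n * coeff S n))" .
  have 1: "coeff (Q * pderiv (pderiv S)) (n + 1) = of_nat n * of_nat (n - 1) * lead_coeff S"
  proof -
    have "3 + (n - 2) = n + 1" using assms by auto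
    then show ?thesis using eq assms by simp
  qed
  have "coeff (P * pderiv S) (2 + (n - 1)) = coeff P 2 * coeff (pderiv S) (n - 1)"
    by (rule coeff_mult_top) (use assms d in auto)
  moreover have "2 + (n - 1) = n + 1" using assms by auto
  ultimately have 2: "coeff (P * pderiv S) (n + 1) = coeff P 2 * of_nat n * lead_coeff S"
    unfolding coeff_pderiv n using assms by simp
  have 3: "coeff (V * S) (n + 1) = lead_coeff V * lead_coeff S"
    using coeff_mult_top[of V 1 S n] assms by (simp add: add.commute)
  have "coeff (Q * pderiv (pderiv S) + P * pderiv S + V * S) (n + 1) = 0" by (simp add: ode)
  then have "(of_nat n * of_nat (n - 1) + coeff P 2 * of_nat n + lead_coeff V) * lead_coeff S = 0"
    unfolding coeff_add 1 2 3 by (simp add: algebra_simps)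
  then have "of_nat n * of_nat (n - 1) + coeff P 2 * of_nat n + lead_coeff V = 0" using S0 by simp
  then show ?thesis by (metis add.commute add_eq_0_iff)
qed

lemma poly_eq_sum_le:
  fixes p :: "'a::comm_semiring_1 poly"
  assumes "degree p \<le> k"
  shows "poly p x = (\<Sum>i\<le>k. coeff p i * x ^ i)"
  unfolding poly_altdef
  by (rule sum.mono_neutral_left) (use assms in \<open>auto simp: coeff_eq_0\<close>)

text \<open>The degree of z P is at most that of Q, so the quotient is bounded away from the roots
  of Q.\<close>

lemma cubic_dominates:
  fixes Q P :: "complex poly"
  assumes "degree Q = 3" "lead_coeff Q = 1" "degree P \<le> 2"
  obtains R M where "R > 0" "\<And>z. norm z \<ge> R \<Longrightarrow> poly Q z \<noteq> 0" "\<And>z. norm z \<ge> R \<Longrightarrow> norm (z * poly P z) \<le> M * norm (poly Q z)"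
proof -
  define A where "A = norm (coeff Q 0) + norm (coeff Q 1) + norm (coeff Q 2)"
  define B where "B = norm (coeff P 0) + norm (coeff P 1) + norm (coeff P 2)"
  \<comment> \<open>For |z| \<ge> 1 the lower terms of Q are at most A |z|^2, and |z| \<ge> 2A makes
    this at most half of |z|^3.\<close>
  define R where "R = 1 + 2 * A"
  have A: "A \<ge> 0" and B: "B \<ge> 0" by (auto simp: A_def B_def)
  have Q: "(norm z)^3 / 2 \<le> norm (poly Q z)" and P: "norm (z * poly P z) \<le> B * (norm z)^3" if z: "norm z \<ge> R" for z
  proof -
    have z1: "norm z \<ge> 1" "2 * A \<le> norm z" using z A by (auto simp: R_def)
    have c3: "coeff Q 3 = 1" using assms by simp
    have "poly Q z = z^3 + (coeff Q 0 + coeff Q 1 * z + coeff Q 2 * z\<^sup>2)"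
      using poly_eq_sum_le[of Q 3 z] assms c3 by (simp add: eval_nat_numeral algebra_simps)
    then have "norm (z^3) - norm (coeff Q 0 + coeff Q 1 * z + coeff Q 2 * z\<^sup>2) \<le> norm (poly Q z)"
      by (metis norm_diff_ineq)
    moreover have low: "norm (c0 + c1 * z + c2 * z\<^sup>2) \<le> (norm c0 + norm c1 + norm c2) * (norm z)\<^sup>2" for c0 c1 c2
    proof -
      have m: "1 \<le> (norm z)\<^sup>2" "norm z \<le> (norm z)\<^sup>2" using z1 by (auto intro: one_le_power self_le_power)
      have "norm (c0 + c1 * z + c2 * z\<^sup>2) \<le> norm c0 + norm c1 * norm z + norm c2 * (norm z)\<^sup>2"
        by (intro order.trans[OF norm_triangle_ineq] add_mono order_refl) (auto simp: norm_mult norm_power)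
      also have "\<dots> \<le> norm c0 * (norm z)\<^sup>2 + norm c1 * (norm z)\<^sup>2 + norm c2 * (norm z)\<^sup>2"
        using m mult_left_mono[OF m(1), of "norm c0"] by (intro add_mono mult_left_mono) auto
      finally show ?thesis by (simp add: algebra_simps)
    qed
    moreover have "A * (norm z)\<^sup>2 \<le> (norm z)^3 / 2"
      using mult_right_mono[OF z1(2), of "(norm z)\<^sup>2"] by (simp add: eval_nat_numeral)
    ultimately show "(norm z)^3 / 2 \<le> norm (poly Q z)"
      using low[of "coeff Q 0" "coeff Q 1" "coeff Q 2"] unfolding A_def[symmetric] norm_power by linarith
    have "poly P z = coeff P 0 + coeff P 1 * z + coeff P 2 * z\<^sup>2"
      using poly_eq_sum_le[OF assms(3), of z] by (simp add: eval_nat_numeral algebra_simps)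
    then have "norm (poly P z) \<le> B * (norm z)\<^sup>2" using low unfolding B_def by simp
    then have "norm z * norm (poly P z) \<le> norm z * (B * (norm z)\<^sup>2)" by (rule mult_left_mono) simp
    then show "norm (z * poly P z) \<le> B * (norm z)^3" by (simp add: norm_mult eval_nat_numeral mult_ac)
  qed
  show ?thesis
  proof (rule that[of R "2 * B"])
    show "R > 0" using A by (simp add: R_def)
    fix z :: complex assume z: "norm z \<ge> R"
    then have "norm z > 0" using \<open>R > 0\<close> by linarith
    then have "(norm z)^3 / 2 > 0" by simp
    then show "poly Q z \<noteq> 0" using Q[OF z] by auto
    have "B * (norm z)^3 \<le> B * (2 * norm (poly Q z))" using Q[OF z] B by (intro mult_left_mono) auto
    then show "norm (z * poly P z) \<le> 2 * B * norm (poly Q z)" using P[OF z] by simp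
  qed
qed

text \<open>At a root of order m \<ge> 2 where Q does not vanish, Q S'' vanishes to order exactly m
  - 2, but it equals -(P S' + V S), which vanishes to order at least m - 1.\<close>

lemma ode_root_simple:
  fixes Q P V S :: "complex poly"
  assumes "Q * pderiv (pderiv S) + P * pderiv S + V * S = 0" "poly Q a \<noteq> 0" "degree S \<ge> 2"
  shows "order a S \<le> 1"
proof (rule ccontr)
  assume "\<not> order a S \<le> 1"
  define m where "m = order a S"
  have m: "m \<ge> 2" using \<open>\<not> order a S \<le> 1\<close> by (simp add: m_def)
  have d: "degree (pderiv S) = degree S - 1" "degree (pderiv (pderiv S)) = degree S - 2" by (simp_all add: degree_pderiv)
  have p1: "pderiv S \<noteq> 0" using d(1) assms(3) by auto
  have p2: "pderiv (pderiv S) \<noteq> 0" using assms(3) by (subst pderiv_eq_0_iff) (simp add: degree_pderiv)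
  have S0: "S \<noteq> 0" using assms(3) by auto
  have root: "poly f a = 0" if "order a f \<noteq> 0" for f :: "complex poly" using that by (simp add: order_root)
  have "order a S = Suc (order a (pderiv S))" by (intro order_pderiv S0 root) (use m m_def in linarith)
  then have o1: "order a (pderiv S) = m - 1" by (simp add: m_def)
  have "order a (pderiv S) = Suc (order a (pderiv (pderiv S)))" by (intro order_pderiv p1 root) (use m o1 in linarith)
  then have o2: "order a (pderiv (pderiv S)) = m - 2" using o1 by linarith
  have Q0: "Q \<noteq> 0" using assms(2) by auto
  have "[:- a, 1:] ^ (m - 1) dvd pderiv S" using order_1[of a "pderiv S"] by (simp only: o1)
  moreover have "[:- a, 1:] ^ (m - 1) dvd S"
    using order_1[of a S] le_imp_power_dvd[of "m - 1" m "[:- a, 1:]"] dvd_trans by (force simp: m_def)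
  ultimately have "[:- a, 1:] ^ (m - 1) dvd - (P * pderiv S + V * S)" by (simp only: dvd_minus_iff dvd_add dvd_mult)
  also have "- (P * pderiv S + V * S) = Q * pderiv (pderiv S)" by (intro minus_unique) (use assms(1) in \<open>simp add: algebra_simps\<close>)
  finally have dv: "[:- a, 1:] ^ (m - 1) dvd Q * pderiv (pderiv S)" .
  have nz: "Q * pderiv (pderiv S) \<noteq> 0" using Q0 p2 by simp
  have "m - 1 \<le> order a (Q * pderiv (pderiv S))" using dv nz unfolding order_divides by blast
  moreover have "order a (Q * pderiv (pderiv S)) = m - 2"
    unfolding order_mult[OF nz] o2 order_0I[OF assms(2)] by simp
  ultimately show False using m by simp
qed

text \<open>The map b/a to 1/(1 - b/a) sends the closed unit disc, without the point 1, into the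
  half plane Re \<ge> 1/2.\<close>

lemma inverse_diff_half_plane:
  fixes a b :: complex
  assumes "norm b \<le> norm a" "a \<noteq> b"
  shows "Re (a * (1 / (a - b))) \<ge> 1/2"
proof -
  have n: "(norm (a - b))\<^sup>2 > 0" using assms by simp
  have "(norm b)\<^sup>2 \<le> (norm a)\<^sup>2" using assms(1) by (intro power_mono) auto
  then have "(norm (a - b))\<^sup>2 \<le> 2 * Re (a * cnj (a - b))"
    unfolding cmod_power2 by (simp add: power2_eq_square algebra_simps)
  then have "1/2 \<le> Re (a * cnj (a - b)) / (norm (a - b))\<^sup>2" using n by (simp add: field_simps)
  also have "\<dots> = Re (a * (1 / (a - b)))"
    by (simp add: complex_div_cnj[of 1 "a - b"] del: complex_cnj_diff)
  finally show ?thesis .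
qed

text \<open>At a simple root \<open>a\<close> the term with V drops out, so the estimate does not
  see V. What remains is 2 Q(a) \<sigma> + P(a) = 0 with \<sigma> the sum of 1/(a - z_j) over the
  other roots. If \<open>a\<close> has maximal modulus, each of the n - 1 summands of a \<sigma> has
  real part at least 1/2, so the relation forces n - 1 \<le> M.\<close>

lemma ode_roots_bounded:
  fixes Q P :: "complex poly"
  assumes "degree Q = 3" "lead_coeff Q = 1" "degree P \<le> 2"
  obtains R n0 where "R > 0" "\<And>V S w. Q * pderiv (pderiv S) + P * pderiv S + V * S = 0 \<Longrightarrow> degree S \<ge> n0 \<Longrightarrow> poly S w = 0 \<Longrightarrow> norm w \<le> R"
proof -
  obtain R M where R: "R > 0" "\<And>z. norm z \<ge> R \<Longrightarrow> poly Q z \<noteq> 0" "\<And>z. norm z \<ge> R \<Longrightarrow> norm (z * poly P z) \<le> M * norm (poly Q z)"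
    using cubic_dominates[OF assms] by blast
  \<comment> \<open>Chosen so that n \<ge> n0 gives n - 1 > M.\<close>
  obtain n0 :: nat where n0: "M + 2 < real n0" using reals_Archimedean2 by blast
  show ?thesis
  proof (rule that[of R "max n0 2"], fact, rule ccontr)
    fix V S w assume ode: "Q * pderiv (pderiv S) + P * pderiv S + V * S = 0" and deg: "max n0 2 \<le> degree S"
      and w: "poly S w = 0" "\<not> norm w \<le> R"
    define n where "n = degree S"
    have n: "n \<ge> 2" "n \<ge> n0" using deg by (auto simp: n_def)
    have S0: "S \<noteq> 0" using deg by auto
    obtain z where z: "S = smult (lead_coeff S) (\<Prod>i<n. [:- z i, 1:])" using complex_poly_roots_list[OF S0] n_def by blast
    have c: "lead_coeff S \<noteq> 0" using S0 by simp
    have roots: "poly S x = 0 \<longleftrightarrow> (\<exists>i<n. z i = x)" for x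
      by (subst z) (use c in \<open>auto simp: poly_prod prod_zero_iff\<close>)
    have "\<exists>i\<in>{..<n}. \<forall>j\<in>{..<n}. norm (z j) \<le> norm (z i)"
    proof -
      have ne: "(\<lambda>i. norm (z i)) ` {..<n} \<noteq> {}" using n by (auto simp: lessThan_empty_iff)
      have "Max ((\<lambda>i. norm (z i)) ` {..<n}) \<in> (\<lambda>i. norm (z i)) ` {..<n}" by (rule Max_in) (use ne in auto)
      then obtain i where i: "i < n" "Max ((\<lambda>i. norm (z i)) ` {..<n}) = norm (z i)" by auto
      then show ?thesis by (intro bexI[of _ i]) (auto simp flip: i(2))
    qed
    then obtain i where i: "i < n" "\<And>j. j < n \<Longrightarrow> norm (z j) \<le> norm (z i)" by auto
    define a where "a = z i"
    obtain k where "k < n" "z k = w" using w roots by blast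
    then have aR: "norm a \<ge> R" using i(2)[of k] w(2) by (simp add: a_def)
    have Qa: "poly Q a \<noteq> 0" by (rule R(2)[OF aR])
    \<comment> \<open>Writing S = c (z - a) T gives S'(a) = c T(a) and S''(a) = 2 c T'(a), hence
      S''(a)/S'(a) = 2 T'(a)/T(a).\<close>
    define T where "T = (\<Prod>j\<in>{..<n} - {i}. [:- z j, 1:])"
    have ST: "S = smult (lead_coeff S) ([:- a, 1:] * T)"
      by (subst z) (use i in \<open>simp add: T_def a_def prod.remove[of "{..<n}" i]\<close>)
    have Ta: "poly T a \<noteq> 0"
    proof
      assume "poly T a = 0"
      then have "[:- a, 1:] dvd T" by (simp add: poly_eq_0_iff_dvd)
      then have "[:- a, 1:] ^ 2 dvd [:- a, 1:] * T" unfolding power2_eq_square by (rule mult_dvd_mono[OF dvd_refl])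
      then have "[:- a, 1:] ^ 2 dvd S" by (subst ST) (rule dvd_smult)
      then have "2 \<le> order a S" using S0 order_divides[of a 2 S] by simp
      moreover have "order a S \<le> 1" by (rule ode_root_simple[OF ode Qa]) (use n n_def in auto)
      ultimately show False by simp
    qed
    have za: "a \<noteq> z j" if "j \<in> {..<n} - {i}" for j
    proof
      assume "a = z j"
      then have "poly T a = 0" unfolding T_def using that by (auto simp: poly_prod prod_zero_iff)
      then show False using Ta by simp
    qed
    have p0: "poly [:- a, 1:] a = 0" by simp
    have p1: "pderiv [:- a, 1:] = 1" by (simp add: pderiv_pCons)
    have 1: "poly (pderiv S) a = lead_coeff S * poly T a"
      by (subst ST) (simp only: pderiv_smult pderiv_mult p1 poly_smult poly_add poly_mult p0 mult_zero_left mult_1_right add_0)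
    have 2: "poly (pderiv (pderiv S)) a = lead_coeff S * (2 * poly (pderiv T) a)"
      by (subst ST) (simp only: pderiv_smult pderiv_mult p1 pderiv_add pderiv_1 poly_smult poly_add poly_mult p0 mult_zero_left mult_1_right add_0, simp)
    define \<sigma> where "\<sigma> = (\<Sum>j\<in>{..<n} - {i}. 1 / (a - z j))"
    have dT: "poly (pderiv T) a = poly T a * \<sigma>"
      unfolding T_def \<sigma>_def by (rule poly_pderiv_prod_roots(1)) (use za in auto)
    have "poly S a = 0" using roots i a_def by blast
    then have "poly Q a * poly (pderiv (pderiv S)) a + poly P a * poly (pderiv S) a = 0"
      using arg_cong[OF ode, of "\<lambda>p. poly p a"] by simp
    then have "(lead_coeff S * poly T a) * (2 * poly Q a * \<sigma> + poly P a) = 0"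
      unfolding 1 2 dT by (simp add: algebra_simps)
    then have "2 * poly Q a * \<sigma> + poly P a = 0" using c Ta by simp
    then have "poly P a = - (2 * poly Q a * \<sigma>)" by (metis add.commute add_eq_0_iff)
    then have "norm (a * poly P a) = norm (poly Q a) * (2 * norm (a * \<sigma>))" by (simp add: norm_mult mult_ac)
    moreover have "2 * norm (a * \<sigma>) \<ge> real (n - 1)"
    proof -
      have "real (n - 1) / 2 = (\<Sum>j\<in>{..<n} - {i}. 1/2)" using i by simp
      also have "\<dots> \<le> (\<Sum>j\<in>{..<n} - {i}. Re (a * (1 / (a - z j))))"
        by (intro sum_mono inverse_diff_half_plane) (use za i in \<open>auto simp: a_def\<close>)
      also have "\<dots> = Re (a * \<sigma>)" unfolding \<sigma>_def by (simp only: sum_distrib_left Re_sum)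
      also have "\<dots> \<le> norm (a * \<sigma>)" by (rule complex_Re_le_cmod)
      finally show ?thesis by simp
    qed
    ultimately have "norm (poly Q a) * real (n - 1) \<le> norm (poly Q a) * M"
      using R(3)[OF aR] mult_left_mono[of "real (n - 1)" "2 * norm (a * \<sigma>)" "norm (poly Q a)"] by (simp add: mult.commute)
    then have "real (n - 1) \<le> M" using Qa by simp
    then show False using n n0 by linarith
  qed
qed

section \<open>Passage to the limit\<close>

lemma compact_prob_root_counting_measure:
  fixes z :: "nat \<Rightarrow> complex"
  assumes S: "S = smult c (\<Prod>i<n. [:- z i, 1:])" "c \<noteq> 0" "n > 0"
    and R: "\<And>i. i < n \<Longrightarrow> norm (z i) \<le> R" "0 \<le> R"
  shows "compact_prob (root_counting_measure S) R"
proof (rule compact_prob.intro)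
  note eq = root_counting_measure_eq_distr[OF S]
  show "sets (root_counting_measure S) = sets borel" by (simp add: eq)
  show "prob_space (root_counting_measure S)"
    unfolding eq by (intro prob_space.prob_space_distr[OF prob_space_measure_pmf]) simp
  have ne: "{..<n} \<noteq> {}" using S(3) by (auto simp: lessThan_empty_iff)
  show "AE \<xi> in root_counting_measure S. norm \<xi> \<le> R"
    unfolding eq by (subst AE_distr_iff) (use R(1) ne in \<open>auto simp: AE_measure_pmf_iff\<close>)
qed fact

lemma norm_reg_kernel_le_inverse: "e > 0 \<Longrightarrow> norm (reg_kernel e z) \<le> 1 / e"
proof -
  assume e: "e > 0"
  have "2 * (norm z * e) \<le> (norm z)\<^sup>2 + e\<^sup>2" using sum_squares_bound[of "norm z" e] by simp
  moreover have "0 \<le> norm z * e" using e by simp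
  ultimately have "norm z * e \<le> (norm z)\<^sup>2 + e\<^sup>2" by linarith
  moreover have "(norm z)\<^sup>2 + e\<^sup>2 > 0" using e by (simp add: add_nonneg_pos)
  ultimately show ?thesis using e by (simp add: norm_reg_kernel divide_simps)
qed

text \<open>The weighted estimate is used with its weight at the origin: on the disc of radius r one
  has 1 \<le> sqrt r |z|^(-1/2).\<close>

lemma (in compact_prob) nn_integral_reg_grad_diff:
  assumes e: "e > 0" and r: "r > 0"
  shows "(\<integral>\<^sup>+z. ennreal (norm (reg_grad e \<mu> z - reg_grad 0 \<mu> z)) * indicator (cball 0 r) z \<partial>lborel)
     \<le> ennreal (sqrt r * (e powr (1/4) * (2 * riesz_const (7/4) (r + 2 * R0))))"
proof -
  let ?d = "\<lambda>z. norm (reg_grad e \<mu> z - reg_grad 0 \<mu> z)"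
  have "(\<integral>\<^sup>+z. ennreal (?d z) * indicator (cball 0 r) z \<partial>lborel)
     \<le> (\<integral>\<^sup>+z. ennreal (sqrt r) * (ennreal (?d z * norm (z - 0) powr - (1/2)) * indicator (cball 0 r) z) \<partial>lborel)"
  proof (rule nn_integral_mono_AE)
    show "AE z in lborel. ennreal (?d z) * indicator (cball 0 r) z \<le> ennreal (sqrt r) * (ennreal (?d z * norm (z - 0) powr - (1/2)) * indicator (cball 0 r) z)"
      using AE_lborel_singleton[of 0]
    proof eventually_elim
      fix z :: complex assume z: "z \<noteq> 0"
      show "ennreal (?d z) * indicator (cball 0 r) z \<le> ennreal (sqrt r) * (ennreal (?d z * norm (z - 0) powr - (1/2)) * indicator (cball 0 r) z)"
      proof (cases "norm z \<le> r")
        case True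
        have "1 \<le> sqrt r * norm z powr - (1/2)"
          using z True by (simp add: powr_minus_divide powr_half_sqrt)
        then have "?d z * 1 \<le> ?d z * (sqrt r * norm z powr - (1/2))" by (intro mult_left_mono) auto
        then have "ennreal (?d z) \<le> ennreal (sqrt r * (?d z * norm (z - 0) powr - (1/2)))"
          by (intro ennreal_leI) (simp add: mult_ac)
        also have "\<dots> = ennreal (sqrt r) * ennreal (?d z * norm (z - 0) powr - (1/2))"
          using r by (intro ennreal_mult) auto
        finally show ?thesis using True by simp
      qed simp
    qed
  qed
  also have "\<dots> = ennreal (sqrt r) * (\<integral>\<^sup>+z. ennreal (?d z * norm (z - 0) powr - (1/2)) * indicator (cball 0 r) z \<partial>lborel)"
    by (rule nn_integral_cmult) measurable
  also have "\<dots> \<le> ennreal (sqrt r) * ennreal (e powr (1/4) * (2 * riesz_const (7/4) (r + 2 * R0)))"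
    by (intro mult_left_mono nn_integral_reg_grad_diff_weighted e r) (use R0_nonneg in auto)
  also have "\<dots> = ennreal (sqrt r * (e powr (1/4) * (2 * riesz_const (7/4) (r + 2 * R0))))"
    using r by (intro ennreal_mult[symmetric]) auto
  finally show ?thesis .
qed

text \<open>For fixed e > 0 the kernel is bounded and continuous, so weak convergence gives
  pointwise convergence of the gradients with the majorant 2/e. The error of replacing e by 0 is
  small uniformly in k, because all measures live in one disc.\<close>

lemma reg_grad_tendsto_L1:
  assumes \<nu>: "\<And>k. compact_prob (\<nu> k) R" and \<mu>: "compact_prob \<mu> R" and r: "r > 0"
    and weak: "\<And>f :: complex \<Rightarrow> complex. continuous_on UNIV f \<Longrightarrow> bounded (range f) \<Longrightarrow> (\<lambda>k. \<integral>\<xi>. f \<xi> \<partial>\<nu> k) \<longlonglongrightarrow> (\<integral>\<xi>. f \<xi> \<partial>\<mu>)"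
  shows "(\<lambda>k. \<integral>\<^sup>+z. ennreal (norm (reg_grad 0 (\<nu> k) z - reg_grad 0 \<mu> z)) * indicator (cball 0 r) z \<partial>lborel) \<longlonglongrightarrow> 0"
proof -
  interpret m: compact_prob \<mu> R by (rule \<mu>)
  have nm [measurable]: "reg_grad e (\<nu> k) \<in> borel_measurable borel" for e k
    by (rule compact_prob.measurable_reg_grad[OF \<nu>])
  define K where "K e = sqrt r * (e powr (1/4) * (2 * riesz_const (7/4) (r + 2 * R)))" for e
  define I where "I k = (\<integral>\<^sup>+z. ennreal (norm (reg_grad 0 (\<nu> k) z - reg_grad 0 \<mu> z)) * indicator (cball 0 r) z \<partial>lborel)" for k
  define J where "J e k = (\<integral>\<^sup>+z. ennreal (norm (reg_grad e (\<nu> k) z - reg_grad e \<mu> z)) * indicator (cball 0 r) z \<partial>lborel)" for e k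
  have K0: "K e \<ge> 0" for e using r by (simp add: K_def)
  have IJ: "I k \<le> J e k + ennreal (2 * K e)" if e: "e > 0" for e k
  proof -
    have "I k \<le> (\<integral>\<^sup>+z. (ennreal (norm (reg_grad e (\<nu> k) z - reg_grad e \<mu> z)) * indicator (cball 0 r) z
         + ennreal (norm (reg_grad e (\<nu> k) z - reg_grad 0 (\<nu> k) z)) * indicator (cball 0 r) z)
         + ennreal (norm (reg_grad e \<mu> z - reg_grad 0 \<mu> z)) * indicator (cball 0 r) z \<partial>lborel)"
      unfolding I_def
    proof (intro nn_integral_mono)
      fix z
      have "norm (reg_grad 0 (\<nu> k) z - reg_grad 0 \<mu> z) \<le> norm (reg_grad e (\<nu> k) z - reg_grad e \<mu> z)
          + norm (reg_grad e (\<nu> k) z - reg_grad 0 (\<nu> k) z) + norm (reg_grad e \<mu> z - reg_grad 0 \<mu> z)"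
        by norm
      then show "ennreal (norm (reg_grad 0 (\<nu> k) z - reg_grad 0 \<mu> z)) * indicator (cball 0 r) z \<le>
         (ennreal (norm (reg_grad e (\<nu> k) z - reg_grad e \<mu> z)) * indicator (cball 0 r) z
         + ennreal (norm (reg_grad e (\<nu> k) z - reg_grad 0 (\<nu> k) z)) * indicator (cball 0 r) z)
         + ennreal (norm (reg_grad e \<mu> z - reg_grad 0 \<mu> z)) * indicator (cball 0 r) z"
        by (cases "z \<in> cball 0 r") (simp_all flip: ennreal_plus add: ennreal_leI)
    qed
    also have "\<dots> = (J e k + (\<integral>\<^sup>+z. ennreal (norm (reg_grad e (\<nu> k) z - reg_grad 0 (\<nu> k) z)) * indicator (cball 0 r) z \<partial>lborel))
         + (\<integral>\<^sup>+z. ennreal (norm (reg_grad e \<mu> z - reg_grad 0 \<mu> z)) * indicator (cball 0 r) z \<partial>lborel)"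
      unfolding J_def by (subst nn_integral_add, measurable)+
    also have "\<dots> \<le> (J e k + ennreal (K e)) + ennreal (K e)"
      unfolding K_def by (intro add_mono order_refl compact_prob.nn_integral_reg_grad_diff \<nu> \<mu> e r)
    also have "\<dots> = J e k + ennreal (2 * K e)"
      using K0[of e] by (simp add: add.assoc flip: ennreal_plus)
    finally show ?thesis .
  qed
  have J0: "(\<lambda>k. J e k) \<longlonglongrightarrow> 0" if e: "e > 0" for e
  proof -
    have "(\<lambda>k. J e k) \<longlonglongrightarrow> (\<integral>\<^sup>+(z::complex). 0 \<partial>lborel)"
      unfolding J_def
    proof (rule nn_integral_dominated_convergence[where w = "\<lambda>z. ennreal (2 / e) * indicator (cball 0 r) z"])
      have bd: "norm (reg_grad e \<tau> z) \<le> 1 / e" if "compact_prob \<tau> R" for \<tau> z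
        unfolding reg_grad_def
        by (rule compact_prob.integral_norm_bound_on_support[OF that]) (measurable, rule norm_reg_kernel_le_inverse[OF e])
      show "AE z in lborel. ennreal (norm (reg_grad e (\<nu> k) z - reg_grad e \<mu> z)) * indicator (cball 0 r) z \<le> ennreal (2 / e) * indicator (cball 0 r) z" for k
      proof (intro AE_I2 mult_right_mono ennreal_leI)
        fix z
        show "norm (reg_grad e (\<nu> k) z - reg_grad e \<mu> z) \<le> 2 / e"
          using norm_triangle_ineq4[of "reg_grad e (\<nu> k) z" "reg_grad e \<mu> z"] bd[OF \<nu>, of k z] bd[OF \<mu>, of z] by simp
      qed simp
      have "(\<integral>\<^sup>+(z::complex). ennreal (2 / e) * indicator (cball 0 r) z \<partial>lborel) = ennreal (2 / e) * emeasure lborel (cball (0::complex) r)"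
        by (rule nn_integral_cmult_indicator) simp
      also have "\<dots> < \<infinity>" using emeasure_bounded_finite[of "cball (0::complex) r"] by (simp add: ennreal_mult_less_top)
      finally show "(\<integral>\<^sup>+(z::complex). ennreal (2 / e) * indicator (cball 0 r) z \<partial>lborel) < \<infinity>" .
      show "AE z in lborel. (\<lambda>k. ennreal (norm (reg_grad e (\<nu> k) z - reg_grad e \<mu> z)) * indicator (cball 0 r) z) \<longlonglongrightarrow> 0"
      proof (intro AE_I2)
        fix z
        have ck: "continuous_on UNIV (\<lambda>\<xi>. reg_kernel e (z - \<xi>))"
          unfolding reg_kernel_def using e by (intro continuous_intros) (simp add: add_nonneg_eq_0_iff)
        have "(\<lambda>k. reg_grad e (\<nu> k) z) \<longlonglongrightarrow> reg_grad e \<mu> z"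
          unfolding reg_grad_def
          by (rule weak[OF ck]) (auto simp: bounded_iff intro!: exI[of _ "1 / e"] norm_reg_kernel_le_inverse e)
        then have "(\<lambda>k. norm (reg_grad e (\<nu> k) z - reg_grad e \<mu> z) * indicator (cball 0 r) z) \<longlonglongrightarrow> norm (reg_grad e \<mu> z - reg_grad e \<mu> z) * indicator (cball 0 r) z"
          by (intro tendsto_intros)
        then have "(\<lambda>k. norm (reg_grad e (\<nu> k) z - reg_grad e \<mu> z) * indicator (cball 0 r) z) \<longlonglongrightarrow> 0" by simp
        from tendsto_ennrealI[OF this]
        show "(\<lambda>k. ennreal (norm (reg_grad e (\<nu> k) z - reg_grad e \<mu> z)) * indicator (cball 0 r) z) \<longlonglongrightarrow> 0"
          by (simp add: ennreal_mult'' ennreal_indicator)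
      qed
    qed measurable
    then show ?thesis by simp
  qed
  have Kl: "(\<lambda>n. 2 * K (eps n)) \<longlonglongrightarrow> 0"
  proof -
    have "(\<lambda>n. eps n powr (1/4)) \<longlonglongrightarrow> 0"
      by (rule tendsto_zero_powrI[OF LIMSEQ_inverse_real_of_nat tendsto_const]) auto
    then have "(\<lambda>n. 2 * (sqrt r * (eps n powr (1/4) * (2 * riesz_const (7/4) (r + 2 * R))))) \<longlonglongrightarrow> 2 * (sqrt r * (0 * (2 * riesz_const (7/4) (r + 2 * R))))"
      by (intro tendsto_intros)
    then show ?thesis by (simp add: K_def)
  qed
  have "I \<longlonglongrightarrow> 0"
  proof (rule order_tendstoI)
    fix a :: ennreal assume a: "0 < a"
    obtain b where b: "0 < b" "ennreal b < a"
    proof -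
      obtain b' where b': "0 < b'" "b' < a" using a dense by blast
      then have "b' < top" using less_top_ennreal order.strict_trans2 top_greatest by (metis order.strict_implies_not_eq not_top_less top.not_eq_extremum)
      then have "b' = ennreal (enn2real b')" by simp
      then show ?thesis using b' that[of "enn2real b'"] by (metis enn2real_positive_iff \<open>b' < top\<close>)
    qed
    \<comment> \<open>The regularisation parameter is fixed first, from the uniform error; the index
      k is made large afterwards.\<close>
    have "eventually (\<lambda>n. 2 * K (eps n) < b / 2) sequentially" using b by (intro order_tendstoD(2)[OF Kl]) simp
    then obtain n where n: "2 * K (eps n) < b / 2" by (auto simp: eventually_sequentially)
    have "eventually (\<lambda>k. J (eps n) k < ennreal (b / 2)) sequentially"
      using b by (intro order_tendstoD(2)[OF J0[OF eps_pos]]) simp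
    then show "eventually (\<lambda>k. I k < a) sequentially"
    proof eventually_elim
      fix k assume "J (eps n) k < ennreal (b / 2)"
      have "I k \<le> J (eps n) k + ennreal (2 * K (eps n))" by (rule IJ[OF eps_pos])
      also have "\<dots> \<le> ennreal (b / 2) + ennreal (b / 2)"
        using n \<open>J (eps n) k < ennreal (b / 2)\<close> by (intro add_mono ennreal_leI) auto
      also have "\<dots> = ennreal b" using b by (simp flip: ennreal_plus)
      also note b(2)
      finally show "I k < a" .
    qed
  qed simp
  then show ?thesis unfolding I_def .
qed

text \<open>For s \<le> 1 the power s - 1 is nonpositive, so (x + y)^s = x (x + y)^(s-1) + y (x +
  y)^(s-1) \<le> x^s + y^s.\<close>

lemma powr_sum_le:
  fixes f :: "'i \<Rightarrow> real"
  assumes "finite A" "\<And>i. i \<in> A \<Longrightarrow> 0 \<le> f i" "0 \<le> s" "s \<le> 1"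
  shows "(\<Sum>i\<in>A. f i) powr s \<le> (\<Sum>i\<in>A. f i powr s)"
  using assms(1,2)
proof (induction A rule: finite_induct)
  case (insert j A)
  have add: "(x + y) powr s \<le> x powr s + y powr s" if "0 \<le> x" "0 \<le> y" for x y :: real
  proof (cases "x = 0 \<or> y = 0")
    case False
    then have p: "x > 0" "y > 0" using that by auto
    have "(x + y) powr s = (x + y) powr 1 * (x + y) powr (s - 1)" by (subst powr_add[symmetric]) simp
    also have "\<dots> = x * (x + y) powr (s - 1) + y * (x + y) powr (s - 1)" using p by (simp add: algebra_simps)
    also have "\<dots> \<le> x * x powr (s - 1) + y * y powr (s - 1)"
      using p assms by (intro add_mono mult_left_mono powr_mono2') auto
    also have "\<dots> = x powr 1 * x powr (s - 1) + y powr 1 * y powr (s - 1)" using p by simp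
    also have "\<dots> = x powr s + y powr s" by (simp only: powr_add[symmetric]) simp
    finally show ?thesis .
  qed auto
  have "(f j + (\<Sum>i\<in>A. f i)) powr s \<le> f j powr s + (\<Sum>i\<in>A. f i) powr s"
    using insert.prems by (intro add sum_nonneg) auto
  also have "\<dots> \<le> f j powr s + (\<Sum>i\<in>A. f i powr s)" using insert by simp
  finally show ?case using insert.hyps by simp
qed simp

text \<open>The derivative of the Cauchy transform is not locally integrable, but its $3/4$-th power is, with a
  bound that is subadditive in the roots; this beats the factor $1/n$ in the Riccati equation.\<close>

lemma nn_integral_inverse_square_sum_powr:
  fixes z :: "nat \<Rightarrow> complex"
  assumes n: "n > 0" and R: "\<And>i. i < n \<Longrightarrow> norm (z i) \<le> R" "0 \<le> R" and r: "r > 0"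
  shows "(\<integral>\<^sup>+w. ennreal (((\<Sum>i<n. norm (w - z i) powr - 2) / (real n)\<^sup>2) powr (3/4)) * indicator (cball 0 r) w \<partial>lborel)
     \<le> ennreal (riesz_const (3/2) (r + 2 * R) * real n powr - (1/2))"
proof -
  have nn: "real n > 0" using n by simp
  have le: "((\<Sum>i<n. norm (w - z i) powr - 2) / (real n)\<^sup>2) powr (3/4) \<le> real n powr - (3/2) * (\<Sum>i<n. norm (w - z i) powr - (3/2))" for w
  proof -
    have "((\<Sum>i<n. norm (w - z i) powr - 2) / (real n)\<^sup>2) powr (3/4) = (\<Sum>i<n. norm (w - z i) powr - 2) powr (3/4) / ((real n)\<^sup>2) powr (3/4)"
      by (intro powr_divide sum_nonneg; simp)
    also have "((real n)\<^sup>2) powr (3/4) = real n powr (3/2)"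
    proof -
      have "(real n)\<^sup>2 = real n powr 2" using nn by simp
      then show ?thesis by (simp only: powr_powr) simp
    qed
    also have "(\<Sum>i<n. norm (w - z i) powr - 2) powr (3/4) / real n powr (3/2) \<le> (\<Sum>i<n. (norm (w - z i) powr - 2) powr (3/4)) / real n powr (3/2)"
      by (intro divide_right_mono powr_sum_le) auto
    also have "\<dots> = real n powr - (3/2) * (\<Sum>i<n. norm (w - z i) powr - (3/2))"
    proof -
      have "(norm (w - z i) powr - 2) powr (3/4) = norm (w - z i) powr - (3/2)" for i
        by (simp only: powr_powr) simp
      then show ?thesis by (simp only: powr_minus_divide[of "real n"] divide_inverse mult_1_left mult.commute)
    qed
    finally show ?thesis .
  qed
  have "(\<integral>\<^sup>+w. ennreal (((\<Sum>i<n. norm (w - z i) powr - 2) / (real n)\<^sup>2) powr (3/4)) * indicator (cball 0 r) w \<partial>lborel)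
     \<le> (\<integral>\<^sup>+w. ennreal (real n powr - (3/2)) * (\<Sum>i<n. ennreal (norm (w - z i) powr - (3/2)) * indicator (cball 0 r) w) \<partial>lborel)"
  proof (intro nn_integral_mono)
    fix w
    have "ennreal (((\<Sum>i<n. norm (w - z i) powr - 2) / (real n)\<^sup>2) powr (3/4)) * indicator (cball 0 r) w
       \<le> ennreal (real n powr - (3/2) * (\<Sum>i<n. norm (w - z i) powr - (3/2))) * indicator (cball 0 r) w"
      by (intro mult_right_mono ennreal_leI le) simp
    also have "\<dots> = ennreal (real n powr - (3/2)) * (\<Sum>i<n. ennreal (norm (w - z i) powr - (3/2)) * indicator (cball 0 r) w)"
    proof -
      have 1: "ennreal (\<Sum>i<n. norm (w - z i) powr - (3/2)) = (\<Sum>i<n. ennreal (norm (w - z i) powr - (3/2)))"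
        by (rule sum_ennreal[symmetric]) simp
      have "ennreal (real n powr - (3/2) * (\<Sum>i<n. norm (w - z i) powr - (3/2))) = ennreal (real n powr - (3/2)) * ennreal (\<Sum>i<n. norm (w - z i) powr - (3/2))"
        by (intro ennreal_mult sum_nonneg; simp)
      then show ?thesis unfolding 1 by (simp only: mult.assoc sum_distrib_right)
    qed
    finally show "ennreal (((\<Sum>i<n. norm (w - z i) powr - 2) / (real n)\<^sup>2) powr (3/4)) * indicator (cball 0 r) w
       \<le> ennreal (real n powr - (3/2)) * (\<Sum>i<n. ennreal (norm (w - z i) powr - (3/2)) * indicator (cball 0 r) w)" .
  qed
  also have "\<dots> = ennreal (real n powr - (3/2)) * (\<integral>\<^sup>+w. (\<Sum>i<n. ennreal (norm (w - z i) powr - (3/2)) * indicator (cball 0 r) w) \<partial>lborel)"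
    by (rule nn_integral_cmult) measurable
  also have "(\<integral>\<^sup>+w. (\<Sum>i<n. ennreal (norm (w - z i) powr - (3/2)) * indicator (cball 0 r) w) \<partial>lborel)
      = (\<Sum>i<n. \<integral>\<^sup>+w. ennreal (norm (w - z i) powr - (3/2)) * indicator (cball 0 r) w \<partial>lborel)"
    by (rule nn_integral_sum) measurable
  also have "ennreal (real n powr - (3/2)) * \<dots> \<le> ennreal (real n powr - (3/2)) * (\<Sum>i<n. ennreal (riesz_const (3/2) (r + 2 * R)))"
    by (intro mult_left_mono sum_mono nn_integral_norm_powr_cball') (use R r in auto)
  also have "\<dots> = ennreal (real n powr - (3/2) * (real n * riesz_const (3/2) (r + 2 * R)))"
    by (simp add: ennreal_mult ennreal_of_nat_eq_real_of_nat)
  \<comment> \<open>The factor n^(-3/2) comes from the square of n to the power 3/4; the n equal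
    bounds in the sum cost one power of n, and n^(-1/2) remains.\<close>
  also have "real n powr - (3/2) * (real n * riesz_const (3/2) (r + 2 * R)) = riesz_const (3/2) (r + 2 * R) * (real n powr - (3/2) * real n powr 1)"
    using nn by simp
  also have "real n powr - (3/2) * real n powr 1 = real n powr - (1/2)" by (subst powr_add[symmetric]) simp
  finally show ?thesis .
qed

text \<open>The convergence is first established in the mean on each disc, then made pointwise along
  a subsequence. The subsequence may depend on the disc, since the limit identity mentions only
  \<open>\<mu>\<close>.\<close>

lemma limit_square_eq:
  fixes Q P Vt :: "complex poly" and V S :: "nat \<Rightarrow> complex poly" and z :: "nat \<Rightarrow> nat \<Rightarrow> complex" and N :: "nat \<Rightarrow> nat"
  assumes Q: "Q \<noteq> 0"
    and N: "\<And>k. N k > 0" "filterlim N at_top sequentially"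
    and S: "\<And>k. S k = smult (lead_coeff (S k)) (\<Prod>i<N k. [:- z k i, 1:])" "\<And>k. S k \<noteq> 0"
    and R: "\<And>k i. i < N k \<Longrightarrow> norm (z k i) \<le> R" "0 \<le> R"
    and ode: "\<And>k. Q * pderiv (pderiv (S k)) + P * pderiv (S k) + V k * S k = 0"
    and V: "\<And>w. (\<lambda>k. poly (V k) w / (of_nat (N k))\<^sup>2) \<longlonglongrightarrow> - poly Vt w"
    and \<mu>: "compact_prob \<mu> R"
    and weak: "\<And>f :: complex \<Rightarrow> complex. continuous_on UNIV f \<Longrightarrow> bounded (range f) \<Longrightarrow>
        (\<lambda>k. \<integral>\<xi>. f \<xi> \<partial>root_counting_measure (S k)) \<longlonglongrightarrow> (\<integral>\<xi>. f \<xi> \<partial>\<mu>)"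
  shows "AE w in lborel. (cauchy_transform \<mu> w)\<^sup>2 = poly Vt w / poly Q w"
proof -
  interpret m: compact_prob \<mu> R by (rule \<mu>)
  define \<nu> where "\<nu> k = root_counting_measure (S k)" for k
  have c: "lead_coeff (S k) \<noteq> 0" for k using S(2) by simp
  have \<nu>: "compact_prob (\<nu> k) R" for k
    unfolding \<nu>_def by (rule compact_prob_root_counting_measure[OF S(1) c N(1) R(1) R(2)])
  have nm [measurable]: "reg_grad e (\<nu> k) \<in> borel_measurable borel" for e k
    by (rule compact_prob.measurable_reg_grad[OF \<nu>])
  define E where "E k w = (\<Sum>i<N k. norm (w - z k i) powr - 2) / (real (N k))\<^sup>2" for k w
  \<comment> \<open>Both error terms are added into one function so that a single subsequence makes
    them vanish together. The power 3/4 is undone pointwise afterwards by the power 4/3.\<close>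
  define u where "u k w = norm (reg_grad 0 (\<nu> k) w - reg_grad 0 \<mu> w) + E k w powr (3/4)" for k w
  have Em [measurable]: "E k \<in> borel_measurable borel" for k unfolding E_def by measurable
  have um [measurable]: "u k \<in> borel_measurable borel" for k unfolding u_def by measurable
  have u0: "u k w \<ge> 0" for k w by (simp add: u_def)
  have cauchy: "cauchy_transform (\<nu> k) w = (\<Sum>i<N k. 1 / (w - z k i)) / of_nat (N k)" for k w
    unfolding cauchy_transform_def \<nu>_def
    by (subst root_counting_measure_integral[OF S(1) c N(1)]) (auto simp: scaleR_conv_of_real divide_inverse mult.commute)
  have ball: "AE w in lborel. norm w \<le> r \<longrightarrow> (cauchy_transform \<mu> w)\<^sup>2 = poly Vt w / poly Q w" if r: "r > 0" for r
  proof -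
    define v where "v k w = u k w * indicator (cball 0 r) w" for k w
    have vm [measurable]: "v k \<in> borel_measurable borel" for k unfolding v_def by measurable
    have split: "(\<integral>\<^sup>+w. ennreal (norm (v k w)) \<partial>lborel)
       = (\<integral>\<^sup>+w. ennreal (norm (reg_grad 0 (\<nu> k) w - reg_grad 0 \<mu> w)) * indicator (cball 0 r) w \<partial>lborel)
       + (\<integral>\<^sup>+w. ennreal (E k w powr (3/4)) * indicator (cball 0 r) w \<partial>lborel)" for k
    proof -
      have "(\<integral>\<^sup>+w. ennreal (norm (v k w)) \<partial>lborel)
       = (\<integral>\<^sup>+w. ennreal (norm (reg_grad 0 (\<nu> k) w - reg_grad 0 \<mu> w)) * indicator (cball 0 r) w
             + ennreal (E k w powr (3/4)) * indicator (cball 0 r) w \<partial>lborel)"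
        unfolding v_def u_def by (intro nn_integral_cong) (simp add: indicator_def)
      also have "\<dots> = (\<integral>\<^sup>+w. ennreal (norm (reg_grad 0 (\<nu> k) w - reg_grad 0 \<mu> w)) * indicator (cball 0 r) w \<partial>lborel)
       + (\<integral>\<^sup>+w. ennreal (E k w powr (3/4)) * indicator (cball 0 r) w \<partial>lborel)"
        by (rule nn_integral_add) measurable
      finally show ?thesis .
    qed
    have Ele: "(\<integral>\<^sup>+w. ennreal (E k w powr (3/4)) * indicator (cball 0 r) w \<partial>lborel)
       \<le> ennreal (riesz_const (3/2) (r + 2 * R) * real (N k) powr - (1/2))" for k
      unfolding E_def by (rule nn_integral_inverse_square_sum_powr[OF N(1) R(1) R(2) r])
    have fin: "(\<integral>\<^sup>+w. ennreal (norm (v k w)) \<partial>lborel) < \<infinity>" for k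
    proof -
      interpret n: compact_prob "\<nu> k" R by (rule \<nu>)
      have i: "integrable lborel (\<lambda>w. norm (reg_grad 0 (\<nu> k) w) * indicator (cball 0 r) w + norm (reg_grad 0 \<mu> w) * indicator (cball 0 r) w)"
        by (intro Bochner_Integration.integrable_add n.integrable_norm_reg_grad m.integrable_norm_reg_grad r)
      have "(\<integral>\<^sup>+w. ennreal (norm (reg_grad 0 (\<nu> k) w - reg_grad 0 \<mu> w)) * indicator (cball 0 r) w \<partial>lborel)
        \<le> (\<integral>\<^sup>+w. ennreal (norm (norm (reg_grad 0 (\<nu> k) w) * indicator (cball 0 r) w + norm (reg_grad 0 \<mu> w) * indicator (cball 0 r) w)) \<partial>lborel)"
        by (intro nn_integral_mono) (auto simp: indicator_def intro!: ennreal_leI norm_triangle_ineq4 simp flip: ennreal_plus)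
      also have "\<dots> < \<infinity>" using i by (simp add: integrable_iff_bounded)
      finally show ?thesis
        unfolding split using le_less_trans[OF Ele ennreal_less_top, of k] by (simp add: ennreal_add_eq_top less_top[symmetric])
    qed
    have vi: "integrable lborel (v k)" for k
      using fin by (intro integrableI_bounded) auto
    have lim: "(\<lambda>k. \<integral>\<^sup>+w. ennreal (norm (v k w)) \<partial>lborel) \<longlonglongrightarrow> 0"
    proof -
      have "(\<lambda>k. real (N k) powr - (1/2)) \<longlonglongrightarrow> 0"
        by (intro tendsto_neg_powr filterlim_compose[OF filterlim_real_sequentially N(2)]) auto
      from tendsto_mult_right_zero[OF this]
      have "(\<lambda>k. riesz_const (3/2) (r + 2 * R) * real (N k) powr - (1/2)) \<longlonglongrightarrow> 0" .
      from nn_integral_tendsto_0_mult[OF Ele this]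
      have 1: "(\<lambda>k. \<integral>\<^sup>+w. ennreal (E k w powr (3/4)) * indicator (cball 0 r) w \<partial>lborel) \<longlonglongrightarrow> 0" .
      have 2: "(\<lambda>k. \<integral>\<^sup>+w. ennreal (norm (reg_grad 0 (\<nu> k) w - reg_grad 0 \<mu> w)) * indicator (cball 0 r) w \<partial>lborel) \<longlonglongrightarrow> 0"
        by (rule reg_grad_tendsto_L1[OF \<nu> \<mu> r]) (unfold \<nu>_def, rule weak)
      from tendsto_add[OF 2 1] show ?thesis unfolding split by simp
    qed
    have "(\<lambda>k. \<integral>w. norm (v k w) \<partial>lborel) \<longlonglongrightarrow> 0"
    proof -
      have "(\<integral>w. norm (v k w) \<partial>lborel) = enn2real (\<integral>\<^sup>+w. ennreal (norm (v k w)) \<partial>lborel)" for k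
        by (rule integral_eq_nn_integral) auto
      moreover have "(\<lambda>k. enn2real (\<integral>\<^sup>+w. ennreal (norm (v k w)) \<partial>lborel)) \<longlonglongrightarrow> 0"
        using lim by (intro tendsto_enn2real) simp_all
      ultimately show ?thesis by simp
    qed
    from tendsto_L1_AE_subseq[OF vi this]
    obtain s where s: "strict_mono s" "AE w in lborel. (\<lambda>k. v (s k) w) \<longlonglongrightarrow> 0" by blast
    \<comment> \<open>The roots of all the solutions form a countable, hence null, set; off it the
      equation may be divided by \<open>S k\<close>.\<close>
    have "countable (\<Union>k. {w. poly (S k) w = 0})"
      using poly_roots_finite[OF S(2)] by (intro countable_UN) (auto intro: countable_finite)
    then have nr: "AE w in lborel. w \<notin> (\<Union>k. {w. poly (S k) w = 0})"
      by (intro AE_not_in countable_imp_null_set_lborel)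
    have "countable {w. poly Q w = 0}" using poly_roots_finite[OF Q] by (rule countable_finite)
    then have nQ: "AE w in lborel. w \<notin> {w. poly Q w = 0}"
      by (intro AE_not_in countable_imp_null_set_lborel)
    show ?thesis
      using s(2) nr nQ
    proof (eventually_elim, intro impI)
      fix w assume l: "(\<lambda>k. v (s k) w) \<longlonglongrightarrow> 0" and nr: "w \<notin> (\<Union>k. {w. poly (S k) w = 0})" and nQ: "w \<notin> {w. poly Q w = 0}"
        and wr: "norm w \<le> r"
      have ul: "(\<lambda>k. u (s k) w) \<longlonglongrightarrow> 0" using l wr by (simp add: v_def)
      have "(\<lambda>k. reg_grad 0 (\<nu> (s k)) w - reg_grad 0 \<mu> w) \<longlonglongrightarrow> 0"
        by (rule Lim_null_comparison[OF _ ul]) (auto simp: u_def)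
      then have "(\<lambda>k. reg_grad 0 (\<nu> (s k)) w) \<longlonglongrightarrow> reg_grad 0 \<mu> w" by (rule LIM_zero_cancel)
      from tendsto_cnj[OF this]
      have Cl: "(\<lambda>k. cauchy_transform (\<nu> (s k)) w) \<longlonglongrightarrow> cauchy_transform \<mu> w" by (simp add: reg_grad_0)
      have "(\<lambda>k. E (s k) w powr (3/4)) \<longlonglongrightarrow> 0"
        by (rule Lim_null_comparison[OF _ ul]) (auto simp: u_def)
      then have "(\<lambda>k. (E (s k) w powr (3/4)) powr (4/3)) \<longlonglongrightarrow> 0"
        by (rule tendsto_zero_powrI[OF _ tendsto_const]) auto
      moreover have E0: "E k w \<ge> 0" for k unfolding E_def by (intro divide_nonneg_nonneg sum_nonneg) auto
      ultimately have El: "(\<lambda>k. E (s k) w) \<longlonglongrightarrow> 0" by (simp add: powr_powr)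
      \<comment> \<open>This is -C'/n for the Cauchy transform C of the k-th measure with n =
        \<open>N k\<close>, so that S''/(n^2 S) = C^2 - F. Its modulus is at most
        \<open>E\<close>.\<close>
      define F where "F k = (\<Sum>i<N k. 1 / (w - z k i)\<^sup>2) / (of_nat (N k))\<^sup>2" for k
      have wz: "w \<noteq> z k i" if "i < N k" for k i
      proof
        assume "w = z k i"
        then have "poly (\<Prod>i<N k. [:- z k i, 1:]) w = 0" using that by (auto simp: poly_prod prod_zero_iff)
        then have "poly (S k) w = 0" by (subst S(1)) simp
        then show False using nr by auto
      qed
      have "(\<lambda>k. F (s k)) \<longlonglongrightarrow> 0"
      proof (rule Lim_null_comparison[OF always_eventually El], intro allI)
        fix k
        let ?k = "s k"
        have "norm (F ?k) \<le> (\<Sum>i<N ?k. norm (1 / (w - z ?k i)\<^sup>2)) / (real (N ?k))\<^sup>2"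
          unfolding F_def norm_divide norm_power norm_of_nat by (intro divide_right_mono norm_sum[THEN order.trans]) (auto simp: norm_divide norm_power)
        also have "(\<Sum>i<N ?k. norm (1 / (w - z ?k i)\<^sup>2)) = (\<Sum>i<N ?k. norm (w - z ?k i) powr - 2)"
          using wz by (intro sum.cong refl) (simp add: norm_divide norm_power powr_minus_divide)
        finally show "norm (F ?k) \<le> E ?k w" by (simp add: E_def)
      qed
      note Fl = this
      \<comment> \<open>The Riccati equation at \<open>w\<close>, obtained by dividing the
        differential equation by n^2 S.\<close>
      have eq: "poly Q w * ((cauchy_transform (\<nu> k) w)\<^sup>2 - F k) + poly P w * (cauchy_transform (\<nu> k) w / of_nat (N k))
          + poly (V k) w / (of_nat (N k))\<^sup>2 = 0" for k
      proof -
        let ?T = "\<Prod>i<N k. [:- z k i, 1:]"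
        define s1 where "s1 = (\<Sum>i<N k. 1 / (w - z k i))"
        define s2 where "s2 = (\<Sum>i<N k. 1 / (w - z k i)\<^sup>2)"
        define n where "n = (of_nat (N k) :: complex)"
        have n: "n \<noteq> 0" using N(1)[of k] by (simp add: n_def)
        have d: "poly (pderiv ?T) w = poly ?T w * s1" "poly (pderiv (pderiv ?T)) w = poly ?T w * (s1\<^sup>2 - s2)"
          unfolding s1_def s2_def by (rule poly_pderiv_prod_roots; use wz in auto)+
        have S0: "poly (S k) w \<noteq> 0" using nr by auto
        have pS: "poly (S k) w = lead_coeff (S k) * poly ?T w"
          by (subst S(1)) simp
        have "pderiv (S k) = smult (lead_coeff (S k)) (pderiv ?T)" by (subst S(1)) (simp only: pderiv_smult)
        then have pS1: "poly (pderiv (S k)) w = poly (S k) w * s1" by (simp add: pS d)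
        have "pderiv (pderiv (S k)) = smult (lead_coeff (S k)) (pderiv (pderiv ?T))" by (subst S(1)) (simp only: pderiv_smult)
        then have pS2: "poly (pderiv (pderiv (S k))) w = poly (S k) w * (s1\<^sup>2 - s2)" by (simp add: pS d)
        have "poly (Q * pderiv (pderiv (S k)) + P * pderiv (S k) + V k * S k) w = 0" by (simp only: ode poly_0)
        then have "poly (S k) w * (poly Q w * (s1\<^sup>2 - s2) + poly P w * s1 + poly (V k) w) = 0"
          by (simp add: pS1 pS2 algebra_simps)
        then have "poly Q w * (s1\<^sup>2 - s2) + poly P w * s1 + poly (V k) w = 0" using S0 by simp
        moreover have "poly Q w * ((s1 / n)\<^sup>2 - s2 / n\<^sup>2) + poly P w * (s1 / n / n) + poly (V k) w / n\<^sup>2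
            = (poly Q w * (s1\<^sup>2 - s2) + poly P w * s1 + poly (V k) w) / n\<^sup>2"
          using n by (simp add: power_divide add_divide_distrib diff_divide_distrib[symmetric] power2_eq_square)
        ultimately show ?thesis
          unfolding cauchy F_def s1_def[symmetric] s2_def[symmetric] n_def[symmetric] by simp
      qed
      have Ns: "filterlim (\<lambda>k. N (s k)) at_top sequentially"
        by (rule filterlim_compose[OF N(2) filterlim_subseq[OF s(1)]])
      have "(\<lambda>k. inverse (of_nat (N (s k)) :: complex)) \<longlonglongrightarrow> 0"
        by (rule filterlim_compose[OF lim_inverse_n Ns])
      from tendsto_mult[OF Cl this]
      have CN: "(\<lambda>k. cauchy_transform (\<nu> (s k)) w / of_nat (N (s k))) \<longlonglongrightarrow> 0" by (simp add: divide_inverse)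
      have Vl: "(\<lambda>k. poly (V (s k)) w / (of_nat (N (s k)))\<^sup>2) \<longlonglongrightarrow> - poly Vt w"
        using LIMSEQ_subseq_LIMSEQ[OF V s(1)] by (simp add: o_def)
      have "(\<lambda>k. poly Q w * ((cauchy_transform (\<nu> (s k)) w)\<^sup>2 - F (s k)) + poly P w * (cauchy_transform (\<nu> (s k)) w / of_nat (N (s k)))
          + poly (V (s k)) w / (of_nat (N (s k)))\<^sup>2)
         \<longlonglongrightarrow> poly Q w * ((cauchy_transform \<mu> w)\<^sup>2 - 0) + poly P w * 0 + (- poly Vt w)"
        by (intro tendsto_intros Cl Fl CN Vl)
      then have "(\<lambda>k. 0::complex) \<longlonglongrightarrow> poly Q w * (cauchy_transform \<mu> w)\<^sup>2 - poly Vt w" unfolding eq by simp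
      then have "poly Q w * (cauchy_transform \<mu> w)\<^sup>2 - poly Vt w = 0" by (simp add: LIMSEQ_const_iff)
      then show "(cauchy_transform \<mu> w)\<^sup>2 = poly Vt w / poly Q w" using nQ by (simp add: field_simps)
    qed
  qed
  have "AE w in lborel. \<forall>n. norm w \<le> real (Suc n) \<longrightarrow> (cauchy_transform \<mu> w)\<^sup>2 = poly Vt w / poly Q w"
    unfolding AE_all_countable using ball by simp
  then show ?thesis
  proof eventually_elim
    fix w assume *: "\<forall>n. norm w \<le> real (Suc n) \<longrightarrow> (cauchy_transform \<mu> w)\<^sup>2 = poly Vt w / poly Q w"
    obtain n where "norm w < real n" using reals_Archimedean2 by blast
    then show "(cauchy_transform \<mu> w)\<^sup>2 = poly Vt w / poly Q w" using *[rule_format, of n] by simp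
  qed
qed

text \<open>Every sequence of large indices in N has a subsequence along which the root-counting
  measures converge to a solution of the limit equation. Uniqueness makes all these limits equal, so
  the whole family converges. The filter \<open>inf at_top (principal N)\<close> is the passage to
  infinity through N, and uniqueness is stated among compactly supported probability measures, for
  which the Cauchy transform is defined.\<close>

theorem mainTheorem2:
  fixes Q P Vt :: "complex poly"
    and N :: "nat set"
    and V S :: "nat \<Rightarrow> complex poly"
  assumes Q_monic_cubic: "degree Q = 3" "lead_coeff Q = 1"
    and P_deg: "degree P \<le> 2"
    and N_inf: "infinite N"
    and V_deg: "\<And>n. n \<in> N \<Longrightarrow> degree (V n) = 1"
    and S_deg: "\<And>n. n \<in> N \<Longrightarrow> degree (S n) = n"
    and S_sol: "\<And>n. n \<in> N \<Longrightarrow>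
                  Q * pderiv (pderiv (S n)) + P * pderiv (S n) + V n * S n = 0"
    and Vt_monic_linear: "degree Vt = 1" "lead_coeff Vt = 1"
    and V_conv: "\<And>i. ((\<lambda>n. coeff (smult (inverse (lead_coeff (V n))) (V n)) i)
                        \<longlongrightarrow> coeff Vt i) (inf at_top (principal N))"
  shows "\<exists>\<mu>. sets \<mu> = sets borel \<and> prob_space \<mu>
            \<and> (\<exists>K. compact K \<and> emeasure \<mu> (UNIV - K) = 0)
            \<and> (AE z in lborel. (cauchy_transform \<mu> z)\<^sup>2 = poly Vt z / poly Q z)
            \<and> (\<forall>\<mu>'. sets \<mu>' = sets borel \<and> prob_space \<mu>'
                    \<and> (\<exists>K. compact K \<and> emeasure \<mu>' (UNIV - K) = 0)
                    \<and> (AE z in lborel. (cauchy_transform \<mu>' z)\<^sup>2 = poly Vt z / poly Q z)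
                    \<longrightarrow> \<mu>' = \<mu>)
            \<and> weak_conv_along (\<lambda>n. root_counting_measure (S n)) \<mu> (inf at_top (principal N))"
proof -
  let ?F = "inf at_top (principal N)"
  have Q0: "Q \<noteq> 0" and Vt0: "Vt \<noteq> 0" using Q_monic_cubic Vt_monic_linear by auto
  obtain R n0 where R: "R > 0" and roots: "\<And>V S w. Q * pderiv (pderiv S) + P * pderiv S + V * S = 0 \<Longrightarrow> degree S \<ge> n0 \<Longrightarrow> poly S w = 0 \<Longrightarrow> norm w \<le> R"
    using ode_roots_bounded[OF Q_monic_cubic P_deg] by blast
  \<comment> \<open>From \<open>n0\<close> on all roots lie in the disc; n \<ge> 2 is required by
    the formula for the leading coefficient of V.\<close>
  define N' where "N' = {n \<in> N. max n0 2 \<le> n}"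
  define \<nu> where "\<nu> n = root_counting_measure (S n)" for n
  have S0: "S n \<noteq> 0" if "n \<in> N'" for n using S_deg[of n] that by (auto simp: N'_def)
  have "\<forall>n. \<exists>z. n \<in> N' \<longrightarrow> S n = smult (lead_coeff (S n)) (\<Prod>i<n. [:- z i, 1:])"
  proof
    fix n
    show "\<exists>z. n \<in> N' \<longrightarrow> S n = smult (lead_coeff (S n)) (\<Prod>i<n. [:- z i, 1:])"
    proof (cases "n \<in> N'")
      case True
      then have "degree (S n) = n" using S_deg by (simp add: N'_def)
      then show ?thesis using complex_poly_roots_list[OF S0[OF True]] by metis
    qed simp
  qed
  from choice[OF this] obtain z where z: "\<And>n. n \<in> N' \<Longrightarrow> S n = smult (lead_coeff (S n)) (\<Prod>i<n. [:- z n i, 1:])"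
    by blast
  have zR: "norm (z n i) \<le> R" if n: "n \<in> N'" and i: "i < n" for n i
  proof (rule roots)
    show "Q * pderiv (pderiv (S n)) + P * pderiv (S n) + V n * S n = 0" "degree (S n) \<ge> n0"
      using S_sol S_deg n by (auto simp: N'_def)
    have "poly (\<Prod>i<n. [:- z n i, 1:]) (z n i) = 0" using i by (auto simp: poly_prod prod_zero_iff)
    then show "poly (S n) (z n i) = 0" by (subst z[OF n]) simp
  qed
  have pos: "n > 0" if "n \<in> N'" for n using that by (auto simp: N'_def)
  have int: "(\<integral>x. f x \<partial>\<nu> n) = (\<Sum>i<n. f (z n i)) /\<^sub>R real n"
    if "n \<in> N'" "f \<in> borel_measurable borel" for n and f :: "complex \<Rightarrow> 'b::{banach, second_countable_topology}"
    unfolding \<nu>_def by (rule root_counting_measure_integral[OF z[OF that(1)] _ pos[OF that(1)] that(2)]) (use S0[OF that(1)] in simp)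

  \<comment> \<open>Stated for arbitrary sequences in \<open>N'\<close> because it is applied twice:
    to all of \<open>N'\<close> for existence, and to a set of exceptional indices for convergence.
    The radius 6R comes from the covering curve.\<close>
  have key: "\<exists>r \<mu>. strict_mono r \<and> compact_prob \<mu> (6 * R)
       \<and> (AE w in lborel. (cauchy_transform \<mu> w)\<^sup>2 = poly Vt w / poly Q w)
       \<and> (\<forall>f :: complex \<Rightarrow> real. continuous_on UNIV f \<and> bounded (range f) \<longrightarrow> (\<lambda>k. \<integral>x. f x \<partial>\<nu> (s (r k))) \<longlonglongrightarrow> (\<integral>x. f x \<partial>\<mu>))"
    if s: "strict_mono s" "\<And>k. s k \<in> N'" for s :: "nat \<Rightarrow> nat"
  proof -
    obtain r \<mu> where r: "strict_mono (r :: nat \<Rightarrow> nat)" and \<mu>: "prob_space \<mu>" "sets \<mu> = sets borel" "AE \<xi> in \<mu>. norm \<xi> \<le> 6 * R"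
      and lim: "\<And>f :: complex \<Rightarrow> complex. continuous_on UNIV f \<Longrightarrow> bounded (range f) \<Longrightarrow>
       (\<lambda>k. (\<Sum>i<s (r k). f (z (s (r k)) i)) /\<^sub>R real (s (r k))) \<longlonglongrightarrow> (\<integral>\<xi>. f \<xi> \<partial>\<mu>)"
      by (rule empirical_measures_convergent_subseq[where N = s and z = "\<lambda>k. z (s k)", OF pos[OF s(2)] zR[OF s(2)] R])
         (assumption, rule that)
    have lim: "(\<lambda>k. \<integral>\<xi>. f \<xi> \<partial>\<nu> (s (r k))) \<longlonglongrightarrow> (\<integral>\<xi>. f \<xi> \<partial>\<mu>)"
      if "continuous_on UNIV f" "bounded (range f)" for f :: "complex \<Rightarrow> complex"
      using lim[OF that] by (simp add: int[OF s(2)] borel_measurable_continuous_onI[OF that(1)])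
    have cp: "compact_prob \<mu> (6 * R)" by (rule compact_prob.intro) (use \<mu> R in auto)
    have sr: "strict_mono (\<lambda>k. s (r k))" using strict_mono_o[OF s(1) r] by (simp add: o_def)
    have sr_top: "filterlim (\<lambda>k. s (r k)) at_top sequentially" by (rule filterlim_subseq[OF sr])
    have sN: "s k \<in> N" "s k \<ge> 2" for k using s(2)[of k] by (auto simp: N'_def)
    have srF: "filterlim (\<lambda>k. s (r k)) ?F sequentially"
      using sr_top sN by (auto simp: filterlim_inf filterlim_principal)
    have ae: "AE w in lborel. (cauchy_transform \<mu> w)\<^sup>2 = poly Vt w / poly Q w"
    proof (rule limit_square_eq[where N = "\<lambda>k. s (r k)" and S = "\<lambda>k. S (s (r k))" and z = "\<lambda>k. z (s (r k))"
          and V = "\<lambda>k. V (s (r k))" and P = P and R = "6 * R"])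
      show "Q \<noteq> 0" by (rule Q0)
      show "s (r k) > 0" "S (s (r k)) = smult (lead_coeff (S (s (r k)))) (\<Prod>i<s (r k). [:- z (s (r k)) i, 1:])" "S (s (r k)) \<noteq> 0" for k
        by (rule pos[OF s(2)], rule z[OF s(2)], rule S0[OF s(2)])
      show "norm (z (s (r k)) i) \<le> 6 * R" if "i < s (r k)" for k i using zR[OF s(2) that] R by simp
      show "Q * pderiv (pderiv (S (s (r k)))) + P * pderiv (S (s (r k))) + V (s (r k)) * S (s (r k)) = 0" for k
        by (rule S_sol[OF sN(1)])
      show "compact_prob \<mu> (6 * R)" by (rule cp)
      show "(\<lambda>k. \<integral>\<xi>. f \<xi> \<partial>root_counting_measure (S (s (r k)))) \<longlonglongrightarrow> (\<integral>\<xi>. f \<xi> \<partial>\<mu>)"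
        if "continuous_on UNIV f" "bounded (range f)" for f :: "complex \<Rightarrow> complex"
        using lim[OF that] by (simp add: \<nu>_def)
      fix w
      let ?n = "\<lambda>k. s (r k)"
      let ?c = "\<lambda>k i. coeff (smult (inverse (lead_coeff (V (?n k)))) (V (?n k))) i"
      have Vexp: "poly (V (?n k)) w = lead_coeff (V (?n k)) * (?c k 0 + ?c k 1 * w)" for k
      proof -
        have "degree (V (?n k)) = 1" by (rule V_deg[OF sN(1)])
        then have "lead_coeff (V (?n k)) \<noteq> 0" by (metis degree_0 leading_coeff_0_iff zero_neq_one)
        then show ?thesis using poly_eq_sum_le[of "V (?n k)" 1 w] \<open>degree (V (?n k)) = 1\<close>
          by (simp add: algebra_simps)
      qed
      \<comment> \<open>The exact value -(n(n-1) + p_2 n), with p_2 the coefficient of z^2 in P,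
        divided by n^2; it tends to -1.\<close>
      have lead: "lead_coeff (V (?n k)) / (of_nat (?n k))\<^sup>2 = - (1 - inverse (of_nat (?n k)) + coeff P 2 * inverse (of_nat (?n k)))" for k
      proof -
        have n0: "(of_nat (?n k) :: complex) \<noteq> 0" using sN(2)[of "r k"] by auto
        have "lead_coeff (V (?n k)) = - (of_nat (?n k) * of_nat (?n k - 1) + coeff P 2 * of_nat (?n k))"
          by (rule lead_coeff_van_vleck[OF Q_monic_cubic P_deg V_deg[OF sN(1)] S_deg[OF sN(1)] sN(2) S_sol[OF sN(1)]])
        also have "of_nat (?n k - 1) = (of_nat (?n k) - 1 :: complex)" using sN(2)[of "r k"] by (simp add: of_nat_diff)
        finally show ?thesis using n0 by (simp add: field_simps power2_eq_square)
      qed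
      have inv: "(\<lambda>k. inverse (of_nat (?n k)) :: complex) \<longlonglongrightarrow> 0" by (rule filterlim_compose[OF lim_inverse_n sr_top])
      have cl: "(\<lambda>k. ?c k i) \<longlonglongrightarrow> coeff Vt i" for i by (rule filterlim_compose[OF V_conv srF])
      have "(\<lambda>k. - (1 - inverse (of_nat (?n k)) + coeff P 2 * inverse (of_nat (?n k))) * (?c k 0 + ?c k 1 * w))
          \<longlonglongrightarrow> - (1 - 0 + coeff P 2 * 0) * (coeff Vt 0 + coeff Vt 1 * w)"
        by (intro tendsto_mult tendsto_minus tendsto_add tendsto_diff tendsto_const inv cl)
      moreover have "poly Vt w = coeff Vt 0 + coeff Vt 1 * w"
        using poly_eq_sum_le[of Vt 1 w] Vt_monic_linear by simp
      moreover have "poly (V (?n k)) w / (of_nat (?n k))\<^sup>2 = - (1 - inverse (of_nat (?n k)) + coeff P 2 * inverse (of_nat (?n k))) * (?c k 0 + ?c k 1 * w)" for k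
        unfolding lead[symmetric] Vexp by simp
      ultimately show "(\<lambda>k. poly (V (?n k)) w / (of_nat (?n k))\<^sup>2) \<longlonglongrightarrow> - poly Vt w" by simp
    qed (use R sr_top in auto)
    have real: "(\<lambda>k. \<integral>x. f x \<partial>\<nu> (s (r k))) \<longlonglongrightarrow> (\<integral>x. f x \<partial>\<mu>)" if f: "continuous_on UNIV f" "bounded (range f)" for f :: "complex \<Rightarrow> real"
    proof -
      have "bounded (range (\<lambda>x. complex_of_real (f x)))" using f(2) by (auto simp: bounded_iff)
      then have "(\<lambda>k. \<integral>x. complex_of_real (f x) \<partial>\<nu> (s (r k))) \<longlonglongrightarrow> (\<integral>x. complex_of_real (f x) \<partial>\<mu>)"
        by (intro lim continuous_intros f(1))
      then show ?thesis by (simp add: tendsto_of_real_iff)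
    qed
    show ?thesis using r cp ae real by blast
  qed

  have inf': "infinite N'"
  proof
    assume "finite N'"
    then have "finite (N' \<union> {..<max n0 2})" by simp
    moreover have "N \<subseteq> N' \<union> {..<max n0 2}" by (auto simp: N'_def)
    ultimately show False using N_inf finite_subset by blast
  qed
  obtain r \<mu> where cp: "compact_prob \<mu> (6 * R)" and ae: "AE w in lborel. (cauchy_transform \<mu> w)\<^sup>2 = poly Vt w / poly Q w"
    using key[OF strict_mono_enumerate[OF inf'] enumerate_in_set[OF inf']] by blast
  have supp: "emeasure \<tau> (UNIV - cball 0 (6 * R)) = 0" if "compact_prob \<tau> (6 * R)" for \<tau>
  proof -
    interpret compact_prob \<tau> "6 * R" by fact
    have "UNIV - cball 0 (6 * R) \<in> null_sets \<tau>"
      using supp_mu by (subst AE_iff_null_sets) (auto simp: sets_mu elim: eventually_mono)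
    then show ?thesis by auto
  qed
  have unique: "\<mu>' = \<mu>" if "sets \<mu>' = sets borel" "prob_space \<mu>'" "compact K" "emeasure \<mu>' (UNIV - K) = 0"
     "AE z in lborel. (cauchy_transform \<mu>' z)\<^sup>2 = poly Vt z / poly Q z" for \<mu>' K
    by (rule cauchy_transform_square_unique[OF Vt0 Q0 that compact_prob.sets_mu[OF cp] compact_prob.prob_mu[OF cp] compact_cball supp[OF cp] ae])
  have weak: "weak_conv_along (\<lambda>n. root_counting_measure (S n)) \<mu> ?F"
    unfolding weak_conv_along_def \<nu>_def[symmetric]
  proof (intro allI impI, rule ccontr)
    fix f :: "complex \<Rightarrow> real" assume f: "continuous_on UNIV f \<and> bounded (range f)"
    assume "\<not> ((\<lambda>n. \<integral>x. f x \<partial>\<nu> n) \<longlongrightarrow> (\<integral>x. f x \<partial>\<mu>)) ?F"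
    then obtain e where e: "e > 0" "\<not> eventually (\<lambda>n. dist (\<integral>x. f x \<partial>\<nu> n) (\<integral>x. f x \<partial>\<mu>) < e) ?F"
      by (auto simp: tendsto_iff)
    \<comment> \<open>The indices at which the integral of \<open>f\<close> stays at distance e from
      the expected limit. If they were infinitely many, a subsequence of them would converge to a
      second solution, which uniqueness identifies with \<open>\<mu>\<close>.\<close>
    define B where "B = {n \<in> N'. \<not> dist (\<integral>x. f x \<partial>\<nu> n) (\<integral>x. f x \<partial>\<mu>) < e}"
    have "infinite B"
    proof
      assume "finite B"
      then obtain m where m: "\<And>n. n \<in> B \<Longrightarrow> n < m" using finite_nat_set_iff_bounded by auto
      have "eventually (\<lambda>n. dist (\<integral>x. f x \<partial>\<nu> n) (\<integral>x. f x \<partial>\<mu>) < e) ?F"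
        unfolding eventually_inf_principal
        using eventually_ge_at_top[of "max m (max n0 2)"]
        by eventually_elim (use m in \<open>force simp: B_def N'_def\<close>)
      then show False using e by simp
    qed
    have enB: "enumerate B k \<in> B" for k by (rule enumerate_in_set[OF \<open>infinite B\<close>])
    then have "enumerate B k \<in> N'" for k by (auto simp: B_def)
    from key[OF strict_mono_enumerate[OF \<open>infinite B\<close>] this]
    obtain r' \<mu>' where r': "compact_prob \<mu>' (6 * R)" "AE w in lborel. (cauchy_transform \<mu>' w)\<^sup>2 = poly Vt w / poly Q w"
      "(\<lambda>k. \<integral>x. f x \<partial>\<nu> (enumerate B (r' k))) \<longlonglongrightarrow> (\<integral>x. f x \<partial>\<mu>')" using f by blast
    have "\<mu>' = \<mu>"
      by (rule unique[OF compact_prob.sets_mu[OF r'(1)] compact_prob.prob_mu[OF r'(1)] compact_cball supp[OF r'(1)] r'(2)])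
    then have "eventually (\<lambda>k. dist (\<integral>x. f x \<partial>\<nu> (enumerate B (r' k))) (\<integral>x. f x \<partial>\<mu>) < e) sequentially"
      using r'(3) e(1) by (auto simp: tendsto_iff)
    then obtain k where "dist (\<integral>x. f x \<partial>\<nu> (enumerate B (r' k))) (\<integral>x. f x \<partial>\<mu>) < e" by (auto simp: eventually_sequentially)
    then show False using enB[of "r' k"] by (simp add: B_def)
  qed
  show ?thesis
    using compact_prob.sets_mu[OF cp] compact_prob.prob_mu[OF cp] compact_cball supp[OF cp] ae unique weak by blast
qed

end
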